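(* Let $Z$ be a Banach space. Then an operator $T\in B(\mathfrak{C}_1,Z)$ is Dunford-Pettis if and only if it is $\ell_2$-compact.
   Context: $B(X,Y)$ denotes the bounded linear operators from $X$ to $Y$. $\mathfrak{C}_1$ is the space of trace class operators on a separable infinite-dimensional Hilbert space, with the trace norm. An operator $T\in B(X,Y)$ is Dunford-Pettis if it maps weakly null sequences to norm null sequences (equivalently, weakly compact sets to relatively compact sets). $T\in B(X,Y)$ is $\ell_2$-compact if $T|_{Z'}$ is compact whenever $Z'\subset X$ is a closed subspace isomorphic to $\ell_2$. *)

theory Defs
  imports "HOL-Analysis.Analysis" "HOL-Library.Function_Algebras"
begin

text \<open>Complex vector spaces, complex Banach spaces and complex Hilbert spaces.\<close>

class complex_vector = ab_group_add +
  fixes scaleC :: "complex \<Rightarrow> 'a \<Rightarrow> 'a" (infixr \<open>*\<^sub>C\<close> 75)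
  assumes scaleC_add_right: "c *\<^sub>C (x + y) = c *\<^sub>C x + c *\<^sub>C y"
    and scaleC_add_left: "(c + d) *\<^sub>C x = c *\<^sub>C x + d *\<^sub>C x"
    and scaleC_scaleC: "c *\<^sub>C d *\<^sub>C x = (c * d) *\<^sub>C x"
    and scaleC_one: "1 *\<^sub>C x = x"

global_interpretation complex_vector: vector_space "scaleC :: complex \<Rightarrow> 'a \<Rightarrow> 'a::complex_vector"
  by unfold_locales (rule scaleC_add_right scaleC_add_left scaleC_scaleC scaleC_one)+

class complex_normed_vector = complex_vector + real_normed_vector +
  assumes scaleR_scaleC: "r *\<^sub>R x = complex_of_real r *\<^sub>C x"
    and norm_scaleC: "norm (c *\<^sub>C x) = cmod c * norm x"

class complex_banach = complex_normed_vector + complete_space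

class complex_inner = complex_normed_vector +
  fixes cinner :: "'a \<Rightarrow> 'a \<Rightarrow> complex"
  assumes cinner_commute: "cinner x y = cnj (cinner y x)"
    and cinner_add_left: "cinner (x + y) z = cinner x z + cinner y z"
    and cinner_scaleC_left: "cinner (c *\<^sub>C x) y = c * cinner x y"
    and cinner_self: "cinner x x = complex_of_real ((norm x)\<^sup>2)"

class chilbert_space = complex_inner + complete_space

instantiation complex :: chilbert_space
begin
definition "c *\<^sub>C (x::complex) = c * x"
definition "cinner (x::complex) y = x * cnj y"
instance
  by standard
    (auto simp: scaleC_complex_def cinner_complex_def algebra_simps scaleR_conv_of_real
      norm_mult complex_norm_square simp del: of_real_power)
end

instance complex :: complex_banach ..

instantiation "fun" :: (type, complex_vector) complex_vector
begin
definition "c *\<^sub>C f = (\<lambda>x. c *\<^sub>C f x)"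
instance
  by standard
    (simp_all add: scaleC_fun_def fun_eq_iff scaleC_add_right scaleC_add_left scaleC_scaleC scaleC_one)
end


text \<open>
  A normed space that is not a type is given by a carrier \<open>V\<close>, a complex subspace of
  an ambient complex vector space, and a function \<open>N\<close> which is a norm on \<open>V\<close>.
  Values outside the carrier are never referred to.
\<close>

definition bounded_clinear_on ::
    "'a::complex_vector set \<Rightarrow> ('a \<Rightarrow> real) \<Rightarrow> ('a \<Rightarrow> 'b::complex_normed_vector) \<Rightarrow> bool" where
  "bounded_clinear_on V N f \<longleftrightarrow>
     (\<forall>x\<in>V. \<forall>y\<in>V. f (x + y) = f x + f y) \<and>
     (\<forall>c. \<forall>x\<in>V. f (c *\<^sub>C x) = c *\<^sub>C f x) \<and>
     (\<exists>K. \<forall>x\<in>V. norm (f x) \<le> K * N x)"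

definition weakly_null_on ::
    "'a::complex_vector set \<Rightarrow> ('a \<Rightarrow> real) \<Rightarrow> (nat \<Rightarrow> 'a) \<Rightarrow> bool" where
  "weakly_null_on V N x \<longleftrightarrow>
     range x \<subseteq> V \<and>
     (\<forall>\<phi>::'a \<Rightarrow> complex. bounded_clinear_on V N \<phi> \<longrightarrow> (\<lambda>n. \<phi> (x n)) \<longlonglongrightarrow> 0)"

definition dunford_pettis_on ::
    "'a::complex_vector set \<Rightarrow> ('a \<Rightarrow> real) \<Rightarrow> ('a \<Rightarrow> 'b::complex_normed_vector) \<Rightarrow> bool" where
  "dunford_pettis_on V N T \<longleftrightarrow>
     (\<forall>x. weakly_null_on V N x \<longrightarrow> (\<lambda>n. T (x n)) \<longlonglongrightarrow> 0)"

definition closed_csubspace_on ::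
    "'a::complex_vector set \<Rightarrow> ('a \<Rightarrow> real) \<Rightarrow> 'a set \<Rightarrow> bool" where
  "closed_csubspace_on V N W \<longleftrightarrow>
     complex_vector.subspace W \<and> W \<subseteq> V \<and>
     (\<forall>x\<in>V. (\<forall>\<epsilon>>0. \<exists>w\<in>W. N (x - w) < \<epsilon>) \<longrightarrow> x \<in> W)"

definition isomorphic_on ::
    "'a::complex_vector set \<Rightarrow> ('a \<Rightarrow> real) \<Rightarrow> 'b::complex_vector set \<Rightarrow> ('b \<Rightarrow> real) \<Rightarrow> bool" where
  "isomorphic_on V N W M \<longleftrightarrow>
     (\<exists>J. bij_betw J V W \<and>
        (\<forall>x\<in>V. \<forall>y\<in>V. J (x + y) = J x + J y) \<and>
        (\<forall>c. \<forall>x\<in>V. J (c *\<^sub>C x) = c *\<^sub>C J x) \<and>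
        (\<exists>K. \<forall>x\<in>V. M (J x) \<le> K * N x) \<and>
        (\<exists>K. \<forall>x\<in>V. N x \<le> K * M (J x)))"

definition ell2 :: "(nat \<Rightarrow> complex) set" where
  "ell2 = {x. summable (\<lambda>n. (cmod (x n))\<^sup>2)}"

definition ell2_norm :: "(nat \<Rightarrow> complex) \<Rightarrow> real" where
  "ell2_norm x = sqrt (\<Sum>n. (cmod (x n))\<^sup>2)"

definition compact_operator_on ::
    "'a::complex_vector set \<Rightarrow> ('a \<Rightarrow> real) \<Rightarrow> ('a \<Rightarrow> 'b::complex_normed_vector) \<Rightarrow> bool" where
  "compact_operator_on W N T \<longleftrightarrow> compact (closure (T ` {x \<in> W. N x \<le> 1}))"

definition ell2_compact_on ::
    "'a::complex_vector set \<Rightarrow> ('a \<Rightarrow> real) \<Rightarrow> ('a \<Rightarrow> 'b::complex_normed_vector) \<Rightarrow> bool" where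
  "ell2_compact_on V N T \<longleftrightarrow>
     (\<forall>W. closed_csubspace_on V N W \<and> isomorphic_on W N ell2 ell2_norm
        \<longrightarrow> compact_operator_on W N T)"


text \<open>
  Trace class operators on a complex Hilbert space. Operators are plain functions, so that
  sums and multiples of operators are the pointwise ones.
\<close>

definition bounded_op :: "('h::chilbert_space \<Rightarrow> 'h) \<Rightarrow> bool" where
  "bounded_op A \<longleftrightarrow> bounded_clinear_on UNIV norm A"

definition adjoint_op :: "('h::chilbert_space \<Rightarrow> 'h) \<Rightarrow> 'h \<Rightarrow> 'h" where
  "adjoint_op A = (THE B. bounded_op B \<and> (\<forall>x y. cinner (A x) y = cinner x (B y)))"

definition positive_op :: "('h::chilbert_space \<Rightarrow> 'h) \<Rightarrow> bool" where
  "positive_op P \<longleftrightarrow> bounded_op P \<and> (\<forall>x. cinner (P x) x \<in> \<real>\<^sub>\<ge>\<^sub>0)"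

text \<open>The absolute value \<open>|A| = (A\<^sup>* A)\<^sup>1\<^sup>/\<^sup>2\<close>, the positive square root being unique.\<close>

definition abs_op :: "('h::chilbert_space \<Rightarrow> 'h) \<Rightarrow> 'h \<Rightarrow> 'h" where
  "abs_op A = (THE P. positive_op P \<and> P \<circ> P = adjoint_op A \<circ> A)"

definition orthonormal_basis :: "'h::chilbert_space set \<Rightarrow> bool" where
  "orthonormal_basis E \<longleftrightarrow>
     (\<forall>e\<in>E. norm e = 1) \<and> pairwise (\<lambda>e f. cinner e f = 0) E \<and>
     closure (complex_vector.span E) = UNIV"

text \<open>
  The diagonal sum of a positive operator, finite or not, is the same for all orthonormal
  bases, so the trace norm \<open>tr |A|\<close> may be computed in a chosen one.
\<close>

definition some_onb :: "'h::chilbert_space set" where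
  "some_onb = (SOME E. orthonormal_basis E)"

definition trace_class :: "('h::chilbert_space \<Rightarrow> 'h) set" where
  "trace_class =
     {A. bounded_op A \<and> (\<lambda>e. Re (cinner (abs_op A e) e)) summable_on some_onb}"

definition trace_norm :: "('h::chilbert_space \<Rightarrow> 'h) \<Rightarrow> real" where
  "trace_norm A = (\<Sum>\<^sub>\<infinity>e\<in>some_onb. Re (cinner (abs_op A e) e))"

end

theory Submission
  imports Defs "HOL-Library.Diagonal_Subsequence"
begin

text \<open>
  Fix an orthonormal basis \<open>(e\<^sub>i)\<close> and let \<open>P\<^sub>N\<close> be the projection onto the span of its first
  \<open>N\<close> vectors, \<open>Q\<^sub>N = 1 - P\<^sub>N\<close>.

  For an \<open>\<ell>\<^sup>2\<close>-compact \<open>T\<close>, split an operator as \<open>A = P\<^sub>N A + Q\<^sub>N A P\<^sub>N + Q\<^sub>N A Q\<^sub>N\<close>. The first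
  two summands consist of \<open>N\<close> rows and \<open>N\<close> columns (\<open>rows_columns_corner\<close>). The operators
  supported on one row, or on one column, have rank one and form a subspace isometric to
  \<open>\<ell>\<^sup>2\<close> (\<open>row_space\<close>, \<open>column_space\<close>), so \<open>T\<close> is compact there and sends weakly null sequences to
  null sequences (\<open>compact_on_ball_maps_weakly_null\<close>). What remains is the corner
  \<open>Q\<^sub>N A Q\<^sub>N\<close>, and the heart of the proof is that its trace norm tends to zero with \<open>N\<close> uniformly
  along a weakly null sequence (\<open>weakly_null_corners_uniformly_small\<close>). This is the analogue for
  trace class operators of the Schur property of \<open>\<ell>\<^sup>1\<close>, and it is shown by a gliding hump: if it
  failed, there would be successive diagonal blocks on which members of the sequence keep trace
  norm at least \<open>\<epsilon>\<close>, and as disjoint diagonal blocks contribute to the trace norm additively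
  (\<open>partial_trace_blocks_le\<close>), the sum of functionals norming the blocks is a bounded functional
  that does not tend to zero along the sequence.

  Conversely, a copy \<open>W\<close> of \<open>\<ell>\<^sup>2\<close> is a copy of the Hilbert space itself. Bounded sequences in it
  have weakly convergent subsequences (\<open>bounded_weakly_convergent_subsequence\<close>), and a
  Dunford--Pettis operator turns these into norm convergent ones.

  The trace norm is accessible through its description as the supremum of
  \<open>\<bar>\<Sum>\<^sub>i\<^sub>\<in>\<^sub>F \<langle>A e\<^sub>i, B e\<^sub>i\<rangle>\<bar>\<close> over finite \<open>F\<close> and contractions \<open>B\<close> (\<open>partial_trace_le_trace_norm\<close> and
  \<open>trace_classI\<close>). It rests on the existence and uniqueness of positive square roots, which come
  from the binomial series of \<open>(1 - t)\<^sup>1\<^sup>/\<^sup>2\<close>, and on an approximate polar decomposition.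
\<close>

section \<open>Complex inner products\<close>

instance complex_banach \<subseteq> banach ..
instance chilbert_space \<subseteq> banach ..

lemma cinner_add_right: "cinner x (y + z) = cinner x y + cinner x (z :: 'a::complex_inner)"
  by (metis cinner_add_left cinner_commute complex_cnj_add)

lemma cinner_scaleC_right: "cinner x (c *\<^sub>C y) = cnj c * cinner x (y :: 'a::complex_inner)"
  by (metis cinner_commute cinner_scaleC_left complex_cnj_mult)

lemma cinner_scaleR_left: "cinner (r *\<^sub>R x) y = of_real r * cinner x (y :: 'a::complex_inner)"
  by (simp add: scaleR_scaleC cinner_scaleC_left)

lemma cinner_scaleR_right: "cinner x (r *\<^sub>R y) = of_real r * cinner x (y :: 'a::complex_inner)"
  by (simp add: scaleR_scaleC cinner_scaleC_right)

lemma norm_add_square: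
  "(norm (x + y))\<^sup>2 = (norm x)\<^sup>2 + (norm y)\<^sup>2 + 2 * Re (cinner x (y :: 'a::complex_inner))"
proof -
  have "complex_of_real ((norm (x + y))\<^sup>2) = cinner x x + cinner y y + cinner x y + cnj (cinner x y)"
    unfolding cinner_self [symmetric]
    by (simp add: cinner_add_left cinner_add_right flip: cinner_commute)
  then have "Re (complex_of_real ((norm (x + y))\<^sup>2)) =
      Re (cinner x x) + Re (cinner y y) + 2 * Re (cinner x y)"
    by simp
  then show ?thesis
    by (simp add: cinner_self del: of_real_power)
qed

text \<open>The bound for the real part, from the square of \<open>\<parallel>y\<parallel> x - \<parallel>x\<parallel> y\<close>, is applied after
  rotating \<open>x\<close> by a phase that makes the inner product nonnegative.\<close>

lemma cinner_Cauchy_Schwarz: "cmod (cinner x y) \<le> norm x * norm (y :: 'a::complex_inner)"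
proof -
  have real_case: "Re (cinner x y) \<le> norm x * norm y" for x y :: 'a
  proof (cases "x = 0 \<or> y = 0")
    case True
    then have "cinner x y = 0"
      using cinner_scaleC_left [of 0 0 y] cinner_scaleC_right [of x 0 0]
      by (auto simp: complex_vector.scale_zero_left)
    then show ?thesis by simp
  next
    case False
    define u v where "u = norm y *\<^sub>R x" and "v = norm x *\<^sub>R - y"
    have "0 \<le> (norm (u + v))\<^sup>2" by simp
    also have "\<dots> = 2 * (norm x * norm y)\<^sup>2 + 2 * Re (cinner u v)"
      unfolding norm_add_square by (simp add: u_def v_def power_mult_distrib)
    also have "cinner u v = - of_real (norm x * norm y) * cinner x y"
      unfolding u_def v_def scaleR_minus_right scaleR_minus_left [symmetric] cinner_scaleR_left
        cinner_scaleR_right by simp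
    finally have "norm x * norm y * Re (cinner x y) \<le> (norm x * norm y)\<^sup>2" by simp
    then show ?thesis
      using False by (simp add: power2_eq_square)
  qed
  define c where "c = cnj (sgn (cinner x y))"
  have "cmod (cinner x y) = Re (c * cinner x y)"
    unfolding c_def
    by (cases "cinner x y = 0")
      (simp_all add: sgn_eq complex_mult_cnj mult.commute [of "cnj _"] flip: cmod_power2,
        simp add: power2_eq_square)
  also have "\<dots> = Re (cinner (c *\<^sub>C x) y)"
    by (simp add: cinner_scaleC_left)
  also have "\<dots> \<le> norm (c *\<^sub>C x) * norm y" by (rule real_case)
  also have "\<dots> \<le> norm x * norm y"
    by (intro mult_right_mono) (auto simp: norm_scaleC c_def norm_sgn)
  finally show ?thesis .
qed

text \<open>Over the reals the inner product is a bounded bilinear map; this yields at once its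
  algebraic laws and its continuity.\<close>

interpretation cinner: bounded_bilinear "cinner :: 'a::complex_inner \<Rightarrow> 'a \<Rightarrow> complex"
proof
  show "\<exists>K. \<forall>a b. norm (cinner a (b::'a)) \<le> norm a * norm b * K"
    by (rule exI [of _ 1]) (simp add: cinner_Cauchy_Schwarz)
qed (simp_all add: cinner_add_left cinner_add_right cinner_scaleR_left cinner_scaleR_right
    scaleR_conv_of_real)

lemmas [tendsto_intros] = cinner.tendsto

lemma bounded_linear_scaleC_right:
  "bounded_linear (\<lambda>x :: 'a::complex_normed_vector. c *\<^sub>C x)"
  by (rule bounded_linear_intro [of _ "cmod c"])
    (simp_all add: scaleC_add_right scaleR_scaleC scaleC_scaleC norm_scaleC mult.commute)

lemmas scaleC_tendsto = bounded_linear.tendsto [OF bounded_linear_scaleC_right]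

lemma norm_diff_square:
  "(norm (x - y))\<^sup>2 = (norm x)\<^sup>2 + (norm y)\<^sup>2 - 2 * Re (cinner x (y :: 'a::complex_inner))"
  using norm_add_square [of x "- y"] by (simp add: cinner.minus_right)

lemma parallelogram:
  "(norm (x + y))\<^sup>2 + (norm (x - y))\<^sup>2 = 2 * (norm x)\<^sup>2 + 2 * (norm (y :: 'a::complex_inner))\<^sup>2"
  by (simp add: norm_add_square norm_diff_square)

lemma cinner_eq_zero_imp_zero:
  assumes "\<And>y. cinner x y = 0" shows "x = (0 :: 'a::complex_inner)"
  using cinner_self [of x] assms by simp

lemma cinner_ext:
  assumes "\<And>z. cinner x z = cinner y z" shows "x = (y :: 'a::complex_inner)"
  using cinner_eq_zero_imp_zero [of "x - y"] assms by (simp add: cinner.diff_left)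

lemma norm_le_of_cinner_le:
  assumes "\<And>y. cmod (cinner x y) \<le> K * norm y" "0 \<le> K"
  shows "norm (x :: 'a::complex_inner) \<le> K"
proof (cases "x = 0")
  case False
  have "(norm x)\<^sup>2 = cmod (cinner x x)" by (simp add: cinner_self norm_power)
  also have "\<dots> \<le> K * norm x" by (rule assms)
  finally show ?thesis using False by (simp add: power2_eq_square)
qed (simp add: assms)

section \<open>Orthogonal projection and the Riesz representation\<close>

lemma csubspace_orthogonal_projection_exists:
  fixes M :: "'h::chilbert_space set"
  assumes "closed M" and M: "complex_vector.subspace M"
  shows "\<exists>y\<in>M. \<forall>z\<in>M. cinner (x - y) z = 0"
proof -
  define d where "d = Inf ((\<lambda>y. (norm (x - y))\<^sup>2) ` M)"
  have "0 \<in> M" using M by (rule complex_vector.subspace_0)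
  have bdd: "bdd_below ((\<lambda>y. (norm (x - y))\<^sup>2) ` M)"
    by (rule bdd_belowI [of _ 0]) auto
  have d_le: "d \<le> (norm (x - y))\<^sup>2" if "y \<in> M" for y
    unfolding d_def using bdd that by (auto intro: cInf_lower)
  have "\<exists>y\<in>M. (norm (x - y))\<^sup>2 < d + 1 / real (Suc n)" for n
  proof -
    have "Inf ((\<lambda>y. (norm (x - y))\<^sup>2) ` M) < d + 1 / real (Suc n)"
      unfolding d_def by simp
    then show ?thesis
      using \<open>0 \<in> M\<close> bdd by (subst (asm) cInf_less_iff) auto
  qed
  then obtain f where fM: "\<And>n. f n \<in> M" and f: "\<And>n. (norm (x - f n))\<^sup>2 < d + 1 / real (Suc n)"
    by metis
  \<comment> \<open>By the parallelogram law a minimizing sequence is Cauchy: midpoints stay in the subspace.\<close>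
  have close: "(norm (f m - f n))\<^sup>2 \<le> 2 / real (Suc m) + 2 / real (Suc n)" for m n
  proof -
    define mid where "mid = (1/2) *\<^sub>R (f m + f n)"
    have "mid \<in> M"
      unfolding mid_def scaleR_scaleC
      by (intro complex_vector.subspace_scale complex_vector.subspace_add M fM)
    have "(norm ((x - f m) + (x - f n)))\<^sup>2 = (norm (2 *\<^sub>R (x - mid)))\<^sup>2"
      unfolding mid_def by (simp add: algebra_simps scaleR_2)
    also have "\<dots> = 4 * (norm (x - mid))\<^sup>2" by (simp add: power_mult_distrib)
    also have "\<dots> \<ge> 4 * d" using d_le [OF \<open>mid \<in> M\<close>] by simp
    finally have "4 * d \<le> (norm ((x - f m) + (x - f n)))\<^sup>2" .
    moreover have "(norm (f n - f m))\<^sup>2 = (norm (f m - f n))\<^sup>2" by (simp add: norm_minus_commute)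
    ultimately show ?thesis
      using parallelogram [of "x - f m" "x - f n"] f [of m] f [of n] by simp
  qed
  have "Cauchy f"
  proof (rule metric_CauchyI)
    fix e :: real assume "e > 0"
    obtain N where N: "4 / e\<^sup>2 < real (Suc N)"
      using reals_Archimedean2 less_trans [OF _ of_nat_less_iff [THEN iffD2, OF lessI]] by blast
    have "dist (f m) (f n) < e" if "m \<ge> N" "n \<ge> N" for m n
    proof -
      have "(norm (f m - f n))\<^sup>2 \<le> 2 / real (Suc N) + 2 / real (Suc N)"
        using close [of m n] that
        by (intro order_trans [OF close add_mono]) (simp_all add: frac_le)
      also have "\<dots> < e\<^sup>2"
        using N \<open>e > 0\<close> by (simp add: divide_less_eq mult.commute)
      finally show ?thesis
        using \<open>e > 0\<close> by (simp add: dist_norm power_less_imp_less_base)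
    qed
    then show "\<exists>M. \<forall>m\<ge>M. \<forall>n\<ge>M. dist (f m) (f n) < e" by blast
  qed
  then obtain y where y: "f \<longlonglongrightarrow> y" using Cauchy_convergent convergent_def by blast
  have "y \<in> M" using \<open>closed M\<close> fM y by (auto intro: closed_sequentially)
  have lim_d: "(\<lambda>n. d + 1 / real (Suc n)) \<longlonglongrightarrow> d + 0"
    by (intro tendsto_intros LIMSEQ_Suc lim_1_over_n)
  have "(\<lambda>n. (norm (x - f n))\<^sup>2) \<longlonglongrightarrow> (norm (x - y))\<^sup>2"
    by (intro tendsto_intros y)
  from this lim_d have "(norm (x - y))\<^sup>2 \<le> d + 0"
    by (rule LIMSEQ_le) (use f less_imp_le in blast)
  then have min: "(norm (x - y))\<^sup>2 \<le> d" by simp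
  have "cinner (x - y) z = 0" if "z \<in> M" for z
  proof (rule ccontr)
    assume nz: "cinner (x - y) z \<noteq> 0"
    then have "z \<noteq> 0" by (auto simp: cinner.zero_right)
    define c where "c = cinner (x - y) z / (norm z)\<^sup>2"
    have "y + c *\<^sub>C z \<in> M"
      by (intro complex_vector.subspace_scale complex_vector.subspace_add M that \<open>y \<in> M\<close>)
    \<comment> \<open>The scalar \<open>c\<close> minimizes the distance from \<open>x - y\<close> to the line through \<open>z\<close>.\<close>
    then have "d \<le> (norm ((x - y) - c *\<^sub>C z))\<^sup>2"
      using d_le by (metis diff_diff_eq)
    also have "\<dots> = (norm (x - y))\<^sup>2 + (cmod c * norm z)\<^sup>2 - 2 * Re (cnj c * cinner (x - y) z)"
      unfolding norm_diff_square by (simp add: norm_scaleC cinner_scaleC_right)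
    also have "cnj c * cinner (x - y) z = of_real ((cmod (cinner (x - y) z))\<^sup>2 / (norm z)\<^sup>2)"
      unfolding c_def using complex_norm_square [of "cinner (x - y) z"] by (simp add: mult.commute)
    also have "(cmod c * norm z)\<^sup>2 = (cmod (cinner (x - y) z))\<^sup>2 / (norm z)\<^sup>2"
      using \<open>z \<noteq> 0\<close> unfolding c_def
      by (simp add: norm_divide power_mult_distrib power2_eq_square norm_mult)
    finally have "(cmod (cinner (x - y) z))\<^sup>2 / (norm z)\<^sup>2 \<le> 0"
      using min by simp
    moreover have "(cmod (cinner (x - y) z))\<^sup>2 / (norm z)\<^sup>2 > 0"
      using nz \<open>z \<noteq> 0\<close> by simp
    ultimately show False by simp
  qed
  with \<open>y \<in> M\<close> show ?thesis by blast
qed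

text \<open>A functional is determined by its value on a vector orthogonal to its kernel.\<close>

lemma Riesz_representation:
  fixes \<phi> :: "'h::chilbert_space \<Rightarrow> complex"
  assumes "bounded_clinear_on UNIV norm \<phi>"
  shows "\<exists>z. \<forall>x. \<phi> x = cinner x z"
proof (cases "\<forall>x. \<phi> x = 0")
  case True
  then show ?thesis by (intro exI [of _ 0]) (simp add: cinner.zero_right)
next
  case False
  then obtain u where u: "\<phi> u \<noteq> 0" by blast
  have add: "\<phi> (x + y) = \<phi> x + \<phi> y" and scale: "\<phi> (c *\<^sub>C x) = c * \<phi> x" for x y c
    using assms by (auto simp: bounded_clinear_on_def scaleC_complex_def)
  obtain K where K: "\<And>x. cmod (\<phi> x) \<le> K * norm x"
    using assms by (auto simp: bounded_clinear_on_def)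
  have bl: "bounded_linear \<phi>"
    by (rule bounded_linear_intro [of _ K])
      (use K in \<open>simp_all add: add scaleR_scaleC scale scaleC_complex_def mult.commute\<close>)
  define M where "M = {x. \<phi> x = 0}"
  have "closed M"
    unfolding M_def
    using closed_Collect_eq [of \<phi> "\<lambda>_. 0"] bl
    by (simp add: linear_continuous_on)
  moreover have "complex_vector.subspace M"
    unfolding M_def complex_vector.subspace_def
    using add scale scale [of 0 0] by (simp add: complex_vector.scale_zero_left)
  ultimately obtain y where y: "y \<in> M" "\<And>z. z \<in> M \<Longrightarrow> cinner (u - y) z = 0"
    using csubspace_orthogonal_projection_exists by blast
  define v where "v = u - y"
  have diff: "\<phi> (x - z) = \<phi> x - \<phi> z" for x z
    by (rule linear_diff [OF bounded_linear.linear [OF bl]])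
  have "\<phi> v = \<phi> u" using y(1) by (simp add: v_def diff M_def)
  then have "v \<noteq> 0" using u add [of 0 0] by auto
  have "\<phi> x = cinner x ((cnj (\<phi> v) / (norm v)\<^sup>2) *\<^sub>C v)" for x
  proof -
    have "\<phi> v *\<^sub>C x - \<phi> x *\<^sub>C v \<in> M"
      by (simp add: M_def diff scale)
    then have "cinner (\<phi> v *\<^sub>C x - \<phi> x *\<^sub>C v) v = 0"
      using y(2) v_def cinner_commute by (metis complex_cnj_zero)
    then have "\<phi> v * cinner x v = \<phi> x * (norm v)\<^sup>2"
      by (simp add: cinner.diff_left cinner_scaleC_left cinner_self)
    then show ?thesis
      using \<open>v \<noteq> 0\<close> by (simp add: cinner_scaleC_right field_simps)
  qed
  then show ?thesis by blast
qed

section \<open>Bounded operators and adjoints\<close>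

lemma bounded_op_add: "bounded_op A \<Longrightarrow> A (x + y) = A x + A y"
  and bounded_op_scaleC: "bounded_op A \<Longrightarrow> A (c *\<^sub>C x) = c *\<^sub>C A x"
  by (auto simp: bounded_op_def bounded_clinear_on_def)

lemma bounded_opI:
  assumes "\<And>x y. A (x + y) = A x + A y" "\<And>c x. A (c *\<^sub>C x) = c *\<^sub>C A x"
    and "\<And>x. norm (A x) \<le> K * norm x"
  shows "bounded_op A"
  using assms unfolding bounded_op_def bounded_clinear_on_def by blast

lemma bounded_op_bound:
  assumes "bounded_op A"
  obtains K where "K > 0" "\<And>x. norm (A x) \<le> K * norm x"
proof -
  obtain K where K: "norm (A x) \<le> K * norm x" for x
    using assms unfolding bounded_op_def bounded_clinear_on_def by blast
  have "norm (A x) \<le> (\<bar>K\<bar> + 1) * norm x" for x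
    by (rule order_trans [OF K mult_right_mono]) auto
  then show thesis by (rule that [rotated]) simp
qed

lemma bounded_op_imp_bounded_linear:
  assumes "bounded_op A" shows "bounded_linear A"
proof -
  obtain K where "\<And>x. norm (A x) \<le> K * norm x" using bounded_op_bound assms by blast
  then show ?thesis
    by (intro bounded_linear_intro [of _ K])
      (simp_all add: bounded_op_add assms bounded_op_scaleC scaleR_scaleC mult.commute)
qed

lemma bounded_op_linear: "bounded_op A \<Longrightarrow> linear A"
  by (rule bounded_linear.linear [OF bounded_op_imp_bounded_linear])

lemmas bounded_op_diff = linear_diff [OF bounded_op_linear]
lemmas bounded_op_0 = linear_0 [OF bounded_op_linear]
lemmas bounded_op_scaleR = linear_scale [OF bounded_op_linear]
lemmas bounded_op_sum = linear_sum [OF bounded_op_linear]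
lemmas bounded_op_tendsto = bounded_linear.tendsto [OF bounded_op_imp_bounded_linear]

lemma bounded_op_zero [simp]: "bounded_op (\<lambda>x. 0)"
  by (rule bounded_opI [of _ 0]) (simp_all add: complex_vector.scale_zero_right)

lemma bounded_op_id [simp]: "bounded_op (\<lambda>x. x)"
  by (rule bounded_opI [of _ 1]) simp_all

lemma bounded_op_plus:
  assumes "bounded_op A" "bounded_op B" shows "bounded_op (\<lambda>x. A x + B x)"
proof -
  obtain K L where "\<And>x. norm (A x) \<le> K * norm x" "\<And>x. norm (B x) \<le> L * norm x"
    using assms bounded_op_bound by metis
  then have "norm (A x + B x) \<le> (K + L) * norm x" for x
    using norm_triangle_le [OF add_mono, of "A x" _ "B x"] by (simp add: distrib_right)
  then show ?thesis
    by (intro bounded_opI [of _ "K + L"])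
      (simp_all add: bounded_op_add assms bounded_op_scaleC scaleC_add_right)
qed

lemma bounded_op_scale:
  assumes "bounded_op A" shows "bounded_op (\<lambda>x. c *\<^sub>C A x)"
proof -
  obtain K where K: "\<And>x. norm (A x) \<le> K * norm x"
    using assms bounded_op_bound by metis
  show ?thesis
    by (rule bounded_opI [of _ "cmod c * K"])
      (simp_all add: bounded_op_add assms bounded_op_scaleC scaleC_add_right scaleC_scaleC
        mult.commute [of c] norm_scaleC mult_left_mono K mult.assoc)
qed

lemma bounded_op_real_scale:
  "bounded_op A \<Longrightarrow> bounded_op (\<lambda>x. r *\<^sub>R A x)"
  unfolding scaleR_scaleC by (rule bounded_op_scale)

lemma bounded_op_compose:
  assumes "bounded_op A" "bounded_op B" shows "bounded_op (\<lambda>x. A (B x))"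
proof -
  obtain K L where K: "K > 0" "\<And>x. norm (A x) \<le> K * norm x" and L: "\<And>x. norm (B x) \<le> L * norm x"
    using assms bounded_op_bound by metis
  have "norm (A (B x)) \<le> (K * L) * norm x" for x
    using order_trans [OF K(2) mult_left_mono [OF L]] K(1) by (simp add: mult.assoc)
  then show ?thesis
    by (intro bounded_opI [of _ "K * L"]) (simp_all add: bounded_op_add assms bounded_op_scaleC)
qed

lemma bounded_op_minus_op:
  assumes "bounded_op A" "bounded_op B" shows "bounded_op (\<lambda>x. A x - B x)"
proof -
  have "bounded_op (\<lambda>x. A x + (- 1) *\<^sub>R B x)"
    using assms by (intro bounded_op_plus bounded_op_real_scale)
  then show ?thesis by simp
qed

lemma bounded_op_sum_op [intro]:
  "(\<And>i. i \<in> I \<Longrightarrow> bounded_op (A i)) \<Longrightarrow> bounded_op (\<lambda>x. \<Sum>i\<in>I. A i x)"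
  by (induction I rule: infinite_finite_induct) (auto intro!: bounded_op_plus)

lemma bounded_op_rank_one [intro]: "bounded_op (\<lambda>x. cinner x f *\<^sub>C g)"
  by (rule bounded_opI [of _ "norm f * norm g"])
    (auto simp: cinner_add_left scaleC_add_left cinner_scaleC_left scaleC_scaleC norm_scaleC
      intro: mult_right_mono [OF cinner_Cauchy_Schwarz, THEN order_trans])

lemma adjoint_exists:
  assumes A: "bounded_op A"
  shows "\<exists>B. bounded_op B \<and> (\<forall>x y. cinner (A x) y = cinner x (B y))"
proof -
  obtain K where K: "K > 0" "\<And>x. norm (A x) \<le> K * norm x"
    using assms bounded_op_bound by metis
  have "\<exists>z. \<forall>x. cinner (A x) y = cinner x z" for y
  proof (rule Riesz_representation)
    have "cmod (cinner (A x) y) \<le> (K * norm y) * norm x" for x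
      using order_trans [OF cinner_Cauchy_Schwarz mult_right_mono [OF K(2)], of y x]
      by (simp add: algebra_simps)
    then show "bounded_clinear_on UNIV norm (\<lambda>x. cinner (A x) y)"
      unfolding bounded_clinear_on_def
      using bounded_op_add [OF A] bounded_op_scaleC [OF A]
      by (auto simp: cinner_add_left cinner_scaleC_left scaleC_complex_def)
  qed
  then obtain B where B: "\<And>x y. cinner (A x) y = cinner x (B y)" by metis
  have B': "cinner (B y) x = cinner y (A x)" for x y
    by (metis B cinner_commute)
  have "bounded_op B"
  proof (rule bounded_opI)
    show "B (x + y) = B x + B y" for x y
      by (rule cinner_ext) (simp add: B' cinner_add_left)
    show "B (c *\<^sub>C x) = c *\<^sub>C B x" for c x
      by (rule cinner_ext) (simp add: B' cinner_scaleC_left)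
    show "norm (B y) \<le> K * norm y" for y
    proof (rule norm_le_of_cinner_le)
      show "cmod (cinner (B y) x) \<le> (K * norm y) * norm x" for x
        unfolding B'
        using order_trans [OF cinner_Cauchy_Schwarz mult_left_mono [OF K(2)], of y x]
        by (simp add: algebra_simps)
    qed (use K in simp)
  qed
  with B show ?thesis by blast
qed

lemma
  assumes "bounded_op A"
  shows bounded_op_adjoint [intro]: "bounded_op (adjoint_op A)"
    and cinner_adjoint: "cinner (A x) y = cinner x (adjoint_op A y)"
proof -
  have "\<exists>!B. bounded_op B \<and> (\<forall>x y. cinner (A x) y = cinner x (B y))"
  proof (rule ex_ex1I [OF adjoint_exists [OF assms]])
    fix B C
    assume "bounded_op B \<and> (\<forall>x y. cinner (A x) y = cinner x (B y))"
      and "bounded_op C \<and> (\<forall>x y. cinner (A x) y = cinner x (C y))"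
    then have "cinner (B y) x = cinner (C y) x" for x y
      by (metis cinner_commute)
    then show "B = C"
      using cinner_ext by blast
  qed
  from theI' [OF this]
  show "bounded_op (adjoint_op A)" "cinner (A x) y = cinner x (adjoint_op A y)"
    unfolding adjoint_op_def [symmetric] by blast+
qed

lemma cinner_adjoint': "bounded_op A \<Longrightarrow> cinner x (A y) = cinner (adjoint_op A x) y"
  by (metis cinner_adjoint cinner_commute)

definition contraction :: "('h::chilbert_space \<Rightarrow> 'h) \<Rightarrow> bool" where
  "contraction C \<longleftrightarrow> bounded_op C \<and> (\<forall>x. norm (C x) \<le> norm x)"

lemma contraction_adjoint: "contraction C \<Longrightarrow> contraction (adjoint_op C)"
  unfolding contraction_def
proof (intro conjI allI)
  fix x assume C: "bounded_op C \<and> (\<forall>x. norm (C x) \<le> norm x)"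
  show "norm (adjoint_op C x) \<le> norm x"
  proof (rule norm_le_of_cinner_le)
    fix y
    have "cmod (cinner (adjoint_op C x) y) = cmod (cinner x (C y))"
      using C by (simp add: cinner_adjoint')
    also have "\<dots> \<le> norm x * norm y"
      using C by (intro order_trans [OF cinner_Cauchy_Schwarz] mult_left_mono) auto
    finally show "cmod (cinner (adjoint_op C x) y) \<le> norm x * norm y" .
  qed simp
qed auto

lemma contraction_compose: "contraction C \<Longrightarrow> contraction D \<Longrightarrow> contraction (\<lambda>x. C (D x))"
  unfolding contraction_def by (metis bounded_op_compose order_trans)

section \<open>Positive operators and the square root\<close>

lemma positive_op_bounded: "positive_op P \<Longrightarrow> bounded_op P"
  by (simp add: positive_op_def)

lemma positive_op_nonneg: "positive_op P \<Longrightarrow> 0 \<le> Re (cinner (P x) x)"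
  by (auto simp: positive_op_def elim!: nonneg_Reals_cases dest!: spec [of _ x])

lemma positive_op_cinner_real: "positive_op P \<Longrightarrow> cinner (P x) x = of_real (Re (cinner (P x) x))"
  by (auto simp: positive_op_def elim!: nonneg_Reals_cases dest!: spec [of _ x])

lemma positive_opI:
  assumes "bounded_op P" "\<And>x. Im (cinner (P x) x) = 0" "\<And>x. 0 \<le> Re (cinner (P x) x)"
  shows "positive_op P"
  using assms by (simp add: positive_op_def complex_nonneg_Reals_iff)

text \<open>Polarization: the sesquilinear form measuring the failure of self-adjointness vanishes on
  the diagonal, hence everywhere.\<close>

lemma positive_op_selfadjoint:
  assumes P: "positive_op P"
  shows "cinner (P x) y = cinner x (P y)"
proof -
  note bP = positive_op_bounded [OF P]
  define q where "q x y = cinner (P x) y - cinner x (P y)" for x y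
  have diag: "q x x = 0" for x
    using positive_op_cinner_real [OF P, of x] unfolding q_def
    by (metis cinner_commute complex_cnj_complex_of_real diff_self)
  have "q (x + y) (x + y) = q x x + q y y + (q x y + q y x)"
    by (simp add: q_def bounded_op_add bP cinner_add_left cinner_add_right)
  then have 1: "q x y + q y x = 0" by (simp add: diag)
  have "q (x + \<i> *\<^sub>C y) (x + \<i> *\<^sub>C y) = q x x + q (\<i> *\<^sub>C y) (\<i> *\<^sub>C y) + \<i> * (q y x - q x y)"
    by (simp add: q_def bounded_op_add bP cinner_add_left cinner_add_right bounded_op_scaleC
        cinner_scaleC_left cinner_scaleC_right algebra_simps)
  then have "\<i> * (q y x - q x y) = 0" by (simp add: diag)
  then have "q y x = q x y" by simp
  with 1 have "q x y = 0" by simp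
  then show ?thesis by (simp add: q_def)
qed

lemma positive_op_scaleR:
  assumes "positive_op P" "0 \<le> r" shows "positive_op (\<lambda>x. r *\<^sub>R P x)"
proof (intro positive_opI bounded_op_real_scale positive_op_bounded [OF assms(1)])
  fix x
  show "Im (cinner (r *\<^sub>R P x) x) = 0"
    by (subst cinner_scaleR_left, subst positive_op_cinner_real [OF assms(1)]) simp
  show "0 \<le> Re (cinner (r *\<^sub>R P x) x)"
    using positive_op_nonneg [OF assms(1)] assms(2) by (simp add: cinner_scaleR_left)
qed

text \<open>The coefficients of the binomial series of \<open>(1 - t) powr (1/2)\<close>.\<close>

definition sqrt_coeff :: "nat \<Rightarrow> real" where
  "sqrt_coeff n = pochhammer (- (1/2)) n / fact n"

lemma sqrt_coeff_0 [simp]: "sqrt_coeff 0 = 1"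
  by (simp add: sqrt_coeff_def)

lemma sqrt_coeff_nonpos: "0 < n \<Longrightarrow> sqrt_coeff n \<le> 0"
  by (cases n) (simp_all add: sqrt_coeff_def pochhammer_rec divide_nonpos_pos pochhammer_nonneg)

lemma sqrt_coeff_sum: "(\<Sum>k\<le>n. sqrt_coeff k) = pochhammer (1/2) n / fact n"
proof (induction n)
  case (Suc n)
  have "pochhammer (1/2) (Suc n) / fact (Suc n)
      = pochhammer (1/2::real) n / fact n + sqrt_coeff (Suc n)"
    unfolding sqrt_coeff_def pochhammer_Suc [of "1/2"] pochhammer_rec [of "-(1/2)"]
    by (simp add: divide_simps) (simp add: algebra_simps)
  with Suc show ?case by simp
qed simp

text \<open>All coefficients but the first are nonpositive and the partial sums stay nonnegative.\<close>

lemma sqrt_coeff_abs_tail_sum: "(\<Sum>k\<in>{1..n}. \<bar>sqrt_coeff k\<bar>) \<le> 1"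
proof -
  have "(\<Sum>k\<in>{1..n}. \<bar>sqrt_coeff k\<bar>) = - (\<Sum>k\<in>{1..n}. sqrt_coeff k)"
    unfolding sum_negf [symmetric]
    by (rule sum.cong) (use sqrt_coeff_nonpos in \<open>auto simp: abs_of_nonpos\<close>)
  also have "\<dots> = 1 - (\<Sum>k\<le>n. sqrt_coeff k)"
    by (simp add: sum.atLeast_Suc_atMost atMost_atLeast0)
  also have "\<dots> \<le> 1"
    by (simp add: sqrt_coeff_sum pochhammer_nonneg)
  finally show ?thesis .
qed

lemma sqrt_coeff_abs_sum: "(\<Sum>k\<le>n. \<bar>sqrt_coeff k\<bar>) \<le> 2"
  using sqrt_coeff_abs_tail_sum [of n] by (simp add: sum.atLeast_Suc_atMost atMost_atLeast0)

lemma sqrt_coeff_convolution: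
  "(\<Sum>k\<le>n. sqrt_coeff k * sqrt_coeff (n - k)) = (if n = 0 then 1 else if n = 1 then -1 else 0)"
proof -
  have eq: "sqrt_coeff k = (- 1) ^ k * ((1/2) gchoose k)" for k
    by (simp add: sqrt_coeff_def gbinomial_pochhammer flip: power_mult_distrib)
  have "(\<Sum>k\<le>n. sqrt_coeff k * sqrt_coeff (n - k))
      = (- 1) ^ n * (\<Sum>k\<le>n. ((1/2) gchoose k) * ((1/2) gchoose (n - k)))"
    unfolding sum_distrib_left eq
    by (rule sum.cong) (auto simp: power_add [symmetric] mult_ac)
  also have "\<dots> = (- 1) ^ n * ((1::real) gchoose n)"
    using gbinomial_Vandermonde [of "1/2::real" "1/2" n] by (simp add: atMost_atLeast0)
  also have "(1::real) gchoose n = of_nat (1 choose n)"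
    by (simp add: binomial_gbinomial)
  finally show ?thesis
    by (auto simp: binomial_eq_0)
qed

lemma infsum_bounded_linear_comp:
  assumes "bounded_linear h" "f summable_on A"
  shows "(\<Sum>\<^sub>\<infinity>x\<in>A. h (f x)) = h (infsum f A)"
  by (rule infsumI [OF has_sum_bounded_linear [OF assms(1) has_sum_infsum [OF assms(2)]]])

text \<open>For a contraction \<open>K\<close> the binomial series defines the square root of \<open>1 - K\<close>.\<close>

definition sqrt_series :: "('h::chilbert_space \<Rightarrow> 'h) \<Rightarrow> 'h \<Rightarrow> 'h" where
  "sqrt_series K x = (\<Sum>\<^sub>\<infinity>n. sqrt_coeff n *\<^sub>R (K ^^ n) x)"

context
  fixes K :: "'h::chilbert_space \<Rightarrow> 'h"
  assumes K: "contraction K"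
begin

lemma bounded_op_K: "bounded_op K" using K by (simp add: contraction_def)

lemma bounded_op_funpow: "bounded_op (K ^^ n)"
proof (induction n)
  case 0
  then show ?case by (simp add: id_def)
next
  case (Suc n)
  from bounded_op_compose [OF bounded_op_K this] show ?case by (simp add: o_def)
qed

lemma norm_funpow_le: "norm ((K ^^ n) x) \<le> norm x"
proof (induction n)
  case (Suc n)
  then show ?case using K unfolding contraction_def by (auto intro: order_trans)
qed simp

text \<open>This justifies the rearrangement that squares the series.\<close>

lemma double_series_abs_summable:
  "(\<lambda>(i, j). (sqrt_coeff i * sqrt_coeff j) *\<^sub>R (K ^^ (i + j)) x) abs_summable_on UNIV \<times> UNIV"
  unfolding abs_summable_iff_bdd_above
proof (rule bdd_aboveI2)
  fix F :: "(nat \<times> nat) set" assume "F \<in> {F. F \<subseteq> UNIV \<times> UNIV \<and> finite F}"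
  then have "finite F" by simp
  define n where "n = Max (insert 0 (fst ` F \<union> snd ` F))"
  have F: "F \<subseteq> {..n} \<times> {..n}"
    using \<open>finite F\<close> by (force simp: n_def intro!: Max_ge)
  have "(\<Sum>p\<in>F. norm (case p of (i, j) \<Rightarrow> (sqrt_coeff i * sqrt_coeff j) *\<^sub>R (K ^^ (i + j)) x))
      \<le> (\<Sum>(i,j)\<in>{..n} \<times> {..n}. \<bar>sqrt_coeff i\<bar> * \<bar>sqrt_coeff j\<bar> * norm x)"
    by (rule sum_le_included [where i = id])
      (use F \<open>finite F\<close> in \<open>auto simp: abs_mult intro!: mult_left_mono norm_funpow_le mult_nonneg_nonneg\<close>)
  also have "\<dots> = (\<Sum>i\<le>n. \<bar>sqrt_coeff i\<bar>) * (\<Sum>i\<le>n. \<bar>sqrt_coeff i\<bar>) * norm x"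
    by (subst sum_product) (simp add: sum_distrib_right flip: sum.cartesian_product)
  also have "\<dots> \<le> 2 * 2 * norm x"
    by (intro mult_right_mono mult_mono sqrt_coeff_abs_sum) (auto intro: sum_nonneg)
  finally show "(\<Sum>p\<in>F. norm (case p of (i, j) \<Rightarrow> (sqrt_coeff i * sqrt_coeff j) *\<^sub>R (K ^^ (i + j)) x))
      \<le> 2 * 2 * norm x" .
qed

lemma sqrt_series_abs_summable: "(\<lambda>n. sqrt_coeff n *\<^sub>R (K ^^ n) x) abs_summable_on UNIV"
proof -
  have "(\<lambda>(i, j). (sqrt_coeff i * sqrt_coeff j) *\<^sub>R (K ^^ (i + j)) x) abs_summable_on (\<lambda>n. (n,0)) ` UNIV"
    using double_series_abs_summable by (rule summable_on_subset_banach) auto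
  then show ?thesis
    by (subst (asm) summable_on_reindex) (auto simp: o_def inj_on_def)
qed

lemma sqrt_series_summable: "(\<lambda>n. sqrt_coeff n *\<^sub>R (K ^^ n) x) summable_on UNIV"
  by (rule abs_summable_summable [OF sqrt_series_abs_summable])

lemma sqrt_series_commute:
  assumes Q: "bounded_op Q" and comm: "\<And>x. Q (K x) = K (Q x)"
  shows "Q (sqrt_series K x) = sqrt_series K (Q x)"
proof -
  have "Q ((K ^^ n) y) = (K ^^ n) (Q y)" for n y
    by (induction n) (auto simp: comm)
  then show ?thesis
    unfolding sqrt_series_def
    using infsum_bounded_linear_comp [OF bounded_op_imp_bounded_linear [OF Q] sqrt_series_summable, of x]
    by (simp add: o_def bounded_op_scaleR [OF Q])
qed

lemma sqrt_series_diff_le: "norm (sqrt_series K x - x) \<le> norm x"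
proof -
  have "(\<lambda>n. sqrt_coeff n *\<^sub>R (K ^^ n) x) sums sqrt_series K x"
    unfolding sqrt_series_def
    by (rule has_sum_imp_sums [OF has_sum_infsum [OF sqrt_series_summable]])
  then have "(\<lambda>n. \<Sum>k\<le>n. sqrt_coeff k *\<^sub>R (K ^^ k) x) \<longlonglongrightarrow> sqrt_series K x"
    by (simp add: sums_def_le)
  then have "(\<lambda>n. norm ((\<Sum>k\<le>n. sqrt_coeff k *\<^sub>R (K ^^ k) x) - x)) \<longlonglongrightarrow> norm (sqrt_series K x - x)"
    by (intro tendsto_intros)
  moreover have "norm ((\<Sum>k\<le>n. sqrt_coeff k *\<^sub>R (K ^^ k) x) - x) \<le> norm x" for n
  proof -
    have "(\<Sum>k\<le>n. sqrt_coeff k *\<^sub>R (K ^^ k) x) - x = (\<Sum>k\<in>{1..n}. sqrt_coeff k *\<^sub>R (K ^^ k) x)"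
      by (simp add: sum.atLeast_Suc_atMost atMost_atLeast0)
    also have "norm \<dots> \<le> (\<Sum>k\<in>{1..n}. \<bar>sqrt_coeff k\<bar> * norm x)"
      by (rule sum_norm_le) (simp add: mult_left_mono norm_funpow_le)
    also have "\<dots> \<le> 1 * norm x"
      unfolding sum_distrib_right [symmetric] by (intro mult_right_mono sqrt_coeff_abs_tail_sum) simp
    finally show ?thesis by simp
  qed
  ultimately show ?thesis
    by (intro LIMSEQ_le_const2) blast+
qed

lemma bounded_op_sqrt_series: "bounded_op (sqrt_series K)"
proof (rule bounded_opI)
  show "sqrt_series K (x + y) = sqrt_series K x + sqrt_series K y" for x y
    unfolding sqrt_series_def bounded_op_add [OF bounded_op_funpow] scaleR_add_right
    by (rule infsum_add) (rule sqrt_series_summable)+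
  show "sqrt_series K (c *\<^sub>C x) = c *\<^sub>C sqrt_series K x" for c x
    using sqrt_series_commute [of "\<lambda>x. c *\<^sub>C x" x] bounded_op_scaleC [OF bounded_op_K]
      bounded_op_scale [OF bounded_op_id] by metis
  show "norm (sqrt_series K x) \<le> 2 * norm x" for x
    using norm_triangle_sub [of "sqrt_series K x" x] sqrt_series_diff_le [of x] by simp
qed

lemma sqrt_series_square: "sqrt_series K (sqrt_series K x) = x - K x"
proof -
  define f where "f i j = (sqrt_coeff i * sqrt_coeff j) *\<^sub>R (K ^^ (i + j)) x" for i j
  have summ: "(\<lambda>(i,j). f i j) summable_on UNIV \<times> UNIV"
    using abs_summable_summable [OF double_series_abs_summable] unfolding f_def .
  have inner: "sqrt_coeff i *\<^sub>R (K ^^ i) (sqrt_series K x) = (\<Sum>\<^sub>\<infinity>j. f i j)" for i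
  proof -
    have "bounded_linear (\<lambda>y. sqrt_coeff i *\<^sub>R (K ^^ i) y)"
      by (intro bounded_op_imp_bounded_linear bounded_op_real_scale bounded_op_funpow)
    from infsum_bounded_linear_comp [OF this sqrt_series_summable, of x]
    show ?thesis
      unfolding sqrt_series_def f_def
      by (simp add: o_def bounded_op_scaleR [OF bounded_op_funpow] funpow_add)
  qed
  have bij: "bij_betw (\<lambda>(n, i). (i, n - i)) (SIGMA n:UNIV. {..n::nat}) (UNIV \<times> UNIV)"
    by (rule bij_betwI [where g = "\<lambda>(i, j). (i + j, i)"]) auto
  have "sqrt_series K (sqrt_series K x) = (\<Sum>\<^sub>\<infinity>i. \<Sum>\<^sub>\<infinity>j. f i j)"
    by (subst sqrt_series_def) (simp add: inner)
  also have "\<dots> = infsum (\<lambda>(i,j). f i j) (UNIV \<times> UNIV)"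
    by (rule infsum_Sigma'_banach [OF summ])
  also have "\<dots> = infsum (\<lambda>(n,i). f i (n - i)) (SIGMA n:UNIV. {..n})"
    using infsum_reindex_bij_betw [OF bij, of "\<lambda>(i,j). f i j"]
    by (simp add: case_prod_unfold)
  also have "\<dots> = (\<Sum>\<^sub>\<infinity>n. \<Sum>\<^sub>\<infinity>i\<in>{..n}. f i (n - i))"
  proof (rule infsum_Sigma'_banach [symmetric])
    show "(\<lambda>(n,i). f i (n - i)) summable_on (SIGMA n:UNIV. {..n})"
      using summable_on_reindex_bij_betw [OF bij, of "\<lambda>(i,j). f i j"] summ
      by (simp add: case_prod_unfold)
  qed
  also have "\<dots> = (\<Sum>\<^sub>\<infinity>n. (\<Sum>i\<le>n. sqrt_coeff i * sqrt_coeff (n - i)) *\<^sub>R (K ^^ n) x)"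
    by (rule infsum_cong) (simp add: f_def scaleR_sum_left)
  also have "\<dots> = (\<Sum>\<^sub>\<infinity>n\<in>{0,1}. (\<Sum>i\<le>n. sqrt_coeff i * sqrt_coeff (n - i)) *\<^sub>R (K ^^ n) x)"
    by (rule infsum_cong_neutral) (auto simp: sqrt_coeff_convolution)
  also have "\<dots> = x - K x"
    by (simp add: sqrt_coeff_convolution)
  finally show ?thesis .
qed

text \<open>Positivity follows from the first term being \<open>x\<close> and the others adding up to at most
  \<open>\<parallel>x\<parallel>\<close>.\<close>

lemma positive_op_sqrt_series:
  assumes sa: "\<And>x y. cinner (K x) y = cinner x (K y)"
  shows "positive_op (sqrt_series K)"
proof (rule positive_opI [OF bounded_op_sqrt_series])
  fix x
  have pow: "cinner ((K ^^ n) u) v = cinner u ((K ^^ n) v)" for n u v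
    by (induction n arbitrary: u v) (auto simp: sa funpow_swap1)
  have im: "Im (cinner ((K ^^ n) x) x) = 0" for n
    using pow [of n x x] cinner_commute [of x] by (metis Reals_cnj_iff complex_is_Real_iff)
  have "bounded_linear (\<lambda>y. Im (cinner y x))"
    by (intro bounded_linear_compose [OF bounded_linear_Im] cinner.bounded_linear_left)
  from infsum_bounded_linear_comp [OF this sqrt_series_summable, of x]
  show "Im (cinner (sqrt_series K x) x) = 0"
    unfolding sqrt_series_def by (simp add: o_def cinner_scaleR_left im)
  have "- Re (cinner (sqrt_series K x - x) x) \<le> norm (sqrt_series K x - x) * norm x"
    using cinner_Cauchy_Schwarz [of "sqrt_series K x - x" x]
      abs_Re_le_cmod [of "cinner (sqrt_series K x - x) x"] by linarith
  also have "\<dots> \<le> norm x * norm x"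
    by (intro mult_right_mono sqrt_series_diff_le) simp
  finally show "0 \<le> Re (cinner (sqrt_series K x) x)"
    by (simp add: cinner.diff_left cinner_self power2_eq_square)
qed

end

text \<open>For \<open>\<parallel>P\<parallel> \<le> 1\<close> this makes \<open>1 - P\<close> a contraction, as
  \<open>\<parallel>x - P x\<parallel>\<^sup>2 = \<parallel>x\<parallel>\<^sup>2 - 2 \<langle>P x, x\<rangle> + \<parallel>P x\<parallel>\<^sup>2\<close>. It is the positivity of \<open>P\<close> at \<open>x - P x\<close>.\<close>

lemma positive_op_norm_le_form:
  assumes P: "positive_op P" and le: "\<And>x. norm (P x) \<le> norm x"
  shows "(norm (P x))\<^sup>2 \<le> Re (cinner (P x) x)"
proof -
  have "0 \<le> Re (cinner (P (x - P x)) (x - P x))"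
    by (rule positive_op_nonneg [OF P])
  also have "\<dots> = Re (cinner (P x) x) - 2 * (norm (P x))\<^sup>2 + Re (cinner (P (P x)) (P x))"
  proof -
    have "cinner (P (P x)) x = of_real ((norm (P x))\<^sup>2)"
      by (metis P cinner_self positive_op_selfadjoint)
    then show ?thesis
      by (simp add: bounded_op_diff positive_op_bounded [OF P] cinner.diff_left cinner.diff_right
          cinner_self del: of_real_power)
  qed
  also have "Re (cinner (P (P x)) (P x)) \<le> norm (P x) * norm (P x)"
    by (intro order_trans [OF complex_Re_le_cmod] order_trans [OF cinner_Cauchy_Schwarz]
        mult_right_mono le) simp
  finally show ?thesis by (simp add: power2_eq_square)
qed

lemma positive_sqrt_exists_contraction:
  assumes P: "positive_op P" and le: "\<And>x. norm (P x) \<le> norm x"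
  shows "\<exists>S. positive_op S \<and> S \<circ> S = P \<and> (\<forall>Q. bounded_op Q \<longrightarrow> Q \<circ> P = P \<circ> Q \<longrightarrow> Q \<circ> S = S \<circ> Q)"
proof -
  define K where "K = (\<lambda>x. x - P x)"
  note bP = positive_op_bounded [OF P]
  have "contraction K"
    unfolding contraction_def
  proof (intro conjI allI)
    show "bounded_op K" unfolding K_def by (intro bounded_op_minus_op bP bounded_op_id)
    fix x
    have "Re (cinner x (P x)) = Re (cinner (P x) x)"
      using positive_op_selfadjoint [OF P] by simp
    then have "(norm (K x))\<^sup>2 \<le> (norm x)\<^sup>2"
      using positive_op_norm_le_form [OF P le, of x] positive_op_nonneg [OF P, of x]
      unfolding K_def norm_diff_square by simp
    then show "norm (K x) \<le> norm x"
      by (rule power2_le_imp_le) simp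
  qed
  then show ?thesis
    using positive_op_sqrt_series [of K] sqrt_series_square [of K] sqrt_series_commute [of K]
    by (intro exI [of _ "sqrt_series K"])
      (auto simp: K_def fun_eq_iff cinner.diff_left cinner.diff_right positive_op_selfadjoint [OF P]
        bounded_op_diff)
qed

lemma positive_sqrt_exists:
  assumes P: "positive_op P"
  shows "\<exists>S. positive_op S \<and> S \<circ> S = P \<and> (\<forall>Q. bounded_op Q \<longrightarrow> Q \<circ> P = P \<circ> Q \<longrightarrow> Q \<circ> S = S \<circ> Q)"
proof -
  obtain M where M: "M > 0" "\<And>x. norm (P x) \<le> M * norm x"
    using bounded_op_bound positive_op_bounded [OF P] by blast
  define P' where "P' = (\<lambda>x. (1 / M) *\<^sub>R P x)"
  have "positive_op P'" unfolding P'_def using M by (intro positive_op_scaleR P) simp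
  moreover have "norm (P' x) \<le> norm x" for x
    using M by (simp add: P'_def field_simps)
  ultimately obtain S where S: "positive_op S" "S \<circ> S = P'"
    "\<And>Q. bounded_op Q \<Longrightarrow> Q \<circ> P' = P' \<circ> Q \<Longrightarrow> Q \<circ> S = S \<circ> Q"
    using positive_sqrt_exists_contraction by blast
  show ?thesis
  proof (intro exI [of _ "\<lambda>x. sqrt M *\<^sub>R S x"] conjI allI impI)
    show "positive_op (\<lambda>x. sqrt M *\<^sub>R S x)"
      using M S(1) by (intro positive_op_scaleR) auto
    show "(\<lambda>x. sqrt M *\<^sub>R S x) \<circ> (\<lambda>x. sqrt M *\<^sub>R S x) = P"
      using S(2) M positive_op_bounded [OF S(1)]
      by (simp add: fun_eq_iff P'_def bounded_op_scaleR)
    fix Q assume Q: "bounded_op Q" "Q \<circ> P = P \<circ> Q"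
    then have "Q \<circ> P' = P' \<circ> Q"
      by (simp add: fun_eq_iff P'_def bounded_op_scaleR)
    from S(3) [OF Q(1) this] show "Q \<circ> (\<lambda>x. sqrt M *\<^sub>R S x) = (\<lambda>x. sqrt M *\<^sub>R S x) \<circ> Q"
      using Q by (simp add: fun_eq_iff bounded_op_scaleR)
  qed
qed

text \<open>The form is \<open>\<parallel>S x\<parallel>\<^sup>2\<close> for a square root \<open>S\<close> of \<open>P\<close>.\<close>

lemma positive_op_form_zero:
  assumes P: "positive_op P" and "cinner (P x) x = 0"
  shows "P x = 0"
proof -
  obtain S where S: "positive_op S" "S \<circ> S = P" using positive_sqrt_exists [OF P] by blast
  have "cinner (S x) (S x) = cinner (P x) x"
    unfolding S(2) [symmetric] by (simp add: positive_op_selfadjoint [OF S(1)])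
  then have "S x = 0" using assms by (simp add: cinner_self)
  then show ?thesis
    using S bounded_op_0 [OF positive_op_bounded] by (metis comp_apply)
qed

text \<open>Another root \<open>Q\<close> commutes with \<open>P\<close>, hence with the root \<open>S\<close> given by the series. So
  \<open>(S + Q) (S - Q) = 0\<close>, and both nonnegative forms vanish at \<open>y = S x - Q x\<close>.\<close>

lemma positive_sqrt_unique:
  assumes P: "positive_op P"
  shows "\<exists>!S. positive_op S \<and> S \<circ> S = P"
proof -
  obtain S where S: "positive_op S" "S \<circ> S = P"
    and comm: "\<And>Q. bounded_op Q \<Longrightarrow> Q \<circ> P = P \<circ> Q \<Longrightarrow> Q \<circ> S = S \<circ> Q"
    using positive_sqrt_exists [OF P] by blast
  have "Q = S" if Q: "positive_op Q" "Q \<circ> Q = P" for Q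
  proof
    fix x
    note bS = positive_op_bounded [OF S(1)] and bQ = positive_op_bounded [OF Q(1)]
    have "Q \<circ> S = S \<circ> Q"
      using Q by (intro comm bQ) (auto simp: comp_assoc)
    then have QS: "Q (S u) = S (Q u)" for u by (metis comp_apply)
    have sq: "Q (Q u) = S (S u)" for u using S Q by (metis comp_apply)
    define y where "y = S x - Q x"
    have "S y + Q y = 0"
      by (simp add: y_def bounded_op_diff bS bQ QS sq)
    then have 0: "cinner (S y) y + cinner (Q y) y = 0"
      by (metis cinner_add_left cinner.zero_left)
    then have "Re (cinner (S y) y) + Re (cinner (Q y) y) = 0"
      by (metis plus_complex.sel(1) zero_complex.sel(1))
    then have "Re (cinner (S y) y) = 0" "Re (cinner (Q y) y) = 0"
      using positive_op_nonneg [OF S(1), of y] positive_op_nonneg [OF Q(1), of y] by linarith+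
    then have "S y = 0" "Q y = 0"
      using positive_op_form_zero S(1) Q(1) positive_op_cinner_real by (metis of_real_0)+
    then have "cinner y y = 0"
      using positive_op_selfadjoint [OF S(1), of x y] positive_op_selfadjoint [OF Q(1), of x y]
      by (metis y_def cinner.diff_left cinner.zero_right diff_self)
    then show "Q x = S x" by (simp add: cinner_self y_def)
  qed
  with S show ?thesis by blast
qed

lemma
  assumes A: "bounded_op A"
  shows positive_op_abs_op: "positive_op (abs_op A)"
    and abs_op_square: "abs_op A (abs_op A x) = adjoint_op A (A x)"
proof -
  have "positive_op (adjoint_op A \<circ> A)"
    using A bounded_op_compose [OF bounded_op_adjoint [OF A] A]
    by (intro positive_opI)
      (simp_all add: o_def cinner_adjoint' [symmetric] cinner_self flip: of_real_power)
  from theI' [OF positive_sqrt_unique [OF this]]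
  show "positive_op (abs_op A)" "abs_op A (abs_op A x) = adjoint_op A (A x)"
    unfolding abs_op_def by (auto simp: fun_eq_iff)
qed

lemma norm_abs_op:
  assumes A: "bounded_op A"
  shows "norm (abs_op A x) = norm (A x)"
proof -
  have "cinner (abs_op A x) (abs_op A x) = cinner (A x) (A x)"
    by (metis A abs_op_square cinner_adjoint' positive_op_abs_op positive_op_selfadjoint
        bounded_op_adjoint cinner_commute)
  then have "(norm (abs_op A x))\<^sup>2 = (norm (A x))\<^sup>2"
    by (metis cinner_self of_real_eq_iff)
  then show ?thesis by simp
qed

lemma norm_positive_op_shift:
  assumes P: "positive_op P"
  shows "(norm (P x + \<epsilon> *\<^sub>R x))\<^sup>2 = (norm (P x))\<^sup>2 + \<epsilon>\<^sup>2 * (norm x)\<^sup>2 + 2 * \<epsilon> * Re (cinner (P x) x)"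
  unfolding norm_add_square by (simp add: cinner_scaleR_right power_mult_distrib)

text \<open>The resolvent \<open>(P + \<epsilon>)\<^sup>-\<^sup>1\<close> of a positive operator, by Banach's fixed point theorem
  applied to \<open>x \<mapsto> x - t (P x + \<epsilon> x - y)\<close> for small \<open>t > 0\<close>.\<close>

lemma resolvent_exists:
  assumes P: "positive_op P" and "\<epsilon> > 0"
  shows "\<exists>R. bounded_op R \<and> (\<forall>y. P (R y) + \<epsilon> *\<^sub>R R y = y) \<and> (\<forall>x. R (P x + \<epsilon> *\<^sub>R x) = x)"
proof -
  note bP = positive_op_bounded [OF P]
  obtain M where M: "M > 0" "\<And>x. norm (P x) \<le> M * norm x"
    using bounded_op_bound bP by blast
  define G where "G x = P x + \<epsilon> *\<^sub>R x" for x
  have bG: "bounded_op G"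
    unfolding G_def by (intro bounded_op_plus bP bounded_op_real_scale bounded_op_id)
  define L where "L = M + \<epsilon>"
  have L: "L > 0" "\<epsilon> \<le> L" using M \<open>\<epsilon> > 0\<close> by (auto simp: L_def)
  have G_le: "norm (G x) \<le> L * norm x" for x
    unfolding G_def L_def distrib_right using M(2) [of x] \<open>\<epsilon> > 0\<close>
    by (intro norm_triangle_le add_mono) auto
  have G_form: "\<epsilon> * (norm x)\<^sup>2 \<le> Re (cinner x (G x))" for x
    using positive_op_nonneg [OF P, of x]
    by (simp add: G_def cinner_add_right cinner_scaleR_right cinner_self
        flip: positive_op_selfadjoint [OF P] of_real_power)
  have G_ge: "\<epsilon> * norm x \<le> norm (G x)" for x
  proof (rule power2_le_imp_le)
    show "(\<epsilon> * norm x)\<^sup>2 \<le> (norm (G x))\<^sup>2"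
      unfolding G_def norm_positive_op_shift [OF P]
      using positive_op_nonneg [OF P, of x] \<open>\<epsilon> > 0\<close> by (simp add: power_mult_distrib)
  qed simp
  have "\<exists>x. G x = y" for y
  proof -
    define t where "t = \<epsilon> / L\<^sup>2"
    have "t > 0" using L \<open>\<epsilon> > 0\<close> by (simp add: t_def)
    define c where "c = sqrt (1 - \<epsilon>\<^sup>2 / L\<^sup>2)"
    have c: "0 \<le> c" "c < 1" and c2: "c\<^sup>2 = 1 - \<epsilon>\<^sup>2 / L\<^sup>2"
      using L \<open>\<epsilon> > 0\<close> by (auto simp: c_def field_simps power_mono)
    define f where "f x = x - t *\<^sub>R (G x - y)" for x
    have "dist (f u) (f v) \<le> c * dist u v" for u v
    proof -
      define d where "d = u - v"
      have "f u - f v = d - t *\<^sub>R G d"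
        by (simp add: f_def d_def bounded_op_diff [OF bG] algebra_simps)
      then have "(norm (f u - f v))\<^sup>2 = (norm d)\<^sup>2 + t\<^sup>2 * (norm (G d))\<^sup>2 - 2 * t * Re (cinner d (G d))"
        by (simp add: norm_diff_square cinner_scaleR_right power_mult_distrib)
      also have "\<dots> \<le> (norm d)\<^sup>2 + t\<^sup>2 * (L * norm d)\<^sup>2 - 2 * t * (\<epsilon> * (norm d)\<^sup>2)"
        using \<open>t > 0\<close> by (intro diff_mono add_mono mult_left_mono power_mono G_le G_form) auto
      also have "\<dots> = (norm d)\<^sup>2 * (1 + t\<^sup>2 * L\<^sup>2 - 2 * t * \<epsilon>)"
        by (simp add: algebra_simps power_mult_distrib)
      also have "1 + t\<^sup>2 * L\<^sup>2 - 2 * t * \<epsilon> = c\<^sup>2"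
      proof -
        have tL: "t * L\<^sup>2 = \<epsilon>" using L by (simp add: t_def)
        have te: "\<epsilon>\<^sup>2 / L\<^sup>2 = t * \<epsilon>"
          unfolding t_def power2_eq_square by (rule times_divide_eq_left [symmetric])
        have "t\<^sup>2 * L\<^sup>2 = t * (t * L\<^sup>2)" by (simp add: power2_eq_square)
        also have "\<dots> = t * \<epsilon>" unfolding tL ..
        finally show ?thesis unfolding c2 te by algebra
      qed
      finally have "(norm (f u - f v))\<^sup>2 \<le> (c * norm d)\<^sup>2"
        by (simp add: power_mult_distrib mult.commute)
      then show ?thesis
        unfolding dist_norm d_def [symmetric] by (rule power2_le_imp_le) (simp add: c(1))
    qed
    then have "\<exists>!x. f x = x" by (intro banach_fix_type [OF c]) simp
    then obtain x where "f x = x" by blast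
    then show ?thesis using \<open>t > 0\<close> by (auto simp: f_def)
  qed
  then obtain R where R: "\<And>y. G (R y) = y" by metis
  have inj: "u = v" if "G u = G v" for u v
    using G_ge [of "u - v"] that \<open>\<epsilon> > 0\<close> by (simp add: bounded_op_diff [OF bG] mult_le_0_iff)
  have "bounded_op R"
  proof (rule bounded_opI)
    show "R (x + y) = R x + R y" for x y
      by (rule inj) (simp add: R bounded_op_add [OF bG])
    show "R (c *\<^sub>C x) = c *\<^sub>C R x" for c x
      by (rule inj) (simp add: R bounded_op_scaleC [OF bG])
    show "norm (R x) \<le> (1 / \<epsilon>) * norm x" for x
      using G_ge [of "R x"] \<open>\<epsilon> > 0\<close> by (simp add: R field_simps)
  qed
  moreover have "R (G x) = x" for x by (rule inj) (simp add: R)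
  ultimately show ?thesis using R unfolding G_def by blast
qed

section \<open>Orthonormal bases\<close>

lemma csubspace_closure:
  fixes V :: "'a::complex_normed_vector set"
  assumes V: "complex_vector.subspace V"
  shows "complex_vector.subspace (closure V)"
  unfolding complex_vector.subspace_def
proof (intro conjI ballI allI)
  show "0 \<in> closure V"
    using complex_vector.subspace_0 [OF V] closure_subset by blast
next
  fix x y assume "x \<in> closure V" "y \<in> closure V"
  then obtain f g where "\<And>n. f n \<in> V" "f \<longlonglongrightarrow> x" "\<And>n. g n \<in> V" "g \<longlonglongrightarrow> y"
    unfolding closure_sequential by blast
  then show "x + y \<in> closure V"
    unfolding closure_sequential
    by (intro exI [of _ "\<lambda>n. f n + g n"]) (auto intro: tendsto_add complex_vector.subspace_add V)
next
  fix c x assume "x \<in> closure V"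
  then obtain f where "\<And>n. f n \<in> V" "f \<longlonglongrightarrow> x"
    unfolding closure_sequential by blast
  then show "c *\<^sub>C x \<in> closure V"
    unfolding closure_sequential
    by (intro exI [of _ "\<lambda>n. c *\<^sub>C f n"]) (auto intro: scaleC_tendsto complex_vector.subspace_scale V)
qed

text \<open>A maximal orthonormal set has dense span: a vector outside the closed span would
  contribute, through its component orthogonal to it, a further unit vector.\<close>

lemma orthonormal_basis_exists: "\<exists>E. orthonormal_basis (E :: 'h::chilbert_space set)"
proof -
  define \<A> where "\<A> = {E :: 'h set. (\<forall>e\<in>E. norm e = 1) \<and> pairwise (\<lambda>e f. cinner e f = 0) E}"
  have "\<exists>E\<in>\<A>. \<forall>X\<in>\<A>. E \<subseteq> X \<longrightarrow> X = E"
  proof (rule subset_Zorn')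
    fix \<C> assume "subset.chain \<A> \<C>"
    then have \<C>: "\<C> \<subseteq> \<A>" and chain: "\<And>X Y. X \<in> \<C> \<Longrightarrow> Y \<in> \<C> \<Longrightarrow> X \<subseteq> Y \<or> Y \<subseteq> X"
      by (auto simp: subset_chain_def)
    have "pairwise (\<lambda>e f. cinner e f = 0) (\<Union>\<C>)"
    proof (rule pairwiseI)
      fix e f assume "e \<in> \<Union>\<C>" "f \<in> \<Union>\<C>" "e \<noteq> f"
      then obtain X where "X \<in> \<C>" "e \<in> X" "f \<in> X" using chain by blast
      with \<C> \<open>e \<noteq> f\<close> show "cinner e f = 0" unfolding \<A>_def pairwise_def by blast
    qed
    then show "\<Union>\<C> \<in> \<A>" using \<C> unfolding \<A>_def by blast
  qed
  then obtain E where E: "E \<in> \<A>" and max: "\<And>X. X \<in> \<A> \<Longrightarrow> E \<subseteq> X \<Longrightarrow> X = E" by blast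
  define M where "M = closure (complex_vector.span E)"
  have "x \<in> M" for x
  proof (rule ccontr)
    assume "x \<notin> M"
    have "closed M" "complex_vector.subspace M"
      unfolding M_def by (simp_all add: csubspace_closure complex_vector.subspace_span)
    then obtain y where y: "y \<in> M" "\<And>z. z \<in> M \<Longrightarrow> cinner (x - y) z = 0"
      using csubspace_orthogonal_projection_exists by blast
    define u where "u = (1 / norm (x - y)) *\<^sub>R (x - y)"
    have "x \<noteq> y" using y \<open>x \<notin> M\<close> by blast
    then have "norm u = 1" by (simp add: u_def)
    have EM: "E \<subseteq> M"
      unfolding M_def using closure_subset complex_vector.span_superset by blast
    then have orth: "cinner u e = 0" "cinner e u = 0" if "e \<in> E" for e
      using y(2) [of e] that cinner_commute [of e u] by (auto simp: u_def cinner_scaleR_left)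
    have "insert u E \<in> \<A>"
      using E orth \<open>norm u = 1\<close> by (auto simp: \<A>_def pairwise_insert)
    then have "u \<in> E" using max by blast
    then have "cinner u u = 0" using orth by blast
    with \<open>norm u = 1\<close> show False by (simp add: cinner_self)
  qed
  then have "closure (complex_vector.span E) = UNIV" unfolding M_def by blast
  with E show ?thesis unfolding orthonormal_basis_def \<A>_def by blast
qed

lemma orthonormal_basis_some_onb: "orthonormal_basis some_onb"
  unfolding some_onb_def by (rule someI_ex [OF orthonormal_basis_exists])

text \<open>An enumeration of the orthonormal basis in which the trace norm is computed.\<close>

locale onb_sequence =
  fixes e :: "nat \<Rightarrow> 'h::chilbert_space"
  assumes cinner_e: "cinner (e i) (e j) = (if i = j then 1 else 0)"
    and dense: "closure (complex_vector.span (range e)) = UNIV"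
    and range_e: "range e = some_onb"
begin

lemma norm_e [simp]: "norm (e i) = 1"
proof -
  have "complex_of_real ((norm (e i))\<^sup>2) = of_real 1"
    unfolding cinner_self [symmetric] cinner_e by simp
  then have "(norm (e i))\<^sup>2 = 1" unfolding of_real_eq_iff .
  then show ?thesis by (simp add: power2_eq_1_iff) (metis norm_ge_zero not_one_le_zero neg_0_le_iff_le)
qed

definition proj :: "nat set \<Rightarrow> 'h \<Rightarrow> 'h" where
  "proj F x = (\<Sum>i\<in>F. cinner x (e i) *\<^sub>C e i)"

lemma bounded_op_proj: "bounded_op (proj F)"
  unfolding proj_def by (intro bounded_op_sum_op bounded_op_rank_one)

lemma cinner_proj_e: "finite F \<Longrightarrow> cinner (proj F x) (e j) = (if j \<in> F then cinner x (e j) else 0)"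
  by (simp add: proj_def cinner.sum_left cinner_scaleC_left cinner_e if_distrib [of "(*) _"] cong: if_cong)

lemma cinner_proj: "cinner (proj F x) y = (\<Sum>i\<in>F. cinner x (e i) * cnj (cinner y (e i)))"
  by (simp add: proj_def cinner.sum_left cinner_scaleC_left flip: cinner_commute)

lemma proj_selfadjoint: "cinner (proj F x) y = cinner x (proj F y)"
proof -
  have "cinner x (proj F y) = cnj (cinner (proj F y) x)" by (rule cinner_commute)
  also have "\<dots> = cinner (proj F x) y"
    unfolding cinner_proj by (simp add: mult.commute)
  finally show ?thesis by simp
qed

lemma proj_e: "finite F \<Longrightarrow> proj F (e j) = (if j \<in> F then e j else 0)"
  by (simp add: proj_def cinner_e if_distrib [of "\<lambda>c. c *\<^sub>C _"] complex_vector.scale_zero_left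
      complex_vector.scale_one cong: if_cong)

lemma proj_proj: "finite F \<Longrightarrow> finite G \<Longrightarrow> proj F (proj G x) = proj (F \<inter> G) x"
  unfolding proj_def [of F] proj_def [of "F \<inter> G"]
  by (simp add: cinner_proj_e if_distrib [of "\<lambda>c. c *\<^sub>C _"] complex_vector.scale_zero_left
      sum.inter_restrict cong: if_cong)

lemma proj_Un: "finite F \<Longrightarrow> finite G \<Longrightarrow> F \<inter> G = {} \<Longrightarrow> proj (F \<union> G) x = proj F x + proj G x"
  unfolding proj_def by (rule sum.union_disjoint)

lemma norm_proj: "finite F \<Longrightarrow> (norm (proj F x))\<^sup>2 = (\<Sum>i\<in>F. (cmod (cinner x (e i)))\<^sup>2)"
proof -
  assume F: "finite F"
  have "complex_of_real ((norm (proj F x))\<^sup>2) = cinner (proj F x) (proj F x)"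
    by (simp add: cinner_self)
  also have "\<dots> = (\<Sum>i\<in>F. cinner x (e i) * cnj (cinner x (e i)))"
    by (subst cinner_proj, rule sum.cong) (simp_all add: F cinner_proj_e)
  also have "\<dots> = complex_of_real (\<Sum>i\<in>F. (cmod (cinner x (e i)))\<^sup>2)"
    unfolding of_real_sum by (rule sum.cong) (simp_all add: complex_norm_square [symmetric])
  finally show ?thesis by (simp only: of_real_eq_iff)
qed

lemma proj_pythagoras: "finite F \<Longrightarrow> (norm x)\<^sup>2 = (norm (proj F x))\<^sup>2 + (norm (x - proj F x))\<^sup>2"
proof -
  assume F: "finite F"
  have "cinner (proj F x) (x - proj F x) = cinner x (proj F (x - proj F x))"
    by (rule proj_selfadjoint)
  also have "proj F (x - proj F x) = 0"
    by (simp add: bounded_op_diff [OF bounded_op_proj] proj_proj F)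
  finally show ?thesis
    using norm_add_square [of "proj F x" "x - proj F x"] by (simp add: cinner.zero_right)
qed

lemma norm_proj_le: "finite F \<Longrightarrow> norm (proj F x) \<le> norm x"
  using proj_pythagoras [of F x] by (intro power2_le_imp_le [of "norm (proj F x)" "norm x"]) auto

lemma contraction_proj: "finite F \<Longrightarrow> contraction (proj F)"
  by (simp add: contraction_def bounded_op_proj norm_proj_le)

lemma contraction_coproj: "finite F \<Longrightarrow> contraction (\<lambda>x. x - proj F x)"
  unfolding contraction_def
proof (intro conjI allI bounded_op_minus_op bounded_op_proj bounded_op_id)
  fix x assume "finite F"
  then show "norm (x - proj F x) \<le> norm x"
    using proj_pythagoras [of F x]
    by (intro power2_le_imp_le [of "norm (x - proj F x)" "norm x"]) auto
qed

lemma span_e_eventually_proj: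
  assumes "y \<in> complex_vector.span (range e)"
  shows "\<exists>M. \<forall>N\<ge>M. proj {..<N} y = y"
proof -
  define V where "V = {y. \<exists>M. \<forall>N\<ge>M. proj {..<N} y = y}"
  have "complex_vector.subspace V"
    unfolding complex_vector.subspace_def
  proof (intro conjI ballI allI)
    show "0 \<in> V" unfolding V_def by (simp add: bounded_op_0 [OF bounded_op_proj])
  next
    fix x y assume "x \<in> V" "y \<in> V"
    then obtain M M' where "\<And>N. N \<ge> M \<Longrightarrow> proj {..<N} x = x" "\<And>N. N \<ge> M' \<Longrightarrow> proj {..<N} y = y"
      unfolding V_def by blast
    then show "x + y \<in> V"
      unfolding V_def by (auto intro!: exI [of _ "max M M'"] simp: bounded_op_add [OF bounded_op_proj])
  next
    fix c x assume "x \<in> V"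
    then show "c *\<^sub>C x \<in> V"
      unfolding V_def by (auto simp: bounded_op_scaleC [OF bounded_op_proj])
  qed
  moreover have "range e \<subseteq> V"
    by (auto simp: V_def proj_e) (meson Suc_le_lessD)
  ultimately have "complex_vector.span (range e) \<subseteq> V"
    by (intro complex_vector.span_minimal)
  with assms show ?thesis unfolding V_def by blast
qed

lemma proj_tendsto: "(\<lambda>N. proj {..<N} x) \<longlonglongrightarrow> x"
proof (rule metric_LIMSEQ_I)
  fix r :: real assume "r > 0"
  have "x \<in> closure (complex_vector.span (range e))" using dense by simp
  then obtain y where y: "y \<in> complex_vector.span (range e)" "dist y x < r"
    using \<open>r > 0\<close> by (meson closure_approachable)
  then obtain M where M: "\<And>N. N \<ge> M \<Longrightarrow> proj {..<N} y = y"
    using span_e_eventually_proj by blast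
  have "dist (proj {..<N} x) x < r" if "N \<ge> M" for N
  proof -
    have "x - proj {..<N} x = (x - y) - proj {..<N} (x - y)"
      using M [OF that] by (simp add: bounded_op_diff [OF bounded_op_proj])
    also have "norm \<dots> \<le> norm (x - y)"
      using contraction_coproj [of "{..<N}"] unfolding contraction_def by blast
    finally have "norm (x - proj {..<N} x) \<le> norm (x - y)"
      .
    then show ?thesis using y(2) by (simp add: dist_norm norm_minus_commute)
  qed
  then show "\<exists>no. \<forall>n\<ge>no. dist (proj {..<n} x) x < r" by blast
qed

lemma Parseval: "(\<lambda>i. (cmod (cinner x (e i)))\<^sup>2) sums (norm x)\<^sup>2"
proof -
  have "(\<lambda>N. (norm (proj {..<N} x))\<^sup>2) \<longlonglongrightarrow> (norm x)\<^sup>2"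
    by (intro tendsto_intros proj_tendsto)
  then show ?thesis by (simp add: sums_def norm_proj)
qed

lemma eq_if_coords_eq:
  assumes "\<And>i. cinner x (e i) = cinner y (e i)" shows "x = y"
proof -
  have "(\<lambda>i. 0 :: real) sums (norm (x - y))\<^sup>2"
    using Parseval [of "x - y"] assms by (simp add: cinner.diff_left)
  then have "(norm (x - y))\<^sup>2 = 0" using sums_unique2 [OF sums_zero] by metis
  then show ?thesis by simp
qed

text \<open>The Riesz--Fischer theorem: the partial sums of the expansion are Cauchy.\<close>

lemma exists_vector_with_coords:
  assumes "a \<in> ell2"
  shows "\<exists>x. \<forall>i. cinner x (e i) = a i"
proof -
  have a: "summable (\<lambda>i. (cmod (a i))\<^sup>2)" using assms by (simp add: ell2_def)
  define s where "s N = (\<Sum>i<N. a i *\<^sub>C e i)" for N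
  have coord: "cinner (s N) (e j) = (if j < N then a j else 0)" for N j
    by (simp add: s_def cinner.sum_left cinner_scaleC_left cinner_e if_distrib [of "(*) _"] cong: if_cong)
  have proj_s: "proj {..<N} (s M) = s M" if "M \<le> N" for M N
    using that by (simp add: s_def bounded_op_sum [OF bounded_op_proj] bounded_op_scaleC [OF bounded_op_proj] proj_e)
  have norm_s: "(norm (s N - s M))\<^sup>2 = (\<Sum>i\<in>{M..<N}. (cmod (a i))\<^sup>2)" if "M \<le> N" for M N
  proof -
    have "s N - s M = proj {..<N} (s N - s M)"
      using that by (simp add: bounded_op_diff [OF bounded_op_proj] proj_s)
    then have "(norm (s N - s M))\<^sup>2 = (\<Sum>i<N. (cmod (cinner (s N - s M) (e i)))\<^sup>2)"
      by (metis norm_proj finite_lessThan)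
    also have "\<dots> = (\<Sum>i\<in>{M..<N}. (cmod (a i))\<^sup>2)"
      using that by (intro sum.mono_neutral_cong_right) (auto simp: cinner.diff_left coord)
    finally show ?thesis .
  qed
  have "Cauchy s"
  proof (rule metric_CauchyI)
    fix r :: real assume "r > 0"
    then have "r\<^sup>2 > 0" by simp
    then obtain K where K: "\<And>m n. m \<ge> K \<Longrightarrow> norm (\<Sum>i\<in>{m..<n}. (cmod (a i))\<^sup>2) < r\<^sup>2"
      using a unfolding summable_Cauchy by blast
    have *: "norm (s n - s m) < r" if "m \<ge> K" "m \<le> n" for m n
    proof (rule power_less_imp_less_base)
      show "(norm (s n - s m))\<^sup>2 < r\<^sup>2"
        using K [OF that(1), of n] norm_s [OF that(2)] by (simp add: abs_of_nonneg sum_nonneg)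
    qed (use \<open>r > 0\<close> in simp)
    have "dist (s m) (s n) < r" if "m \<ge> K" "n \<ge> K" for m n
      using * [of m n] * [of n m] that by (cases "m \<le> n") (auto simp: dist_norm norm_minus_commute)
    then show "\<exists>M. \<forall>m\<ge>M. \<forall>n\<ge>M. dist (s m) (s n) < r" by blast
  qed
  then obtain x where x: "s \<longlonglongrightarrow> x" using Cauchy_convergent convergent_def by blast
  have "cinner x (e j) = a j" for j
  proof (rule LIMSEQ_unique)
    show "(\<lambda>N. cinner (s N) (e j)) \<longlonglongrightarrow> cinner x (e j)"
      by (intro tendsto_intros x)
    show "(\<lambda>N. cinner (s N) (e j)) \<longlonglongrightarrow> a j"
      by (rule tendsto_eventually) (auto simp: coord eventually_sequentially intro!: exI [of _ "Suc j"])
  qed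
  then show ?thesis by blast
qed

lemma coords_in_ell2: "(\<lambda>i. cinner x (e i)) \<in> ell2"
  using Parseval [of x] by (auto simp: ell2_def sums_iff)

lemma ell2_norm_coords: "ell2_norm (\<lambda>i. cinner x (e i)) = norm x"
  using Parseval [of x] by (simp add: ell2_norm_def sums_iff)

end

text \<open>Elements of an orthonormal set have mutual distance \<open>sqrt 2\<close>, so no two of them are
  within \<open>1/2\<close> of the same point of a dense set.\<close>

lemma orthonormal_countable:
  fixes E :: "'h::chilbert_space set"
  assumes sep: "separable_space (euclidean :: 'h topology)"
    and E: "\<forall>e\<in>E. norm e = 1" "pairwise (\<lambda>e f. cinner e f = 0) E"
  shows "countable E"
proof -
  obtain C :: "'h set" where C: "countable C" "closure C = UNIV"
    using sep unfolding separable_space_def by (auto simp: euclidean_closure_of)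
  have "\<exists>c\<in>C. dist c e < 1/2" for e
    using C(2) closure_approachable [of e C] by (metis UNIV_I half_gt_zero_iff zero_less_one)
  then obtain c where c: "\<And>e. c e \<in> C" "\<And>e. dist (c e) e < 1/2" by metis
  have "inj_on c E"
  proof (rule inj_onI, rule ccontr)
    fix e f assume ef: "e \<in> E" "f \<in> E" "c e = c f" "e \<noteq> f"
    then have "cinner e f = 0" using E(2) by (auto simp: pairwise_def)
    then have "(norm (e - f))\<^sup>2 = 2"
      using E(1) ef by (simp add: norm_diff_square)
    moreover have "norm (e - f) < 1"
      using c(2) [of e] c(2) [of f] ef(3) dist_triangle_half_r [of "c e" e 1 f] by (simp add: dist_norm)
    then have "(norm (e - f))\<^sup>2 < 1" by (simp add: power_less_one_iff)
    ultimately show False by simp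
  qed
  moreover have "c ` E \<subseteq> C" using c(1) by blast
  ultimately show ?thesis
    using C(1) countable_image_inj_on countable_subset by blast
qed

text \<open>The expansion in a finite orthonormal set is continuous and fixes the span, hence also
  its closure.\<close>

lemma finite_onb_spans:
  fixes E :: "'h::chilbert_space set"
  assumes "finite E" and E: "orthonormal_basis E"
  shows "complex_vector.span E = UNIV"
proof -
  define p where "p x = (\<Sum>e\<in>E. cinner x e *\<^sub>C e)" for x
  have bp: "bounded_op p" unfolding p_def by (intro bounded_op_sum_op bounded_op_rank_one)
  have 1: "norm e = 1" if "e \<in> E" for e using E that by (simp add: orthonormal_basis_def)
  have 0: "cinner e f = 0" if "e \<in> E" "f \<in> E" "e \<noteq> f" for e f
    using E that by (auto simp: orthonormal_basis_def pairwise_def)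
  have "p f = f" if "f \<in> E" for f
  proof -
    have "p f = (\<Sum>e\<in>E. if e = f then f else 0)"
      unfolding p_def
      by (rule sum.cong) (use that in \<open>auto simp: 0 1 cinner_self complex_vector.scale_one
          complex_vector.scale_zero_left\<close>)
    also have "\<dots> = f" using \<open>finite E\<close> that by simp
    finally show ?thesis .
  qed
  moreover have "complex_vector.subspace {x. p x = x}"
    unfolding complex_vector.subspace_def
    by (simp add: bounded_op_0 [OF bp] bounded_op_add [OF bp] bounded_op_scaleC [OF bp])
  ultimately have "complex_vector.span E \<subseteq> {x. p x = x}"
    by (intro complex_vector.span_minimal) auto
  moreover have "closed {x. p x = x}"
    using bounded_op_imp_bounded_linear [OF bp]
    by (intro closed_Collect_eq linear_continuous_on continuous_on_id)
  ultimately have "closure (complex_vector.span E) \<subseteq> {x. p x = x}"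
    by (rule closure_minimal)
  then have "p x = x" for x
    using E by (auto simp: orthonormal_basis_def)
  moreover have "p x \<in> complex_vector.span E" for x
    unfolding p_def by (intro complex_vector.span_sum complex_vector.span_scale complex_vector.span_base)
  ultimately show ?thesis by (metis UNIV_eq_I)
qed

lemma onb_sequence_exists:
  assumes "separable_space (euclidean :: 'h::chilbert_space topology)"
    and "\<not> (\<exists>B::'h set. finite B \<and> complex_vector.span B = UNIV)"
  shows "\<exists>e :: nat \<Rightarrow> 'h. onb_sequence e"
proof -
  define E where "E = (some_onb :: 'h set)"
  have E: "orthonormal_basis E" unfolding E_def by (rule orthonormal_basis_some_onb)
  then have E': "\<forall>e\<in>E. norm e = 1" "pairwise (\<lambda>e f. cinner e f = 0) E"
    "closure (complex_vector.span E) = UNIV"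
    by (auto simp: orthonormal_basis_def)
  have "infinite E" using finite_onb_spans [OF _ E] assms(2) by blast
  moreover have "countable E" using orthonormal_countable assms(1) E' by blast
  ultimately obtain e :: "nat \<Rightarrow> 'h" where e: "bij_betw e UNIV E"
    using countableE_infinite by (metis bij_betw_from_nat_into)
  then have e_range: "range e = E" and e_inj: "inj e" by (auto simp: bij_betw_def)
  have "onb_sequence e"
  proof
    fix i j
    show "cinner (e i) (e j) = (if i = j then 1 else 0)"
    proof (cases "i = j")
      case True
      have "norm (e j) = 1" using E'(1) e_range by blast
      with True show ?thesis by (simp add: cinner_self)
    next
      case False
      then have "e i \<noteq> e j" using e_inj by (auto simp: inj_def)
      moreover have "e i \<in> E" "e j \<in> E" using e_range by auto
      ultimately show ?thesis using E'(2) False by (auto simp: pairwise_def)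
    qed
  qed (use E' e_range E_def in auto)
  then show ?thesis by blast
qed

section \<open>The trace norm as a supremum\<close>

text \<open>An approximate polar decomposition \<open>A = V (\<bar>A\<bar> + \<epsilon>)\<close>, obtained without
  extending a partial isometry: take \<open>V = A (\<bar>A\<bar> + \<epsilon>)\<^sup>-\<^sup>1\<close>.\<close>

lemma approximate_polar_decomposition:
  assumes A: "bounded_op A" and "\<epsilon> > 0"
  obtains V where "contraction V" "\<And>x. A x = V (abs_op A x + \<epsilon> *\<^sub>R x)"
    "\<And>x. cmod (cinner (A x) (V x) - cinner (abs_op A x) x) \<le> \<epsilon> * (norm x)\<^sup>2"
proof -
  define P where "P = abs_op A"
  have P: "positive_op P" unfolding P_def by (rule positive_op_abs_op [OF A])
  obtain R where R: "bounded_op R" "\<And>y. P (R y) + \<epsilon> *\<^sub>R R y = y" "\<And>x. R (P x + \<epsilon> *\<^sub>R x) = x"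
    using resolvent_exists [OF P \<open>\<epsilon> > 0\<close>] by blast
  have PR: "norm (P (R y)) \<le> norm y" for y
  proof (rule power2_le_imp_le)
    have "(norm (P (R y)))\<^sup>2 \<le> (norm (P (R y) + \<epsilon> *\<^sub>R R y))\<^sup>2"
      unfolding norm_positive_op_shift [OF P]
      using positive_op_nonneg [OF P, of "R y"] \<open>\<epsilon> > 0\<close> by simp
    then show "(norm (P (R y)))\<^sup>2 \<le> (norm y)\<^sup>2" by (simp add: R(2))
  qed simp
  show thesis
  proof (rule that [of "\<lambda>x. A (R x)"])
    show "contraction (\<lambda>x. A (R x))"
      unfolding contraction_def
      using bounded_op_compose [OF A R(1)] PR norm_abs_op [OF A] by (simp add: P_def)
    show "A x = A (R (abs_op A x + \<epsilon> *\<^sub>R x))" for x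
      using R(3) by (simp add: P_def)
    fix x
    have "cinner (A x) (A (R x)) = cinner (P (P x)) (R x)"
      unfolding P_def abs_op_square [OF A] using cinner_adjoint' [OF bounded_op_adjoint [OF A]]
      by (metis A cinner_adjoint cinner_adjoint' cinner_commute)
    also have "\<dots> = cinner (P x) (P (R x))" by (rule positive_op_selfadjoint [OF P])
    also have "P (R x) = x - \<epsilon> *\<^sub>R R x" using R(2) [of x] by (simp add: eq_diff_eq)
    also have "cinner (P x) (x - \<epsilon> *\<^sub>R R x) = cinner (P x) x - of_real \<epsilon> * cinner x (P (R x))"
      by (simp add: cinner.diff_right cinner_scaleR_right positive_op_selfadjoint [OF P])
    finally have "cmod (cinner (A x) (A (R x)) - cinner (P x) x) = \<epsilon> * cmod (cinner x (P (R x)))"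
      using \<open>\<epsilon> > 0\<close> by (simp add: norm_mult)
    also have "\<dots> \<le> \<epsilon> * (norm x * norm x)"
      using \<open>\<epsilon> > 0\<close>
      by (intro mult_left_mono order_trans [OF cinner_Cauchy_Schwarz] mult_left_mono PR) auto
    finally show "cmod (cinner (A x) (A (R x)) - cinner (abs_op A x) x) \<le> \<epsilon> * (norm x)\<^sup>2"
      by (simp add: P_def power2_eq_square)
  qed
qed

context onb_sequence
begin

lemma inj_e: "inj e"
  by (rule injI) (metis cinner_e zero_neq_one)

lemma trace_class_iff:
  "A \<in> trace_class \<longleftrightarrow> bounded_op A \<and> (\<lambda>i. Re (cinner (abs_op A (e i)) (e i))) summable_on UNIV"
  using summable_on_reindex [OF inj_e, of "\<lambda>f. Re (cinner (abs_op A f) f)"]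
  unfolding trace_class_def range_e by (simp add: o_def)

lemma trace_norm_eq: "trace_norm A = (\<Sum>\<^sub>\<infinity>i. Re (cinner (abs_op A (e i)) (e i)))"
  using infsum_reindex [OF inj_e, of "\<lambda>f. Re (cinner (abs_op A f) f)"]
  unfolding trace_norm_def range_e by (simp add: o_def)

lemma trace_class_bounded_op: "A \<in> trace_class \<Longrightarrow> bounded_op A"
  by (simp add: trace_class_def)

text \<open>A partial sum of the diagonal of \<open>B\<^sup>* A\<close>.\<close>

definition partial_trace :: "nat set \<Rightarrow> ('h \<Rightarrow> 'h) \<Rightarrow> ('h \<Rightarrow> 'h) \<Rightarrow> complex" where
  "partial_trace F B A = (\<Sum>i\<in>F. cinner (A (e i)) (B (e i)))"

text \<open>With \<open>P = S\<^sup>2\<close> the partial trace is a Hilbert--Schmidt inner product of \<open>S\<close> with \<open>S C\<close>,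
  and the Hilbert--Schmidt norm of \<open>S C\<close> is that of \<open>C\<^sup>* S\<close>, hence at most that of \<open>S\<close>.\<close>

lemma partial_trace_positive_le:
  assumes P: "positive_op P" and summ: "(\<lambda>i. Re (cinner (P (e i)) (e i))) summable_on UNIV"
    and C: "contraction C" and F: "finite F"
  shows "cmod (partial_trace F C P) \<le> (\<Sum>\<^sub>\<infinity>i. Re (cinner (P (e i)) (e i)))"
proof -
  define t where "t = (\<Sum>\<^sub>\<infinity>i. Re (cinner (P (e i)) (e i)))"
  have bC: "bounded_op C" using C by (simp add: contraction_def)
  obtain S where S: "positive_op S" "S \<circ> S = P" using positive_sqrt_exists [OF P] by blast
  have PS: "cinner (P x) y = cinner (S x) (S y)" for x y
    unfolding S(2) [symmetric] by (simp add: positive_op_selfadjoint [OF S(1)])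
  have sum_le: "(\<Sum>i\<in>G. (norm (S (e i)))\<^sup>2) \<le> t" if "finite G" for G
  proof -
    have "(\<Sum>i\<in>G. (norm (S (e i)))\<^sup>2) = (\<Sum>i\<in>G. Re (cinner (P (e i)) (e i)))"
      by (simp add: PS cinner_self flip: of_real_power)
    also have "\<dots> \<le> t"
      unfolding t_def by (rule finite_sum_le_infsum [OF summ that])
        (simp_all add: positive_op_nonneg [OF P])
    finally show ?thesis .
  qed
  have "t \<ge> 0" using sum_le [of "{}"] by simp
  have coord: "cmod (cinner (S (C (e i))) (e j)) = cmod (cinner (adjoint_op C (S (e j))) (e i))" for i j
  proof -
    have "cinner (S (C (e i))) (e j) = cinner (e i) (adjoint_op C (S (e j)))"
      by (simp add: positive_op_selfadjoint [OF S(1)] cinner_adjoint [OF bC])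
    also have "\<dots> = cnj (cinner (adjoint_op C (S (e j))) (e i))" by (rule cinner_commute)
    finally show ?thesis by simp
  qed
  have sum_le': "(\<Sum>i\<in>F. (norm (S (C (e i))))\<^sup>2) \<le> t"
  proof (rule LIMSEQ_le_const2)
    show "(\<lambda>N. \<Sum>i\<in>F. \<Sum>j<N. (cmod (cinner (S (C (e i))) (e j)))\<^sup>2)
        \<longlonglongrightarrow> (\<Sum>i\<in>F. (norm (S (C (e i))))\<^sup>2)"
      by (intro tendsto_sum) (use Parseval in \<open>simp add: sums_def\<close>)
    have "(\<Sum>i\<in>F. \<Sum>j<N. (cmod (cinner (S (C (e i))) (e j)))\<^sup>2) \<le> t" for N
    proof -
      have "(\<Sum>i\<in>F. \<Sum>j<N. (cmod (cinner (S (C (e i))) (e j)))\<^sup>2)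
          = (\<Sum>j<N. \<Sum>i\<in>F. (cmod (cinner (adjoint_op C (S (e j))) (e i)))\<^sup>2)"
        unfolding coord by (rule sum.swap)
      also have "\<dots> = (\<Sum>j<N. (norm (proj F (adjoint_op C (S (e j)))))\<^sup>2)"
        by (simp add: norm_proj F)
      also have "\<dots> \<le> (\<Sum>j<N. (norm (S (e j)))\<^sup>2)"
        using contraction_adjoint [OF C] norm_proj_le [OF F]
        by (intro sum_mono power_mono) (auto simp: contraction_def intro: order_trans)
      also have "\<dots> \<le> t" by (rule sum_le) simp
      finally show ?thesis .
    qed
    then show "\<exists>N. \<forall>n\<ge>N. (\<Sum>i\<in>F. \<Sum>j<n. (cmod (cinner (S (C (e i))) (e j)))\<^sup>2) \<le> t" by blast
  qed
  have "cmod (partial_trace F C P) \<le> (\<Sum>i\<in>F. \<bar>norm (S (e i))\<bar> * \<bar>norm (S (C (e i)))\<bar>)"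
    unfolding partial_trace_def PS
    by (rule sum_norm_le) (simp add: cinner_Cauchy_Schwarz)
  also have "\<dots> \<le> L2_set (\<lambda>i. norm (S (e i))) F * L2_set (\<lambda>i. norm (S (C (e i)))) F"
    by (rule L2_set_mult_ineq)
  also have "\<dots> \<le> sqrt t * sqrt t"
    unfolding L2_set_def
    using sum_le [OF F] sum_le' \<open>t \<ge> 0\<close>
    by (intro mult_mono real_sqrt_le_mono) (auto intro: sum_nonneg)
  also have "\<dots> = t" using \<open>t \<ge> 0\<close> by simp
  finally show ?thesis unfolding t_def .
qed

text \<open>The next two lemmas say that \<open>trace_norm A\<close> is the supremum of the partial traces of
  \<open>B\<^sup>* A\<close> over finite sets and contractions \<open>B\<close>. Everything below about the trace norm is
  deduced from this description.\<close>

lemma partial_trace_le_trace_norm: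
  assumes A: "A \<in> trace_class" and B: "contraction B" and F: "finite F"
  shows "cmod (partial_trace F B A) \<le> trace_norm A"
proof (rule field_le_epsilon)
  fix \<delta> :: real assume "\<delta> > 0"
  define \<epsilon> where "\<epsilon> = \<delta> / (real (card F) + 1)"
  have "\<epsilon> > 0" using \<open>\<delta> > 0\<close> by (simp add: \<epsilon>_def)
  have bA: "bounded_op A" and summ: "(\<lambda>i. Re (cinner (abs_op A (e i)) (e i))) summable_on UNIV"
    using A by (auto simp: trace_class_iff)
  obtain V where V: "contraction V" "\<And>x. A x = V (abs_op A x + \<epsilon> *\<^sub>R x)"
    using approximate_polar_decomposition [OF bA \<open>\<epsilon> > 0\<close>] by metis
  define C where "C = (\<lambda>x. adjoint_op V (B x))"
  have C: "contraction C"
    unfolding C_def by (rule contraction_compose [OF contraction_adjoint [OF V(1)] B])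
  have bV: "bounded_op V" using V by (simp add: contraction_def)
  have "cinner (A x) (B x) = cinner (abs_op A x) (C x) + of_real \<epsilon> * cinner x (C x)" for x
    by (subst V(2)) (simp add: cinner_adjoint [OF bV] cinner_add_left cinner_scaleR_left C_def)
  then have "partial_trace F B A = partial_trace F C (abs_op A) + of_real \<epsilon> * (\<Sum>i\<in>F. cinner (e i) (C (e i)))"
    unfolding partial_trace_def by (simp add: sum.distrib sum_distrib_left)
  then have "cmod (partial_trace F B A)
      \<le> cmod (partial_trace F C (abs_op A)) + cmod (of_real \<epsilon> * (\<Sum>i\<in>F. cinner (e i) (C (e i))))"
    by (metis norm_triangle_ineq)
  also have "\<dots> \<le> trace_norm A + \<delta>"
  proof (rule add_mono)
    show "cmod (partial_trace F C (abs_op A)) \<le> trace_norm A"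
      unfolding trace_norm_eq
      by (rule partial_trace_positive_le [OF positive_op_abs_op [OF bA] summ C F])
    have "cmod (cinner (e i) (C (e i))) \<le> 1" for i
      using C cinner_Cauchy_Schwarz [of "e i" "C (e i)"] unfolding contraction_def
      by (metis mult_1 norm_e order_trans)
    then have "cmod (\<Sum>i\<in>F. cinner (e i) (C (e i))) \<le> (\<Sum>i\<in>F. 1)"
      by (rule sum_norm_le)
    then have "cmod (of_real \<epsilon> * (\<Sum>i\<in>F. cinner (e i) (C (e i)))) \<le> \<epsilon> * real (card F)"
      using \<open>\<epsilon> > 0\<close> by (simp add: norm_mult)
    also have "\<dots> \<le> \<delta>"
      using \<open>\<delta> > 0\<close> by (simp add: \<epsilon>_def field_simps)
    finally show "cmod (of_real \<epsilon> * (\<Sum>i\<in>F. cinner (e i) (C (e i)))) \<le> \<delta>" .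
  qed
  finally show "cmod (partial_trace F B A) \<le> trace_norm A + \<delta>" .
qed

lemma trace_classI:
  assumes A: "bounded_op A"
    and le: "\<And>F B. finite F \<Longrightarrow> contraction B \<Longrightarrow> cmod (partial_trace F B A) \<le> t"
  shows "A \<in> trace_class" and "trace_norm A \<le> t"
proof -
  have *: "(\<Sum>i\<in>F. Re (cinner (abs_op A (e i)) (e i))) \<le> t" if F: "finite F" for F
  proof (rule field_le_epsilon)
    fix \<delta> :: real assume "\<delta> > 0"
    define \<epsilon> where "\<epsilon> = \<delta> / (real (card F) + 1)"
    have "\<epsilon> > 0" using \<open>\<delta> > 0\<close> by (simp add: \<epsilon>_def)
    obtain V where V: "contraction V"
      "\<And>x. cmod (cinner (A x) (V x) - cinner (abs_op A x) x) \<le> \<epsilon> * (norm x)\<^sup>2"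
      using approximate_polar_decomposition [OF A \<open>\<epsilon> > 0\<close>] by metis
    have "Re (cinner (abs_op A (e i)) (e i)) \<le> Re (cinner (A (e i)) (V (e i))) + \<epsilon>" for i
      using V(2) [of "e i"] abs_Re_le_cmod [of "cinner (A (e i)) (V (e i)) - cinner (abs_op A (e i)) (e i)"]
      by (simp add: abs_if split: if_splits)
    then have "(\<Sum>i\<in>F. Re (cinner (abs_op A (e i)) (e i))) \<le> (\<Sum>i\<in>F. Re (cinner (A (e i)) (V (e i))) + \<epsilon>)"
      by (rule sum_mono)
    also have "\<dots> = Re (partial_trace F V A) + real (card F) * \<epsilon>"
      by (simp add: partial_trace_def sum.distrib Re_sum)
    also have "\<dots> \<le> t + \<delta>"
    proof (rule add_mono)
      show "Re (partial_trace F V A) \<le> t"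
        by (rule order_trans [OF complex_Re_le_cmod le [OF F V(1)]])
      show "real (card F) * \<epsilon> \<le> \<delta>"
        using \<open>\<delta> > 0\<close> by (simp add: \<epsilon>_def field_simps)
    qed
    finally show "(\<Sum>i\<in>F. Re (cinner (abs_op A (e i)) (e i))) \<le> t + \<delta>" .
  qed
  have summ: "(\<lambda>i. Re (cinner (abs_op A (e i)) (e i))) summable_on UNIV"
    by (rule nonneg_bdd_above_summable_on)
      (use * in \<open>auto intro!: bdd_aboveI2 positive_op_nonneg positive_op_abs_op A\<close>)
  then show "A \<in> trace_class" using A by (simp add: trace_class_iff)
  show "trace_norm A \<le> t"
    unfolding trace_norm_eq using summ * by (rule infsum_le_finite_sums)
qed

lemma contraction_zero: "contraction (\<lambda>x. 0 :: 'h)"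
  by (simp add: contraction_def)

lemma trace_norm_nonneg: "(A :: 'h \<Rightarrow> 'h) \<in> trace_class \<Longrightarrow> 0 \<le> trace_norm A"
  using partial_trace_le_trace_norm [OF _ contraction_zero, of A "{}"] by (simp add: partial_trace_def)

lemma trace_class_add:
  fixes A B :: "'h \<Rightarrow> 'h"
  assumes A: "A \<in> trace_class" and B: "B \<in> trace_class"
  shows "A + B \<in> trace_class"
proof (rule trace_classI(1))
  show "bounded_op (A + B)"
    unfolding plus_fun_def using A B by (intro bounded_op_plus trace_class_bounded_op)
  fix F :: "nat set" and C :: "'h \<Rightarrow> 'h" assume "finite F" "contraction C"
  moreover have "partial_trace F C (A + B) = partial_trace F C A + partial_trace F C B"
    by (simp add: partial_trace_def cinner_add_left sum.distrib)
  ultimately show "cmod (partial_trace F C (A + B)) \<le> trace_norm A + trace_norm B"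
    using partial_trace_le_trace_norm [OF A] partial_trace_le_trace_norm [OF B]
    by (simp add: norm_triangle_le add_mono)
qed

lemma trace_class_scaleC:
  fixes A :: "'h \<Rightarrow> 'h"
  assumes A: "A \<in> trace_class"
  shows "c *\<^sub>C A \<in> trace_class"
proof (rule trace_classI(1))
  show "bounded_op (c *\<^sub>C A)"
    unfolding scaleC_fun_def using A by (intro bounded_op_scale trace_class_bounded_op)
  fix F :: "nat set" and C :: "'h \<Rightarrow> 'h" assume "finite F" "contraction C"
  moreover have "partial_trace F C (c *\<^sub>C A) = c * partial_trace F C A"
    by (simp add: partial_trace_def scaleC_fun_def cinner_scaleC_left sum_distrib_left)
  ultimately show "cmod (partial_trace F C (c *\<^sub>C A)) \<le> cmod c * trace_norm A"
    using partial_trace_le_trace_norm [OF A] by (simp add: norm_mult mult_left_mono)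
qed

lemma trace_class_zero: "(0 :: 'h \<Rightarrow> 'h) \<in> trace_class"
  using trace_classI(1) [of "0 :: 'h \<Rightarrow> 'h" 0]
  by (simp add: zero_fun_def partial_trace_def cinner.zero_left)

lemma minus_eq_scaleC: "A - B = A + (- 1) *\<^sub>C (B :: 'h \<Rightarrow> 'h)"
  by (simp add: fun_eq_iff scaleC_fun_def complex_vector.scale_minus_left complex_vector.scale_one)

lemma trace_class_diff: "(A :: 'h \<Rightarrow> 'h) \<in> trace_class \<Longrightarrow> B \<in> trace_class \<Longrightarrow> A - B \<in> trace_class"
  unfolding minus_eq_scaleC by (intro trace_class_add trace_class_scaleC)

lemma
  fixes A C :: "'h \<Rightarrow> 'h"
  assumes A: "A \<in> trace_class" and C: "contraction C"
  shows trace_class_contraction_left: "(\<lambda>x. C (A x)) \<in> trace_class"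
    and trace_norm_contraction_left: "trace_norm (\<lambda>x. C (A x)) \<le> trace_norm A"
proof -
  have bC: "bounded_op C" using C by (simp add: contraction_def)
  have b: "bounded_op (\<lambda>x. C (A x))"
    by (rule bounded_op_compose [OF bC trace_class_bounded_op [OF A]])
  have le: "cmod (partial_trace F B (\<lambda>x. C (A x))) \<le> trace_norm A"
    if "finite F" "contraction B" for F B
  proof -
    have "partial_trace F B (\<lambda>x. C (A x)) = partial_trace F (\<lambda>x. adjoint_op C (B x)) A"
      by (simp add: partial_trace_def cinner_adjoint [OF bC])
    then show ?thesis
      using partial_trace_le_trace_norm [OF A contraction_compose [OF contraction_adjoint [OF C] that(2)] that(1)]
      by simp
  qed
  show "(\<lambda>x. C (A x)) \<in> trace_class" "trace_norm (\<lambda>x. C (A x)) \<le> trace_norm A"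
    using trace_classI [OF b le] by auto
qed

text \<open>Multiplication by a diagonal projection on the right only drops terms of the partial
  traces.\<close>

lemma
  assumes A: "A \<in> trace_class" and D: "bounded_op D" and diag: "\<And>i. D (e i) = (if i \<in> G then e i else 0)"
  shows trace_class_diagonal_right: "(\<lambda>x. A (D x)) \<in> trace_class"
    and trace_norm_diagonal_right: "trace_norm (\<lambda>x. A (D x)) \<le> trace_norm A"
proof -
  note bA = trace_class_bounded_op [OF A]
  have b: "bounded_op (\<lambda>x. A (D x))"
    by (rule bounded_op_compose [OF bA D])
  have le: "cmod (partial_trace F B (\<lambda>x. A (D x))) \<le> trace_norm A"
    if "finite F" "contraction B" for F B
  proof -
    have "partial_trace F B (\<lambda>x. A (D x)) = partial_trace (F \<inter> G) B A"
      unfolding partial_trace_def sum.inter_restrict [OF that(1)]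
      by (rule sum.cong) (simp_all add: diag bounded_op_0 [OF bA] cinner.zero_left)
    then show ?thesis
      using partial_trace_le_trace_norm [OF A that(2)] that(1) by simp
  qed
  show "(\<lambda>x. A (D x)) \<in> trace_class" "trace_norm (\<lambda>x. A (D x)) \<le> trace_norm A"
    using trace_classI [OF b le] by auto
qed

lemma partial_trace_le_bound:
  assumes A: "A \<in> trace_class" and B: "bounded_op B" and K: "\<And>x. norm (B x) \<le> K * norm x"
    and F: "finite F"
  shows "cmod (partial_trace F B A) \<le> K * trace_norm A"
proof (cases "K > 0")
  case True
  define C where "C = (\<lambda>x. (1 / K) *\<^sub>R B x)"
  have "contraction C"
    unfolding contraction_def C_def using bounded_op_real_scale [OF B] K True
    by (simp add: field_simps)
  from partial_trace_le_trace_norm [OF A this F]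
  have "cmod (of_real K * partial_trace F C A) \<le> K * trace_norm A"
    using True by (simp add: norm_mult)
  moreover have "of_real K * partial_trace F C A = partial_trace F B A"
    unfolding partial_trace_def C_def sum_distrib_left
    by (rule sum.cong) (use True in \<open>simp_all add: cinner_scaleR_right\<close>)
  ultimately show ?thesis by simp
next
  case False
  have le: "norm (B (e i)) \<le> K" for i using K [of "e i"] by simp
  have "norm (B (e i)) = 0" for i
    using le [of i] norm_ge_zero [of "B (e i)"] False by linarith
  moreover have "K = 0"
    using le [of 0] norm_ge_zero [of "B (e 0)"] False by linarith
  ultimately show ?thesis
    by (simp add: partial_trace_def cinner.zero_right)
qed

text \<open>The trace norm dominates the operator norm: test against operators of rank one.\<close>

lemma norm_le_trace_norm:
  fixes A :: "'h \<Rightarrow> 'h"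
  assumes A: "A \<in> trace_class"
  shows "norm (A x) \<le> trace_norm A * norm x"
proof (rule LIMSEQ_le_const2)
  note bA = trace_class_bounded_op [OF A]
  show "(\<lambda>N. norm (A (proj {..<N} x))) \<longlonglongrightarrow> norm (A x)"
    by (intro tendsto_norm bounded_op_tendsto [OF bA] proj_tendsto)
  have "norm (A (proj {..<N} x)) \<le> trace_norm A * norm x" for N
  proof (rule norm_le_of_cinner_le)
    fix y :: 'h
    define B where "B = (\<lambda>z. cinner z x *\<^sub>C y)"
    have "cinner (A (proj {..<N} x)) y = partial_trace {..<N} B A"
      unfolding proj_def partial_trace_def B_def
      by (simp add: bounded_op_sum [OF bA] bounded_op_scaleC [OF bA] cinner.sum_left cinner_scaleC_left
          cinner_scaleC_right flip: cinner_commute)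
    also have "cmod \<dots> \<le> (norm x * norm y) * trace_norm A"
    proof (rule partial_trace_le_bound [OF A])
      show "bounded_op B" unfolding B_def by (rule bounded_op_rank_one)
      show "norm (B z) \<le> norm x * norm y * norm z" for z
        using mult_right_mono [OF cinner_Cauchy_Schwarz [of z x], of "norm y"]
        by (simp add: B_def norm_scaleC algebra_simps)
    qed simp
    finally show "cmod (cinner (A (proj {..<N} x)) y) \<le> trace_norm A * norm x * norm y"
      by (simp add: algebra_simps)
  qed (use trace_norm_nonneg [OF A] in simp)
  then show "\<exists>N. \<forall>n\<ge>N. norm (A (proj {..<n} x)) \<le> trace_norm A * norm x" by blast
qed

definition rank_one :: "'h \<Rightarrow> 'h \<Rightarrow> 'h \<Rightarrow> 'h" where
  "rank_one f g x = cinner x f *\<^sub>C g"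

lemma rank_one_trace_class: "rank_one f g \<in> trace_class"
  and trace_norm_rank_one_le: "trace_norm (rank_one f g) \<le> norm f * norm g"
proof -
  have b: "bounded_op (rank_one f g)"
    using bounded_op_rank_one [of f g] unfolding rank_one_def [abs_def] .
  have le: "cmod (partial_trace F B (rank_one f g)) \<le> norm f * norm g"
    if F: "finite F" and B: "contraction B" for F B
  proof -
    have bB: "bounded_op B" using B by (simp add: contraction_def)
    have "partial_trace F B (rank_one f g) = cinner g (B (proj F f))"
      unfolding partial_trace_def rank_one_def proj_def
      by (simp add: bounded_op_sum [OF bB] bounded_op_scaleC [OF bB] cinner.sum_right cinner_scaleC_left
          cinner_scaleC_right flip: cinner_commute)
    also have "cmod \<dots> \<le> norm g * norm (B (proj F f))" by (rule cinner_Cauchy_Schwarz)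
    also have "\<dots> \<le> norm g * norm f"
      using B norm_proj_le [OF F, of f] unfolding contraction_def
      by (intro mult_left_mono) (auto intro: order_trans)
    finally show ?thesis by (simp add: mult.commute)
  qed
  show "rank_one f g \<in> trace_class" "trace_norm (rank_one f g) \<le> norm f * norm g"
    using trace_classI [OF b le] by auto
qed

end

section \<open>Weakly null sequences of trace class operators\<close>

context onb_sequence
begin

text \<open>Contractions that live on the finitely many coordinates in \<open>F\<close>.\<close>

definition block :: "nat set \<Rightarrow> ('h \<Rightarrow> 'h) \<Rightarrow> bool" where
  "block F b \<longleftrightarrow> finite F \<and> contraction b \<and> (\<forall>x. proj F (b (proj F x)) = b x)"

lemma block_finite: "block F b \<Longrightarrow> finite F"
  and block_contraction: "block F b \<Longrightarrow> contraction b"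
  and block_bounded_op: "block F b \<Longrightarrow> bounded_op b"
  by (simp_all add: block_def contraction_def)

lemma block_norm_le: "block F b \<Longrightarrow> norm (b x) \<le> norm x"
  by (simp add: block_def contraction_def)

lemma block_proj_left: "block F b \<Longrightarrow> proj F (b x) = b x"
  unfolding block_def by (metis inf.idem proj_proj)

lemma block_proj_right: "block F b \<Longrightarrow> b (proj F x) = b x"
  unfolding block_def by (metis inf.idem proj_proj)

lemma block_e:
  assumes "block F b" "i \<notin> F"
  shows "b (e i) = 0"
proof -
  have "b (e i) = b (proj F (e i))" by (simp add: block_proj_right [OF assms(1)])
  also have "\<dots> = 0"
    using assms by (simp add: proj_e block_finite bounded_op_0 [OF block_bounded_op])
  finally show ?thesis .
qed

lemma block_mono:
  assumes b: "block F b" and "F \<subseteq> G" "finite G"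
  shows "block G b"
proof -
  have F: "finite F" using b by (rule block_finite)
  have FG: "F \<inter> G = F" "G \<inter> F = F" using assms by auto
  have "proj G (b (proj G x)) = b x" for x
  proof -
    have "b (proj G x) = b (proj F (proj G x))" by (simp add: block_proj_right [OF b])
    also have "\<dots> = b x"
      by (simp add: proj_proj F assms FG block_proj_right [OF b])
    finally have "proj G (b (proj G x)) = proj G (proj F (b x))"
      by (simp add: block_proj_left [OF b])
    also have "\<dots> = proj F (b x)" by (simp only: proj_proj F assms FG)
    finally show ?thesis by (simp add: block_proj_left [OF b])
  qed
  then show ?thesis using b assms by (simp add: block_def)
qed

lemma block_zero: "block {} (\<lambda>x. 0)"
  by (simp add: block_def contraction_def proj_def)

lemma block_scale:
  assumes b: "block F b" and "cmod u \<le> 1"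
  shows "block F (\<lambda>x. u *\<^sub>C b x)"
proof -
  have "norm (u *\<^sub>C b x) \<le> norm x" for x
    using mult_mono [OF assms(2) block_norm_le [OF b, of x]] by (simp add: norm_scaleC)
  moreover have "proj F (b (proj F x)) = b x" for x using b by (simp add: block_def)
  ultimately show ?thesis
    unfolding block_def contraction_def
    using block_finite [OF b] bounded_op_scale [OF block_bounded_op [OF b]]
    by (simp add: bounded_op_scaleC [OF bounded_op_proj])
qed

text \<open>A block diagonal sum of contractions is a contraction, by Pythagoras in the domain and
  in the range.\<close>

lemma block_add:
  assumes b: "block F b" and c: "block G c" and disj: "F \<inter> G = {}"
  shows "block (F \<union> G) (\<lambda>x. b x + c x)"
proof -
  have fin: "finite F" "finite G" using b c by (auto intro: block_finite)
  have orth: "cinner (proj F u) (proj G v) = 0" for u v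
    using disj by (simp add: proj_selfadjoint proj_proj fin) (simp add: proj_def cinner.zero_right)
  have "norm (b x + c x) \<le> norm x" for x
  proof (rule power2_le_imp_le)
    have "cinner (b x) (c x) = 0"
      using orth [of "b x" "c x"] by (simp add: block_proj_left [OF b] block_proj_left [OF c])
    then have "(norm (b x + c x))\<^sup>2 = (norm (b (proj F x)))\<^sup>2 + (norm (c (proj G x)))\<^sup>2"
      by (simp add: norm_add_square block_proj_right [OF b] block_proj_right [OF c])
    also have "\<dots> \<le> (norm (proj F x))\<^sup>2 + (norm (proj G x))\<^sup>2"
      by (intro add_mono power_mono block_norm_le [OF b] block_norm_le [OF c]) auto
    also have "\<dots> = (norm (proj (F \<union> G) x))\<^sup>2"
      by (simp add: proj_Un fin disj norm_add_square orth)
    also have "\<dots> \<le> (norm x)\<^sup>2"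
      by (intro power_mono norm_proj_le) (simp_all add: fin)
    finally show "(norm (b x + c x))\<^sup>2 \<le> (norm x)\<^sup>2" .
  qed simp
  moreover have "block (F \<union> G) b" "block (F \<union> G) c"
    using block_mono b c fin by auto
  ultimately show ?thesis
    unfolding block_def contraction_def
    using bounded_op_plus [OF block_bounded_op [OF b] block_bounded_op [OF c]]
    by (simp add: bounded_op_add [OF bounded_op_proj])
qed

lemma block_sum:
  assumes "finite K" "disjoint_family_on F K" "\<And>k. k \<in> K \<Longrightarrow> block (F k) (b k)"
  shows "block (\<Union>k\<in>K. F k) (\<lambda>x. \<Sum>k\<in>K. b k x)"
  using assms
proof (induction K rule: finite_induct)
  case empty
  then show ?case using block_zero by simp
next
  case (insert k K)
  have "block (F k \<union> (\<Union>k\<in>K. F k)) (\<lambda>x. b k x + (\<Sum>k\<in>K. b k x))"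
  proof (rule block_add)
    show "block (F k) (b k)" using insert.prems by simp
    show "block (\<Union>k\<in>K. F k) (\<lambda>x. \<Sum>k\<in>K. b k x)"
      using insert.prems by (intro insert.IH) (auto simp: disjoint_family_on_def)
    show "F k \<inter> (\<Union>k\<in>K. F k) = {}"
      using insert.prems(1) insert.hyps by (force simp: disjoint_family_on_def)
  qed
  then show ?case using insert.hyps by simp
qed

lemma partial_trace_block_mono:
  assumes "block F b" "F \<subseteq> G" "finite G"
  shows "partial_trace G b A = partial_trace F b A"
  unfolding partial_trace_def
  by (rule sum.mono_neutral_right) (use assms(2,3) in \<open>auto simp: cinner.zero_right block_e [OF assms(1)]\<close>)

text \<open>Disjoint diagonal blocks sum up to at most the trace norm: multiply each block by a phase
  that makes its contribution nonnegative, and test against the sum.\<close>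

lemma partial_trace_blocks_le:
  assumes A: "A \<in> trace_class" and K: "finite K" and disj: "disjoint_family_on F K"
    and b: "\<And>k. k \<in> K \<Longrightarrow> block (F k) (b k)"
  shows "(\<Sum>k\<in>K. cmod (partial_trace (F k) (b k) A)) \<le> trace_norm A"
proof -
  define u where "u k = sgn (partial_trace (F k) (b k) A)" for k
  define B where "B = (\<lambda>x. \<Sum>k\<in>K. u k *\<^sub>C b k x)"
  define G where "G = (\<Union>k\<in>K. F k)"
  have "block G B"
    unfolding G_def B_def using b
    by (intro block_sum K disj block_scale) (auto simp: u_def norm_sgn)
  have "partial_trace G B A = (\<Sum>k\<in>K. cnj (u k) * partial_trace G (b k) A)"
    unfolding partial_trace_def B_def
    by (simp add: cinner.sum_right cinner_scaleC_right sum_distrib_left) (rule sum.swap)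
  also have "\<dots> = (\<Sum>k\<in>K. complex_of_real (cmod (partial_trace (F k) (b k) A)))"
  proof (rule sum.cong [OF refl])
    fix k assume k: "k \<in> K"
    have "partial_trace G (b k) A = partial_trace (F k) (b k) A"
      using k block_finite [OF \<open>block G B\<close>]
      by (intro partial_trace_block_mono b) (auto simp: G_def)
    moreover have "cnj (sgn z) * z = complex_of_real (cmod z)" for z
      using complex_norm_square [of z]
      by (cases "z = 0") (simp_all add: sgn_eq field_simps power2_eq_square)
    ultimately show "cnj (u k) * partial_trace G (b k) A = complex_of_real (cmod (partial_trace (F k) (b k) A))"
      by (simp add: u_def)
  qed
  also have "\<dots> = complex_of_real (\<Sum>k\<in>K. cmod (partial_trace (F k) (b k) A))" by simp
  finally have "cmod (partial_trace G B A) = \<bar>\<Sum>k\<in>K. cmod (partial_trace (F k) (b k) A)\<bar>"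
    by (simp only: norm_of_real real_norm_def)
  then show ?thesis
    using partial_trace_le_trace_norm [OF A block_contraction block_finite, OF \<open>block G B\<close> \<open>block G B\<close>]
    by linarith
qed

definition coproj :: "nat \<Rightarrow> 'h \<Rightarrow> 'h" where
  "coproj N x = x - proj {..<N} x"

definition corner :: "nat \<Rightarrow> ('h \<Rightarrow> 'h) \<Rightarrow> 'h \<Rightarrow> 'h" where
  "corner N A x = coproj N (A (coproj N x))"

definition head :: "nat \<Rightarrow> ('h \<Rightarrow> 'h) \<Rightarrow> 'h \<Rightarrow> 'h" where
  "head N A x = proj {..<N} (A (proj {..<N} x))"

lemma contraction_coproj': "contraction (coproj N)"
  unfolding coproj_def [abs_def] by (rule contraction_coproj) simp

lemma bounded_op_coproj: "bounded_op (coproj N)"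
  using contraction_coproj' by (simp add: contraction_def)

lemma coproj_e: "coproj N (e i) = (if i \<in> {N..} then e i else 0)"
  by (simp add: coproj_def proj_e)

lemma coproj_selfadjoint: "cinner (coproj N x) y = cinner x (coproj N y)"
  by (simp add: coproj_def cinner.diff_left cinner.diff_right proj_selfadjoint)

lemma coproj_coproj:
  "M \<le> N \<Longrightarrow> coproj N (coproj M x) = coproj N x"
  "M \<le> N \<Longrightarrow> coproj M (coproj N x) = coproj N x"
proof -
  have "{..<N} \<inter> {..<M} = {..<M}" "{..<M} \<inter> {..<N} = {..<M}" if "M \<le> N" using that by auto
  then show "M \<le> N \<Longrightarrow> coproj N (coproj M x) = coproj N x"
    "M \<le> N \<Longrightarrow> coproj M (coproj N x) = coproj N x"
    by (simp_all add: coproj_def bounded_op_diff [OF bounded_op_proj] proj_proj)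
qed

lemma coproj_proj:
  assumes "F \<subseteq> {N..}" "finite F" shows "coproj N (proj F x) = proj F x"
proof -
  have "{..<N} \<inter> F = {}" using assms by auto
  then show ?thesis using assms by (simp add: coproj_def proj_proj) (simp add: proj_def)
qed

lemma
  assumes A: "A \<in> trace_class"
  shows corner_trace_class: "corner N A \<in> trace_class"
    and trace_norm_corner_le: "trace_norm (corner N A) \<le> trace_norm A"
proof -
  note d = bounded_op_coproj coproj_e
  note 1 = trace_class_diagonal_right [OF A d] trace_norm_diagonal_right [OF A d]
  show "corner N A \<in> trace_class"
    unfolding corner_def [abs_def] by (rule trace_class_contraction_left [OF 1(1) contraction_coproj'])
  show "trace_norm (corner N A) \<le> trace_norm A"
    unfolding corner_def [abs_def]
    by (rule order_trans [OF trace_norm_contraction_left [OF 1(1) contraction_coproj'] 1(2)])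
qed

lemma head_trace_class:
  assumes A: "A \<in> trace_class"
  shows "head N A \<in> trace_class"
proof -
  have "(\<lambda>x. A (proj {..<N} x)) \<in> trace_class"
    by (rule trace_class_diagonal_right [OF A bounded_op_proj, where G = "{..<N}"]) (simp add: proj_e)
  then show ?thesis
    unfolding head_def [abs_def] by (rule trace_class_contraction_left) (simp add: contraction_proj)
qed

lemma trace_norm_corner_mono:
  assumes "A \<in> trace_class" "M \<le> N"
  shows "trace_norm (corner N A) \<le> trace_norm (corner M A)"
proof -
  have "corner N (corner M A) = corner N A"
    by (simp add: corner_def fun_eq_iff coproj_coproj [OF assms(2)])
  then show ?thesis
    using trace_norm_corner_le [OF corner_trace_class [OF assms(1)], of N M] by simp
qed

lemma partial_trace_corner:
  assumes b: "block F b" and F: "F \<subseteq> {N..}"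
  shows "partial_trace F b (corner N A) = partial_trace F b A"
  unfolding partial_trace_def
proof (rule sum.cong [OF refl])
  fix i assume "i \<in> F"
  then have "cinner (corner N A (e i)) (b (e i)) = cinner (A (e i)) (coproj N (b (e i)))"
    using F by (auto simp: corner_def coproj_selfadjoint coproj_e)
  also have "coproj N (b (e i)) = b (e i)"
    using coproj_proj [OF F block_finite [OF b], of "b (e i)"] by (simp add: block_proj_left [OF b])
  finally show "cinner (corner N A (e i)) (b (e i)) = cinner (A (e i)) (b (e i))" .
qed

lemma partial_trace_head:
  assumes b: "block F b" and F: "F \<subseteq> {..<N}"
  shows "partial_trace F b (head N A) = partial_trace F b A"
  unfolding partial_trace_def
proof (rule sum.cong [OF refl])
  fix i assume i: "i \<in> F"
  have FN: "{..<N} \<inter> F = F" using F by auto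
  have "cinner (head N A (e i)) (b (e i)) = cinner (A (e i)) (proj {..<N} (b (e i)))"
    using F i by (auto simp: head_def proj_selfadjoint proj_e)
  also have "proj {..<N} (b (e i)) = b (e i)"
    using proj_proj [of "{..<N}" F "b (e i)"] by (simp add: FN block_finite [OF b] block_proj_left [OF b])
  finally show "cinner (head N A (e i)) (b (e i)) = cinner (A (e i)) (b (e i))" .
qed

text \<open>The crude bound by matrix entries suffices for weak convergence, as there are finitely
  many of them.\<close>

lemma trace_norm_head_le:
  assumes A: "A \<in> trace_class"
  shows "trace_norm (head N A) \<le> (\<Sum>i<N. \<Sum>j<N. cmod (cinner (A (e i)) (e j)))"
proof (rule trace_classI(2))
  show "bounded_op (head N A)" by (rule trace_class_bounded_op [OF head_trace_class [OF A]])
  fix F :: "nat set" and B :: "'h \<Rightarrow> 'h" assume F: "finite F" and B: "contraction B"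
  note bA = trace_class_bounded_op [OF A]
  have e1: "cmod (cinner (e j) (B (e i))) \<le> 1" for i j
    using cinner_Cauchy_Schwarz [of "e j" "B (e i)"] B unfolding contraction_def
    by (metis mult_1 norm_e order_trans)
  have "cmod (partial_trace F B (head N A)) \<le> (\<Sum>i\<in>F. cmod (cinner (head N A (e i)) (B (e i))))"
    unfolding partial_trace_def by (rule norm_sum)
  also have "\<dots> = (\<Sum>i\<in>F \<inter> {..<N}. cmod (cinner (head N A (e i)) (B (e i))))"
    by (rule sum.mono_neutral_right)
      (auto simp: F head_def proj_e bounded_op_0 [OF bA] bounded_op_0 [OF bounded_op_proj] cinner.zero_left)
  also have "\<dots> \<le> (\<Sum>i<N. cmod (cinner (head N A (e i)) (B (e i))))"
    by (rule sum_mono2) auto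
  also have "\<dots> \<le> (\<Sum>i<N. \<Sum>j<N. cmod (cinner (A (e i)) (e j)))"
  proof (rule sum_mono)
    fix i assume "i \<in> {..<N}"
    then have "cinner (head N A (e i)) (B (e i)) = (\<Sum>j<N. cinner (A (e i)) (e j) * cinner (e j) (B (e i)))"
      by (simp add: head_def proj_e) (simp add: proj_def cinner.sum_left cinner_scaleC_left)
    then show "cmod (cinner (head N A (e i)) (B (e i))) \<le> (\<Sum>j<N. cmod (cinner (A (e i)) (e j)))"
      using e1 by (auto simp: norm_mult intro!: sum_norm_le mult_left_le)
  qed
  finally show "cmod (partial_trace F B (head N A)) \<le> (\<Sum>i<N. \<Sum>j<N. cmod (cinner (A (e i)) (e j)))" .
qed

text \<open>Take \<open>F\<close> and \<open>B\<close> for which the partial trace of the corner exceeds \<open>\<delta>\<close>. Cutting off \<open>B\<close> to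
  the coordinates between \<open>N\<close> and \<open>M\<close> changes it arbitrarily little for large \<open>M\<close>, because
  only the finitely many vectors \<open>B (e i)\<close> with \<open>i \<in> F\<close> matter.\<close>

lemma exists_block_of_corner:
  assumes A: "A \<in> trace_class" and less: "\<delta> < trace_norm (corner N A)"
  shows "\<exists>M>N. \<exists>b. block {N..<M} b \<and> \<delta> < cmod (partial_trace {N..<M} b A)"
proof -
  have "\<exists>F (B :: 'h \<Rightarrow> 'h). finite F \<and> contraction B \<and> \<delta> < cmod (partial_trace F B (corner N A))"
    using trace_classI(2) [OF trace_class_bounded_op [OF corner_trace_class [OF A]], where t = \<delta>] less
    by (meson not_le)
  then obtain F B where F: "finite F" and B: "contraction B"
    and FB: "\<delta> < cmod (partial_trace F B (corner N A))" by blast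
  have bA: "bounded_op A" by (rule trace_class_bounded_op [OF A])
  define G where "G = F \<inter> {N..}"
  have G: "finite G" using F by (simp add: G_def)
  define b where "b M = (\<lambda>x. proj {N..<M} (B (proj (G \<inter> {N..<M}) x)))" for M
  have block: "block {N..<M} (b M)" for M
  proof -
    have "contraction (b M)"
      unfolding b_def
      by (rule contraction_compose [OF _ contraction_compose [OF B]]) (simp_all add: contraction_proj G)
    then show ?thesis
      by (simp add: block_def b_def proj_proj G Int_ac)
  qed
  have proj_lim: "(\<lambda>M. proj {N..<M} x) \<longlonglongrightarrow> coproj N x" for x
  proof -
    have "(\<lambda>M. proj {..<M} x - proj {..<N} x) \<longlonglongrightarrow> coproj N x"
      unfolding coproj_def by (intro tendsto_intros proj_tendsto)
    moreover have "proj {..<M} x - proj {..<N} x = proj {N..<M} x" if "N \<le> M" for M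
    proof -
      have "{..<N} \<inter> {N..<M} = {}" "{..<N} \<union> {N..<M} = {..<M}" using that by auto
      then show ?thesis using proj_Un [of "{..<N}" "{N..<M}" x] by simp
    qed
    then have "\<forall>\<^sub>F M in sequentially. proj {..<M} x - proj {..<N} x = proj {N..<M} x"
      unfolding eventually_sequentially by blast
    ultimately show ?thesis by (rule Lim_transform_eventually)
  qed
  define K where "K = Suc (Max (insert N G))"
  have GK: "G \<subseteq> {N..<M}" if "M \<ge> K" for M
  proof
    fix i assume i: "i \<in> G"
    then have "i \<le> Max (insert N G)" using G by (intro Max_ge) auto
    then show "i \<in> {N..<M}" using that i by (auto simp: K_def G_def)
  qed
  have "partial_trace {N..<M} (b M) A = (\<Sum>i\<in>G. cinner (A (e i)) (proj {N..<M} (B (e i))))" if "M \<ge> K" for M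
  proof -
    have "partial_trace {N..<M} (b M) A = (\<Sum>i\<in>G. cinner (A (e i)) (b M (e i)))"
      unfolding partial_trace_def using GK [OF that] G B
      by (intro sum.mono_neutral_right)
        (auto simp: b_def proj_e contraction_def bounded_op_0 [OF bounded_op_proj] bounded_op_0 cinner.zero_right)
    also have "\<dots> = (\<Sum>i\<in>G. cinner (A (e i)) (proj {N..<M} (B (e i))))"
      using GK [OF that] G by (intro sum.cong) (auto simp: b_def proj_e)
    finally show ?thesis .
  qed
  then have "\<forall>\<^sub>F M in sequentially. (\<Sum>i\<in>G. cinner (A (e i)) (proj {N..<M} (B (e i)))) = partial_trace {N..<M} (b M) A"
    unfolding eventually_sequentially by metis
  moreover have "(\<lambda>M. \<Sum>i\<in>G. cinner (A (e i)) (proj {N..<M} (B (e i))))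
      \<longlonglongrightarrow> (\<Sum>i\<in>G. cinner (A (e i)) (coproj N (B (e i))))"
    by (intro tendsto_intros proj_lim)
  ultimately have "(\<lambda>M. partial_trace {N..<M} (b M) A) \<longlonglongrightarrow> (\<Sum>i\<in>G. cinner (A (e i)) (coproj N (B (e i))))"
    by (rule Lim_transform_eventually [rotated])
  also have "(\<Sum>i\<in>G. cinner (A (e i)) (coproj N (B (e i)))) = partial_trace F B (corner N A)"
  proof -
    have "partial_trace F B (corner N A) = (\<Sum>i\<in>G. cinner (corner N A (e i)) (B (e i)))"
      unfolding partial_trace_def using F
      by (intro sum.mono_neutral_right)
        (auto simp: G_def corner_def coproj_e bounded_op_0 [OF bA] bounded_op_0 [OF bounded_op_coproj] cinner.zero_left)
    also have "\<dots> = (\<Sum>i\<in>G. cinner (A (e i)) (coproj N (B (e i))))"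
      by (intro sum.cong) (auto simp: G_def corner_def coproj_e coproj_selfadjoint)
    finally show ?thesis by simp
  qed
  finally have "(\<lambda>M. cmod (partial_trace {N..<M} (b M) A)) \<longlonglongrightarrow> cmod (partial_trace F B (corner N A))"
    by (rule tendsto_norm)
  from order_tendstoD(1) [OF this FB]
  have "\<forall>\<^sub>F M in sequentially. \<delta> < cmod (partial_trace {N..<M} (b M) A) \<and> M > N"
    by (rule eventually_conj) (rule eventually_gt_at_top)
  then obtain M where "\<delta> < cmod (partial_trace {N..<M} (b M) A)" "M > N"
    unfolding eventually_sequentially by blast
  with block show ?thesis by blast
qed

lemma disjoint_family_on_successive:
  fixes m :: "nat \<Rightarrow> nat"
  assumes "\<And>k. m k \<le> m (Suc k)"
  shows "disjoint_family_on (\<lambda>k. {m k..<m (Suc k)}) K"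
proof -
  have mono: "mono m" using assms by (simp add: mono_iff_le_Suc)
  have "{m k..<m (Suc k)} \<inter> {m l..<m (Suc l)} = {}" if "k < l" for k l
    using monoD [OF mono, of "Suc k" l] that by auto
  then show ?thesis
    unfolding disjoint_family_on_def by (metis inf_commute linorder_neqE_nat)
qed

text \<open>Otherwise there would be arbitrarily many disjoint blocks, each contributing more than
  \<open>\<epsilon>\<close> to the trace norm.\<close>

lemma corner_eventually_small:
  assumes A: "A \<in> trace_class" and "\<epsilon> > 0"
  shows "\<exists>N. trace_norm (corner N A) \<le> \<epsilon>"
proof (rule ccontr)
  assume "\<nexists>N. trace_norm (corner N A) \<le> \<epsilon>"
  then have "\<exists>M b. M > N \<and> block {N..<M} b \<and> \<epsilon> < cmod (partial_trace {N..<M} b A)" for N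
    using exists_block_of_corner [OF A, of \<epsilon> N] by (auto simp: not_le)
  then obtain s b where s: "\<And>N. s N > N" and b: "\<And>N. block {N..<s N} (b N)"
    "\<And>N. \<epsilon> < cmod (partial_trace {N..<s N} (b N) A)" by metis
  define m where "m k = (s ^^ k) 0" for k
  have m: "m (Suc k) = s (m k)" for k by (simp add: m_def)
  obtain J :: nat where J: "trace_norm A < real J * \<epsilon>"
    using \<open>\<epsilon> > 0\<close> ex_less_of_nat_mult by blast
  have "real J * \<epsilon> = (\<Sum>k<J. \<epsilon>)" by simp
  also have "\<dots> \<le> (\<Sum>k<J. cmod (partial_trace {m k..<m (Suc k)} (b (m k)) A))"
    unfolding m by (intro sum_mono less_imp_le b)
  also have "\<dots> \<le> trace_norm A"
  proof (rule partial_trace_blocks_le [OF A])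
    show "disjoint_family_on (\<lambda>k. {m k..<m (Suc k)}) {..<J}"
      by (rule disjoint_family_on_successive) (simp add: m less_imp_le [OF s])
  qed (use b m in auto)
  finally show False using J by simp
qed

lemma matrix_entry_functional:
  "bounded_clinear_on trace_class trace_norm (\<lambda>A. cinner (A x) (y :: 'h))"
  unfolding bounded_clinear_on_def
proof (intro conjI ballI allI exI)
  fix A :: "'h \<Rightarrow> 'h" assume A: "A \<in> trace_class"
  have "cmod (cinner (A x) y) \<le> norm (A x) * norm y" by (rule cinner_Cauchy_Schwarz)
  also have "\<dots> \<le> (trace_norm A * norm x) * norm y"
    by (intro mult_right_mono norm_le_trace_norm A) simp
  finally show "norm (cinner (A x) y) \<le> (norm x * norm y) * trace_norm A" by (simp add: mult_ac)
qed (simp_all add: cinner_add_left scaleC_fun_def cinner_scaleC_left scaleC_complex_def)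

text \<open>The trace class operators have the property of \<open>\<ell>\<^sup>1\<close> that weakly null sequences have
  uniformly small tails. The proof is a gliding hump: otherwise there would be successive
  diagonal blocks, each carrying a fixed part of the trace norm of some member of the sequence
  whose remaining mass near the other blocks is negligible, and the sum of the corresponding
  functionals would stay away from zero along a subsequence.\<close>

lemma weakly_null_corners_uniformly_small:
  fixes x :: "nat \<Rightarrow> 'h \<Rightarrow> 'h"
  assumes weak: "weakly_null_on trace_class trace_norm x" and "\<epsilon> > 0"
  shows "\<exists>N. \<forall>n. trace_norm (corner N (x n)) \<le> \<epsilon>"
proof (rule ccontr)
  assume "\<nexists>N. \<forall>n. trace_norm (corner N (x n)) \<le> \<epsilon>"
  then have big: "\<exists>n. \<epsilon> < trace_norm (corner N (x n))" for N by (simp add: not_le)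
  have tc: "x n \<in> trace_class" for n
    using weak by (auto simp: weakly_null_on_def)
  have big_late: "\<exists>n\<ge>n0. \<epsilon> < trace_norm (corner N (x n))" for N n0
  proof -
    obtain f where f: "\<And>n. trace_norm (corner (f n) (x n)) \<le> \<epsilon>"
      using corner_eventually_small [OF tc \<open>\<epsilon> > 0\<close>] by metis
    define M where "M = Max (insert N (f ` {..<n0}))"
    have "N \<le> M" unfolding M_def by (rule Max_ge) auto
    obtain n where n: "\<epsilon> < trace_norm (corner M (x n))" using big by blast
    have "n \<ge> n0"
    proof (rule ccontr)
      assume "\<not> n \<ge> n0"
      then have "f n \<le> M" unfolding M_def by (intro Max_ge) auto
      then show False using trace_norm_corner_mono [OF tc] f n by (meson not_le order_trans)
    qed
    moreover have "\<epsilon> < trace_norm (corner N (x n))"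
      using trace_norm_corner_mono [OF tc \<open>N \<le> M\<close>, of n] n by linarith
    ultimately show ?thesis by blast
  qed
  have head_null: "\<exists>n0. \<forall>n\<ge>n0. trace_norm (head N (x n)) \<le> \<epsilon> / 4" for N
  proof -
    have "(\<lambda>n. cinner (x n (e i)) (e j)) \<longlonglongrightarrow> 0" for i j
      using weak matrix_entry_functional unfolding weakly_null_on_def by blast
    then have "(\<lambda>n. \<Sum>i<N. \<Sum>j<N. cmod (cinner (x n (e i)) (e j))) \<longlonglongrightarrow> (\<Sum>i<N. \<Sum>j<N. cmod 0)"
      by (intro tendsto_intros)
    then have "\<forall>\<^sub>F n in sequentially. (\<Sum>i<N. \<Sum>j<N. cmod (cinner (x n (e i)) (e j))) < \<epsilon> / 4"
      using \<open>\<epsilon> > 0\<close> by (intro order_tendstoD) auto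
    then show ?thesis
      unfolding eventually_sequentially using trace_norm_head_le [OF tc, of N] by (meson less_imp_le order_trans)
  qed
  \<comment> \<open>The member of the sequence is taken so late that it is small on the coordinates below \<open>N\<close>,
    and the block so large that what lies beyond its end \<open>M\<close> is small.\<close>
  have "\<exists>M n b. M > N \<and> block {N..<M} b \<and> n \<ge> N \<and> \<epsilon> < cmod (partial_trace {N..<M} b (x n)) \<and>
      trace_norm (head N (x n)) \<le> \<epsilon> / 4 \<and> trace_norm (corner M (x n)) \<le> \<epsilon> / 4" for N
  proof -
    obtain n0 where n0: "\<And>n. n \<ge> n0 \<Longrightarrow> trace_norm (head N (x n)) \<le> \<epsilon> / 4" using head_null by blast
    obtain n where n: "n \<ge> max N n0" "\<epsilon> < trace_norm (corner N (x n))" using big_late by blast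
    obtain M1 b where b: "M1 > N" "block {N..<M1} b" "\<epsilon> < cmod (partial_trace {N..<M1} b (x n))"
      using exists_block_of_corner [OF tc n(2)] by blast
    obtain M2 where M2: "trace_norm (corner M2 (x n)) \<le> \<epsilon> / 4"
      using corner_eventually_small [OF tc, of "\<epsilon> / 4" n] \<open>\<epsilon> > 0\<close> by auto
    define M where "M = max M1 M2"
    have sub: "{N..<M1} \<subseteq> {N..<M}" by (auto simp: M_def)
    have "trace_norm (corner M (x n)) \<le> \<epsilon> / 4"
      using trace_norm_corner_mono [OF tc, of M2 M n] M2 by (simp add: M_def)
    moreover have "block {N..<M} b" by (rule block_mono [OF b(2) sub]) simp
    moreover have "\<epsilon> < cmod (partial_trace {N..<M} b (x n))"
      using b(3) partial_trace_block_mono [OF b(2) sub] by simp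
    moreover have "M > N" using b(1) by (simp add: M_def)
    ultimately show ?thesis using n(1) n0 by (intro exI [of _ M] exI [of _ n] exI [of _ b]) auto
  qed
  then obtain s r b where s: "\<And>N. s N > N" and b: "\<And>N. block {N..<s N} (b N)" and r: "\<And>N. r N \<ge> N"
    and hump: "\<And>N. \<epsilon> < cmod (partial_trace {N..<s N} (b N) (x (r N)))"
    and before: "\<And>N. trace_norm (head N (x (r N))) \<le> \<epsilon> / 4"
    and after: "\<And>N. trace_norm (corner (s N) (x (r N))) \<le> \<epsilon> / 4" by metis
  define m where "m k = (s ^^ k) 0" for k
  have m: "m (Suc k) = s (m k)" for k by (simp add: m_def)
  have m_le: "m k \<le> m (Suc k)" for k unfolding m by (rule less_imp_le [OF s])
  have m_mono: "m j \<le> m k" if "j \<le> k" for j k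
    by (rule lift_Suc_mono_le [of m, OF m_le that])
  have m_ge: "k \<le> m k" for k
  proof (induction k)
    case (Suc k)
    then show ?case using s [of "m k"] by (simp add: m)
  qed simp
  define F where "F k = {m k..<m (Suc k)}" for k
  define c where "c k = b (m k)" for k
  have block: "block (F k) (c k)" for k unfolding F_def c_def m by (rule b)
  have disj: "disjoint_family_on F K" for K
    unfolding F_def by (rule disjoint_family_on_successive) (rule m_le)
  define \<beta> where "\<beta> k A = partial_trace (F k) (c k) A" for k A
  have sum_\<beta>: "(\<Sum>k\<in>K. cmod (\<beta> k A)) \<le> trace_norm A" if "finite K" "A \<in> trace_class" for K A
    unfolding \<beta>_def by (rule partial_trace_blocks_le [OF that(2,1) disj block])
  have summ: "summable (\<lambda>k. \<beta> k A)" if "A \<in> trace_class" for A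
    by (rule summable_norm_cancel, rule summableI_nonneg_bounded [where x = "trace_norm A"])
      (use sum_\<beta> that in auto)
  define \<phi> where "\<phi> A = (\<Sum>k. \<beta> k A)" for A
  have lim_\<phi>: "(\<lambda>J. \<Sum>k<J. \<beta> k A) \<longlonglongrightarrow> \<phi> A" if "A \<in> trace_class" for A
    unfolding \<phi>_def by (rule summable_LIMSEQ [OF summ [OF that]])
  have "bounded_clinear_on trace_class trace_norm \<phi>"
    unfolding bounded_clinear_on_def
  proof (intro conjI ballI allI exI)
    fix A B :: "'h \<Rightarrow> 'h" and z
    assume A: "A \<in> trace_class"
    show "\<phi> (z *\<^sub>C A) = z *\<^sub>C \<phi> A"
      unfolding \<phi>_def scaleC_complex_def suminf_mult [OF summ [OF A], symmetric]
      by (simp add: \<beta>_def partial_trace_def scaleC_fun_def cinner_scaleC_left sum_distrib_left)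
    show "norm (\<phi> A) \<le> 1 * trace_norm A"
    proof (rule LIMSEQ_le_const2 [OF tendsto_norm [OF lim_\<phi> [OF A]]])
      have "norm (\<Sum>k<J. \<beta> k A) \<le> 1 * trace_norm A" for J
        using order_trans [OF norm_sum sum_\<beta> [OF _ A, of "{..<J}"]] by simp
      then show "\<exists>N. \<forall>J\<ge>N. norm (\<Sum>k<J. \<beta> k A) \<le> 1 * trace_norm A" by blast
    qed
    assume B: "B \<in> trace_class"
    show "\<phi> (A + B) = \<phi> A + \<phi> B"
      unfolding \<phi>_def suminf_add [OF summ [OF A] summ [OF B]]
      by (simp add: \<beta>_def partial_trace_def cinner_add_left sum.distrib)
  qed
  then have \<phi>_null: "(\<lambda>n. \<phi> (x n)) \<longlonglongrightarrow> 0"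
    using weak by (auto simp: weakly_null_on_def)
  \<comment> \<open>Of the hump \<open>\<epsilon>\<close> the blocks before and after it can cancel at most \<open>\<epsilon> / 4\<close> each.\<close>
  have "\<epsilon> / 2 \<le> cmod (\<phi> (x (r (m k))))" for k
  proof (rule LIMSEQ_le_const [OF tendsto_norm [OF lim_\<phi> [OF tc]]])
    define A where "A = x (r (m k))"
    have A: "A \<in> trace_class" by (simp add: A_def tc)
    have early: "(\<Sum>j<k. cmod (\<beta> j A)) \<le> \<epsilon> / 4"
    proof -
      have "(\<Sum>j<k. cmod (\<beta> j A)) = (\<Sum>j<k. cmod (\<beta> j (head (m k) A)))"
      proof (rule sum.cong [OF refl])
        fix j assume "j \<in> {..<k}"
        then have "F j \<subseteq> {..<m k}" using m_mono [of "Suc j" k] by (auto simp: F_def)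
        then show "cmod (\<beta> j A) = cmod (\<beta> j (head (m k) A))"
          unfolding \<beta>_def by (simp add: partial_trace_head [OF block])
      qed
      also have "\<dots> \<le> trace_norm (head (m k) A)"
        by (rule sum_\<beta>) (simp_all add: head_trace_class A)
      also have "\<dots> \<le> \<epsilon> / 4" unfolding A_def by (rule before)
      finally show ?thesis .
    qed
    have late: "(\<Sum>j\<in>{Suc k..<J}. cmod (\<beta> j A)) \<le> \<epsilon> / 4" for J
    proof -
      have "(\<Sum>j\<in>{Suc k..<J}. cmod (\<beta> j A)) = (\<Sum>j\<in>{Suc k..<J}. cmod (\<beta> j (corner (m (Suc k)) A)))"
      proof (rule sum.cong [OF refl])
        fix j assume "j \<in> {Suc k..<J}"
        then have "F j \<subseteq> {m (Suc k)..}" using m_mono [of "Suc k" j] by (auto simp: F_def)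
        then show "cmod (\<beta> j A) = cmod (\<beta> j (corner (m (Suc k)) A))"
          unfolding \<beta>_def by (simp add: partial_trace_corner [OF block])
      qed
      also have "\<dots> \<le> trace_norm (corner (m (Suc k)) A)"
        by (rule sum_\<beta>) (simp_all add: corner_trace_class A)
      also have "\<dots> \<le> \<epsilon> / 4" unfolding A_def m by (rule after)
      finally show ?thesis .
    qed
    have mid: "\<epsilon> < cmod (\<beta> k A)"
      unfolding \<beta>_def F_def c_def m A_def by (rule hump)
    have "\<epsilon> / 2 \<le> norm (\<Sum>j<J. \<beta> j A)" if "J > k" for J
    proof -
      have "{..<J} = {..<k} \<union> {k} \<union> {Suc k..<J}" using that by auto
      moreover have "{..<k} \<inter> {Suc k..<J} = {}" by auto
      ultimately have "(\<Sum>j<J. \<beta> j A) = (\<Sum>j<k. \<beta> j A) + \<beta> k A + (\<Sum>j\<in>{Suc k..<J}. \<beta> j A)"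
        by (simp add: sum.union_disjoint)
      then have "\<beta> k A = (\<Sum>j<J. \<beta> j A) - ((\<Sum>j<k. \<beta> j A) + (\<Sum>j\<in>{Suc k..<J}. \<beta> j A))"
        by simp
      then have "cmod (\<beta> k A) \<le> cmod (\<Sum>j<J. \<beta> j A)
          + cmod ((\<Sum>j<k. \<beta> j A) + (\<Sum>j\<in>{Suc k..<J}. \<beta> j A))"
        by (metis norm_triangle_ineq4)
      also have "cmod ((\<Sum>j<k. \<beta> j A) + (\<Sum>j\<in>{Suc k..<J}. \<beta> j A)) \<le> \<epsilon> / 4 + \<epsilon> / 4"
        by (intro norm_triangle_le add_mono order_trans [OF norm_sum early] order_trans [OF norm_sum late])
      finally show ?thesis using mid by simp
    qed
    then show "\<exists>N. \<forall>J\<ge>N. \<epsilon> / 2 \<le> norm (\<Sum>j<J. \<beta> j (x (r (m k))))"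
      unfolding A_def by (meson Suc_le_lessD)
  qed
  moreover obtain n0 where "\<And>n. n \<ge> n0 \<Longrightarrow> cmod (\<phi> (x n)) < \<epsilon> / 2"
    using LIMSEQ_D [OF \<phi>_null, of "\<epsilon> / 2"] \<open>\<epsilon> > 0\<close> by auto
  moreover have "r (m n0) \<ge> n0" using r [of "m n0"] m_ge [of n0] by linarith
  ultimately show False by (meson not_le)
qed

end

section \<open>Weak convergence in Hilbert space and compactness\<close>

definition hilbert_weakly_null :: "(nat \<Rightarrow> 'h::chilbert_space) \<Rightarrow> bool" where
  "hilbert_weakly_null h \<longleftrightarrow> (\<forall>y. (\<lambda>n. cinner (h n) y) \<longlonglongrightarrow> 0)"

text \<open>The uniform boundedness principle, from the Baire category theorem.\<close>

lemma hilbert_weakly_null_bounded: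
  fixes h :: "nat \<Rightarrow> 'h::chilbert_space"
  assumes "hilbert_weakly_null h"
  obtains C where "C > 0" "\<And>n. norm (h n) \<le> C"
proof -
  define F where "F k = {y. \<forall>n. cmod (cinner (h n) y) \<le> real k}" for k :: nat
  have closed_F: "closed (F k)" for k
  proof -
    have "F k = (\<Inter>n. {y. cmod (cinner (h n) y) \<le> real k})" by (auto simp: F_def)
    moreover have "closed {y. cmod (cinner (h n) y) \<le> real k}" for n
      by (intro closed_Collect_le continuous_on_norm continuous_on_const
          linear_continuous_on cinner.bounded_linear_right)
    ultimately show ?thesis by auto
  qed
  have "y \<in> (\<Union>k. F k)" for y
  proof -
    have "Bseq (\<lambda>n. cinner (h n) y)"
      using assms unfolding hilbert_weakly_null_def by (blast intro: convergent_imp_Bseq convergentI)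
    then obtain K where K: "\<And>n. cmod (cinner (h n) y) \<le> K" by (auto simp: Bseq_def)
    obtain k :: nat where "K \<le> real k" using real_arch_simple by blast
    then have "y \<in> F k" unfolding F_def using order_trans [OF K] by blast
    then show ?thesis by blast
  qed
  then have F_UN: "\<Union>(range F) = UNIV" by blast
  have "\<exists>k. interior (F k) \<noteq> {}"
  proof (rule ccontr)
    assume "\<nexists>k. interior (F k) \<noteq> {}"
    then have empty: "interior (F k) = {}" for k by blast
    have "Met_TC.mtopology interior_of \<Union>(range F) = {}"
    proof (rule Met_TC.metric_Baire_category_alt)
      show "Met_TC.mcomplete TYPE('h)" by (simp add: mcomplete_iff_complete complete_UNIV)
      show "closedin Met_TC.mtopology T \<and> Met_TC.mtopology interior_of T = {}" if "T \<in> range F" for T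
        using that closed_F empty by auto
    qed simp
    then show False by (simp add: F_UN)
  qed
  then obtain k y where "y \<in> interior (F k)" by blast
  then obtain r where r: "r > 0" "ball y r \<subseteq> F k"
    by (meson mem_interior)
  have "norm (h n) \<le> 4 * (real k + 1) / r" for n
  proof (cases "h n = 0")
    case True
    then show ?thesis using r by simp
  next
    case False
    define u where "u = (r / (2 * norm (h n))) *\<^sub>R h n"
    have "norm u = r / 2" using False r by (simp add: u_def)
    then have "y + u \<in> F k" "y \<in> F k" using r by (auto simp: dist_norm)
    then have "cmod (cinner (h n) (y + u)) \<le> real k" "cmod (cinner (h n) y) \<le> real k"
      by (auto simp: F_def)
    then have "cmod (cinner (h n) (y + u) - cinner (h n) y) \<le> 2 * real k"
      using norm_triangle_ineq4 [of "cinner (h n) (y + u)" "cinner (h n) y"] by linarith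
    moreover have "cinner (h n) (y + u) - cinner (h n) y = of_real (r / 2 * norm (h n))"
      using False by (simp add: cinner_add_right u_def cinner_scaleR_right cinner_self power2_eq_square)
    ultimately have "\<bar>r / 2 * norm (h n)\<bar> \<le> 2 * real k" by (simp only: norm_of_real)
    then have "r * norm (h n) \<le> 4 * (real k + 1)" using r by (simp add: abs_mult)
    then show ?thesis using r by (simp add: field_simps)
  qed
  then show thesis using r by (intro that [of "4 * (real k + 1) / r"]) auto
qed

lemma hilbert_weakly_null_subseq:
  "hilbert_weakly_null h \<Longrightarrow> strict_mono r \<Longrightarrow> hilbert_weakly_null (h \<circ> r)"
  unfolding hilbert_weakly_null_def using LIMSEQ_subseq_LIMSEQ by (fastforce simp: o_def)

text \<open>A bounded weakly null sequence has almost orthogonal members, whose sums grow only like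
  the square root of their number.\<close>

lemma weakly_null_slow_sums:
  fixes h :: "nat \<Rightarrow> 'h::chilbert_space"
  assumes h: "hilbert_weakly_null h" and C: "\<And>n. norm (h n) \<le> C"
  shows "\<exists>I. finite I \<and> card I = m \<and> I \<subseteq> {n0..} \<and> (norm (\<Sum>i\<in>I. h i))\<^sup>2 \<le> real m * (C\<^sup>2 + 1)"
proof (induction m)
  case 0
  show ?case by (rule exI [of _ "{}"]) simp
next
  case (Suc m)
  then obtain I where I: "finite I" "card I = m" "I \<subseteq> {n0..}"
    and le: "(norm (\<Sum>i\<in>I. h i))\<^sup>2 \<le> real m * (C\<^sup>2 + 1)" by blast
  define v where "v = (\<Sum>i\<in>I. h i)"
  obtain N where N: "\<And>n. n \<ge> N \<Longrightarrow> cmod (cinner (h n) v) < 1/2"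
    using LIMSEQ_D [OF h [unfolded hilbert_weakly_null_def, rule_format, of v], of "1/2"] by auto
  define n where "n = Max (insert N (insert n0 (Suc ` I)))"
  have "k \<le> n" if "k \<in> insert N (insert n0 (Suc ` I))" for k
    unfolding n_def using I(1) that by (intro Max_ge) auto
  then have n: "n \<ge> N" "n \<ge> n0" "\<And>i. i \<in> I \<Longrightarrow> i < n"
    by (auto simp: Suc_le_eq [symmetric])
  have "n \<notin> I" using n(3) by blast
  have "(norm (h n + v))\<^sup>2 = (norm (h n))\<^sup>2 + (norm v)\<^sup>2 + 2 * Re (cinner (h n) v)"
    by (rule norm_add_square)
  also have "\<dots> \<le> C\<^sup>2 + real m * (C\<^sup>2 + 1) + 2 * (1/2)"
    using N [OF n(1)] complex_Re_le_cmod [of "cinner (h n) v"] le power_mono [OF C, of n 2]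
    unfolding v_def by (intro add_mono mult_left_mono) auto
  also have "\<dots> = real (Suc m) * (C\<^sup>2 + 1)" by (simp add: algebra_simps)
  finally show ?case
    using I n \<open>n \<notin> I\<close> by (intro exI [of _ "insert n I"]) (auto simp: v_def)
qed

text \<open>The argument of Banach and Saks replaces functionals on the target space: averages of
  almost orthogonal members tend to zero in norm, while their images tend to \<open>z\<close>.\<close>

lemma weakly_null_limit_zero:
  fixes h :: "nat \<Rightarrow> 'h::chilbert_space" and S :: "'h \<Rightarrow> 'z::real_normed_vector"
  assumes S: "bounded_linear S" and h: "hilbert_weakly_null h" and z: "(\<lambda>n. S (h n)) \<longlonglongrightarrow> z"
  shows "z = 0"
proof (rule ccontr)
  assume "z \<noteq> 0"
  define \<epsilon> where "\<epsilon> = norm z / 4"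
  have \<epsilon>: "\<epsilon> > 0" using \<open>z \<noteq> 0\<close> by (simp add: \<epsilon>_def)
  obtain C where C: "\<And>n. norm (h n) \<le> C" using hilbert_weakly_null_bounded [OF h] by blast
  obtain K where K: "K > 0" "\<And>x. norm (S x) \<le> norm x * K" using bounded_linear.pos_bounded [OF S] by blast
  obtain n0 where n0: "\<And>n. n \<ge> n0 \<Longrightarrow> norm (S (h n) - z) < \<epsilon>"
    using LIMSEQ_D [OF z \<epsilon>] by blast
  obtain m :: nat where m: "(K\<^sup>2 * (C\<^sup>2 + 1) + 1) / \<epsilon>\<^sup>2 < real m" using reals_Archimedean2 by blast
  have "0 < (K\<^sup>2 * (C\<^sup>2 + 1) + 1) / \<epsilon>\<^sup>2"
    using \<epsilon> by (intro divide_pos_pos add_nonneg_pos) auto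
  then have "m > 0" using m by (cases m) auto
  obtain I where I: "finite I" "card I = m" "I \<subseteq> {n0..}"
    and le: "(norm (\<Sum>i\<in>I. h i))\<^sup>2 \<le> real m * (C\<^sup>2 + 1)"
    using weakly_null_slow_sums [OF h C] by blast
  define v where "v = (\<Sum>i\<in>I. h i)"
  have "norm (S v) \<le> real m * \<epsilon>"
  proof (rule power2_le_imp_le)
    have "(norm (S v))\<^sup>2 \<le> (norm v)\<^sup>2 * K\<^sup>2"
      using power_mono [OF K(2) [of v], of 2] by (simp add: power_mult_distrib)
    also have "\<dots> \<le> (real m * (C\<^sup>2 + 1)) * K\<^sup>2"
      using le unfolding v_def by (rule mult_right_mono) simp
    also have "\<dots> \<le> real m * (real m * \<epsilon>\<^sup>2)"
      unfolding mult.assoc using m \<epsilon> by (intro mult_left_mono) (auto simp: field_simps)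
    finally show "(norm (S v))\<^sup>2 \<le> (real m * \<epsilon>)\<^sup>2" by (simp add: power2_eq_square mult_ac)
  qed (use \<epsilon> in simp)
  moreover have "norm (S v - real m *\<^sub>R z) \<le> real m * \<epsilon>"
  proof -
    have "S v - real m *\<^sub>R z = (\<Sum>i\<in>I. S (h i) - z)"
      unfolding v_def linear_sum [OF bounded_linear.linear [OF S]] sum_subtractf
      using I by (simp add: sum_constant_scaleR)
    also have "norm \<dots> \<le> (\<Sum>i\<in>I. \<epsilon>)"
      by (rule sum_norm_le) (use n0 I in \<open>auto intro: less_imp_le\<close>)
    finally show ?thesis using I by simp
  qed
  ultimately have "norm (real m *\<^sub>R z) \<le> real m * (2 * \<epsilon>)"
    using norm_triangle_ineq4 [of "S v" "S v - real m *\<^sub>R z"] by (simp add: algebra_simps)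
  then have "norm z \<le> 2 * \<epsilon>" using \<open>m > 0\<close> by simp
  then show False using \<epsilon> by (simp add: \<epsilon>_def)
qed

lemma compact_on_ball_maps_weakly_null:
  fixes S :: "'h::chilbert_space \<Rightarrow> 'z::real_normed_vector"
  assumes S: "bounded_linear S" and comp: "compact (closure (S ` {x. norm x \<le> 1}))"
    and h: "hilbert_weakly_null h"
  shows "(\<lambda>n. S (h n)) \<longlonglongrightarrow> 0"
proof (rule ccontr)
  assume "\<not> (\<lambda>n. S (h n)) \<longlonglongrightarrow> 0"
  then obtain \<epsilon> where \<epsilon>: "\<epsilon> > 0" "\<And>N. \<exists>n\<ge>N. norm (S (h n)) \<ge> \<epsilon>"
    unfolding LIMSEQ_iff by (auto simp: not_less)
  obtain r :: "nat \<Rightarrow> nat" where r: "strict_mono r" "\<And>n. norm (S (h (r n))) \<ge> \<epsilon>"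
    using infinite_enumerate [of "{n. norm (S (h n)) \<ge> \<epsilon>}"] \<epsilon>(2)
    unfolding infinite_nat_iff_unbounded_le by auto
  obtain C where C: "C > 0" "\<And>n. norm (h n) \<le> C" using hilbert_weakly_null_bounded [OF h] by blast
  define g where "g n = S ((1 / C) *\<^sub>R h (r n))" for n
  have "g n \<in> closure (S ` {x. norm x \<le> 1})" for n
  proof -
    have "norm ((1 / C) *\<^sub>R h (r n)) \<le> 1" using C by simp
    then show ?thesis
      unfolding g_def by (intro subsetD [OF closure_subset] imageI CollectI)
  qed
  then obtain z s where s: "strict_mono s" "(g \<circ> s) \<longlonglongrightarrow> z"
    using comp unfolding compact_def by blast
  have "(\<lambda>n. C *\<^sub>R g (s n)) \<longlonglongrightarrow> C *\<^sub>R z"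
    using s(2) by (intro tendsto_intros) (simp add: o_def)
  moreover have "C *\<^sub>R g n = S (h (r n))" for n
    using C by (simp add: g_def linear_scale [OF bounded_linear.linear [OF S]])
  ultimately have lim: "(\<lambda>n. S ((h \<circ> (r \<circ> s)) n)) \<longlonglongrightarrow> C *\<^sub>R z" by simp
  moreover have "hilbert_weakly_null (h \<circ> (r \<circ> s))"
    using h r(1) s(1) by (intro hilbert_weakly_null_subseq strict_mono_o)
  ultimately have "C *\<^sub>R z = 0" using weakly_null_limit_zero [OF S] by blast
  with tendsto_norm [OF lim] have "(\<lambda>n. norm (S (h (r (s n))))) \<longlonglongrightarrow> 0" by simp
  then have "\<epsilon> \<le> 0" by (rule LIMSEQ_le_const) (use r(2) in blast)
  with \<epsilon>(1) show False by simp
qed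

lemma compact_closure_if_subseq:
  fixes A :: "'a::real_normed_vector set"
  assumes "\<And>f :: nat \<Rightarrow> 'a. (\<And>n. f n \<in> A) \<Longrightarrow> \<exists>l r. strict_mono (r :: nat \<Rightarrow> nat) \<and> (f \<circ> r) \<longlonglongrightarrow> l"
  shows "compact (closure A)"
  unfolding compact_def
proof (intro allI impI)
  fix f :: "nat \<Rightarrow> 'a" assume f: "\<forall>n. f n \<in> closure A"
  have "\<exists>a\<in>A. dist a (f n) < 1 / real (Suc n)" for n
    using f closure_approachable [of "f n" A] by simp
  then obtain g where g: "\<And>n. g n \<in> A" "\<And>n. dist (g n) (f n) < 1 / real (Suc n)" by metis
  obtain l r where r: "strict_mono r" "(g \<circ> r) \<longlonglongrightarrow> l" using assms [of g] g(1) by blast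
  have "(\<lambda>n. g n - f n) \<longlonglongrightarrow> 0"
    by (rule Lim_null_comparison [OF always_eventually LIMSEQ_Suc [OF lim_1_over_n]])
      (use g(2) less_imp_le in \<open>auto simp: dist_norm\<close>)
  from Lim_transform2 [OF r(2), of "f \<circ> r"] LIMSEQ_subseq_LIMSEQ [OF this r(1)]
  have "(f \<circ> r) \<longlonglongrightarrow> l" by (simp add: o_def)
  moreover have "l \<in> closure A"
    using r(2) g(1) closure_sequential by (metis comp_apply)
  ultimately show "\<exists>l\<in>closure A. \<exists>r. strict_mono r \<and> (f \<circ> r) \<longlonglongrightarrow> l"
    using r(1) by blast
qed

context onb_sequence
begin

text \<open>Weak sequential compactness of balls: choose a subsequence along which all coordinates
  converge; the limits are the coordinates of a vector by Fatou's inequality and Riesz--Fischer.\<close>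

lemma bounded_weakly_convergent_subsequence:
  fixes h :: "nat \<Rightarrow> 'h"
  assumes C: "\<And>n. norm (h n) \<le> C"
  obtains r x where "strict_mono r" "hilbert_weakly_null (\<lambda>n. h (r n) - x)"
proof -
  define a where "a n i = cinner (h n) (e i)" for n i
  have "C \<ge> 0" using order_trans [OF norm_ge_zero C] .
  have a_le: "cmod (a n i) \<le> C" for n i
    using order_trans [OF cinner_Cauchy_Schwarz, of "h n" "e i" C] C by (simp add: a_def)
  interpret subseqs "\<lambda>i s. convergent (\<lambda>n. a (s n) i)"
  proof
    fix i :: nat and s :: "nat \<Rightarrow> nat" assume "strict_mono s"
    have "bounded (range (\<lambda>n. a (s n) i))"
      using a_le by (auto simp: bounded_iff)
    then show "\<exists>r. strict_mono r \<and> convergent (\<lambda>n. a ((s \<circ> r) n) i)"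
      using bounded_imp_convergent_subsequence [of "\<lambda>n. a (s n) i"]
      by (auto simp: o_def convergent_def)
  qed
  define r where "r = diagseq"
  have r: "strict_mono r" unfolding r_def by (rule subseq_diagseq)
  have "convergent (\<lambda>n. a (r n) i)" for i
  proof -
    have "convergent (\<lambda>n. a ((diagseq \<circ> (+) (Suc i)) n) i)"
    proof (rule diagseq_holds)
      fix s t :: "nat \<Rightarrow> nat" and i
      assume "strict_mono t" "convergent (\<lambda>n. a (s n) i)"
      from convergent_subseq_convergent [OF this(2,1)]
      show "convergent (\<lambda>n. a ((s \<circ> t) n) i)" by (simp add: o_def)
    qed
    then have "convergent (\<lambda>n. a (r (n + Suc i)) i)"
      unfolding r_def o_def by (simp only: add.commute)
    then show ?thesis
      using convergent_ignore_initial_segment [of "\<lambda>n. a (r n) i" "Suc i"] by simp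
  qed
  then obtain b where b: "\<And>i. (\<lambda>n. a (r n) i) \<longlonglongrightarrow> b i" unfolding convergent_def by metis
  have sum_b: "(\<Sum>i<N. (cmod (b i))\<^sup>2) \<le> C\<^sup>2" for N
  proof (rule LIMSEQ_le_const2)
    show "(\<lambda>n. \<Sum>i<N. (cmod (a (r n) i))\<^sup>2) \<longlonglongrightarrow> (\<Sum>i<N. (cmod (b i))\<^sup>2)"
      by (intro tendsto_intros b)
    have "(\<Sum>i<N. (cmod (a (r n) i))\<^sup>2) \<le> C\<^sup>2" for n
      unfolding a_def norm_proj [symmetric, OF finite_lessThan]
      by (intro power_mono order_trans [OF norm_proj_le C]) auto
    then show "\<exists>M. \<forall>n\<ge>M. (\<Sum>i<N. (cmod (a (r n) i))\<^sup>2) \<le> C\<^sup>2" by blast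
  qed
  then have "b \<in> ell2"
    unfolding ell2_def by (auto intro: summableI_nonneg_bounded [where x = "C\<^sup>2"])
  then obtain x where x: "\<And>i. cinner x (e i) = b i" using exists_vector_with_coords by blast
  define d where "d n = h (r n) - x" for n
  define D where "D = C + norm x + 1"
  have D: "D > 0" "norm (d n) \<le> D" for n
    using C [of "r n"] norm_triangle_ineq4 [of "h (r n)" x] \<open>C \<ge> 0\<close> by (auto simp: d_def D_def add_nonneg_pos)
  have coord: "(\<lambda>n. cinner (d n) (e i)) \<longlonglongrightarrow> 0" for i
    using tendsto_diff [OF b tendsto_const [of "b i"], of i] by (simp add: d_def cinner.diff_left x a_def)
  have "(\<lambda>n. cinner (d n) y) \<longlonglongrightarrow> 0" for y
  proof (rule LIMSEQ_I)
    fix \<epsilon> :: real assume "\<epsilon> > 0"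
    then obtain N where N: "norm (proj {..<N} y - y) < \<epsilon> / (2 * D)"
      using LIMSEQ_D [OF proj_tendsto [of y], of "\<epsilon> / (2 * D)"] D(1) by auto
    have "(\<lambda>n. \<Sum>i<N. cinner (d n) (e i) * cinner (e i) y) \<longlonglongrightarrow> (\<Sum>i<N. 0 * cinner (e i) y)"
      by (intro tendsto_intros coord)
    then obtain n0 where n0: "\<And>n. n \<ge> n0 \<Longrightarrow> cmod (\<Sum>i<N. cinner (d n) (e i) * cinner (e i) y) < \<epsilon> / 2"
      using LIMSEQ_D [of _ "0 :: complex" "\<epsilon> / 2"] \<open>\<epsilon> > 0\<close> by fastforce
    have "cmod (cinner (d n) y) < \<epsilon>" if "n \<ge> n0" for n
    proof -
      have "cinner (d n) y = cinner (d n) (proj {..<N} y) - cinner (d n) (proj {..<N} y - y)"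
        by (simp add: cinner.diff_right)
      also have "cinner (d n) (proj {..<N} y) = (\<Sum>i<N. cinner (d n) (e i) * cinner (e i) y)"
        unfolding proj_selfadjoint [symmetric] by (simp add: proj_def cinner.sum_left cinner_scaleC_left)
      finally have "cmod (cinner (d n) y)
          \<le> cmod (\<Sum>i<N. cinner (d n) (e i) * cinner (e i) y) + cmod (cinner (d n) (proj {..<N} y - y))"
        using norm_triangle_ineq4 by metis
      also have "cmod (cinner (d n) (proj {..<N} y - y)) \<le> D * (\<epsilon> / (2 * D))"
        using N D by (intro order_trans [OF cinner_Cauchy_Schwarz] mult_mono) auto
      also have "D * (\<epsilon> / (2 * D)) = \<epsilon> / 2" using D(1) by simp
      finally show ?thesis using n0 [OF that] by simp
    qed
    then show "\<exists>no. \<forall>n\<ge>no. norm (cinner (d n) y - 0) < \<epsilon>" by auto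
  qed
  then show thesis using r by (intro that [of r x]) (simp_all add: hilbert_weakly_null_def d_def)
qed

end

section \<open>Dunford--Pettis operators are \<open>\<ell>\<^sup>2\<close>-compact\<close>

context onb_sequence
begin

text \<open>A copy of \<open>\<ell>\<^sup>2\<close> is a copy of the Hilbert space, so a bounded sequence in it has a
  subsequence that converges weakly there, hence weakly in the space of trace class operators.\<close>

lemma dunford_pettis_imp_ell2_compact:
  fixes T :: "('h \<Rightarrow> 'h) \<Rightarrow> 'z::complex_banach"
  assumes T: "bounded_clinear_on trace_class trace_norm T"
    and DP: "dunford_pettis_on trace_class trace_norm T"
  shows "ell2_compact_on trace_class trace_norm T"
  unfolding ell2_compact_on_def compact_operator_on_def
proof (intro allI impI, elim conjE)
  fix W :: "('h \<Rightarrow> 'h) set"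
  assume closed: "closed_csubspace_on trace_class trace_norm W"
    and iso: "isomorphic_on W trace_norm ell2 ell2_norm"
  have W: "complex_vector.subspace W" "W \<subseteq> trace_class"
    using closed by (auto simp: closed_csubspace_on_def)
  obtain J K L where J: "bij_betw J W ell2"
    and J_add: "\<And>A B. A \<in> W \<Longrightarrow> B \<in> W \<Longrightarrow> J (A + B) = J A + J B"
    and J_scale: "\<And>c A. A \<in> W \<Longrightarrow> J (c *\<^sub>C A) = c *\<^sub>C J A"
    and K: "\<And>A. A \<in> W \<Longrightarrow> ell2_norm (J A) \<le> K * trace_norm A"
    and L: "\<And>A. A \<in> W \<Longrightarrow> trace_norm A \<le> L * ell2_norm (J A)"
    using iso unfolding isomorphic_on_def by metis
  have inj: "A = B" if "A \<in> W" "B \<in> W" "J A = J B" for A B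
    using bij_betw_imp_inj_on [OF J] that by (auto dest: inj_onD)
  define coords where "coords h = (\<lambda>i. cinner h (e i))" for h
  define G where "G h = inv_into W J (coords h)" for h
  have coords_ell2: "coords h \<in> J ` W" for h
    using J coords_in_ell2 unfolding coords_def bij_betw_def by blast
  have G: "G h \<in> W" "J (G h) = coords h" for h
    unfolding G_def using inv_into_into [OF coords_ell2] f_inv_into_f [OF coords_ell2] by auto
  have G_add: "G (h + k) = G h + G k" for h k
  proof (rule inj)
    show "J (G (h + k)) = J (G h + G k)"
      by (simp add: J_add G) (simp add: coords_def fun_eq_iff cinner_add_left)
  qed (intro G complex_vector.subspace_add W)+
  have G_scale: "G (c *\<^sub>C h) = c *\<^sub>C G h" for c h
  proof (rule inj)
    show "J (G (c *\<^sub>C h)) = J (c *\<^sub>C G h)"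
      by (simp add: J_scale G)
        (simp add: coords_def fun_eq_iff cinner_scaleC_left scaleC_fun_def scaleC_complex_def)
  qed (intro G complex_vector.subspace_scale W)+
  have G_norm: "trace_norm (G h) \<le> L * norm h" for h
    using L [OF G(1)] by (simp add: G(2)) (simp add: coords_def ell2_norm_coords)
  have T_add: "T (A + B) = T A + T B" if "A \<in> trace_class" "B \<in> trace_class" for A B
    using T that by (simp add: bounded_clinear_on_def)
  show "compact (closure (T ` {A \<in> W. trace_norm A \<le> 1}))"
  proof (rule compact_closure_if_subseq)
    fix f :: "nat \<Rightarrow> 'z" assume "\<And>n. f n \<in> T ` {A \<in> W. trace_norm A \<le> 1}"
    then have "\<exists>A. f n = T A \<and> A \<in> W \<and> trace_norm A \<le> 1" for n by blast
    then obtain A where A: "\<And>n. f n = T (A n)" "\<And>n. A n \<in> W" "\<And>n. trace_norm (A n) \<le> 1" by metis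
    have "\<exists>h. coords h = J (A n)" for n
      using exists_vector_with_coords [of "J (A n)"] J A(2) unfolding bij_betw_def coords_def by blast
    then obtain h where h: "\<And>n. coords (h n) = J (A n)" by metis
    have Gh: "G (h n) = A n" for n
      by (rule inj) (simp_all add: G h A(2))
    have "norm (h n) \<le> \<bar>K\<bar>" for n
    proof -
      have "norm (h n) = ell2_norm (J (A n))"
        unfolding h [symmetric] coords_def by (simp add: ell2_norm_coords)
      also have "\<dots> \<le> K * trace_norm (A n)" by (rule K [OF A(2)])
      also have "\<dots> \<le> \<bar>K\<bar> * trace_norm (A n)"
        using trace_norm_nonneg [of "A n"] A(2) W(2) by (intro mult_right_mono) auto
      also have "\<dots> \<le> \<bar>K\<bar> * 1" by (intro mult_left_mono A(3)) simp
      finally show ?thesis by simp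
    qed
    then obtain r x where r: "strict_mono r" and weak: "hilbert_weakly_null (\<lambda>n. h (r n) - x)"
      using bounded_weakly_convergent_subsequence by blast
    have "weakly_null_on trace_class trace_norm (\<lambda>n. G (h (r n) - x))"
      unfolding weakly_null_on_def
    proof (intro conjI allI impI)
      show "range (\<lambda>n. G (h (r n) - x)) \<subseteq> trace_class" using G(1) W(2) by blast
      fix \<phi> :: "('h \<Rightarrow> 'h) \<Rightarrow> complex" assume \<phi>: "bounded_clinear_on trace_class trace_norm \<phi>"
      then obtain M where M: "\<And>A. A \<in> trace_class \<Longrightarrow> norm (\<phi> A) \<le> M * trace_norm A"
        unfolding bounded_clinear_on_def by blast
      have Gtc: "G u \<in> trace_class" for u using G(1) W(2) by blast
      have "bounded_clinear_on UNIV norm (\<lambda>u. \<phi> (G u))"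
        unfolding bounded_clinear_on_def
      proof (intro conjI ballI allI exI)
        fix u
        have "norm (\<phi> (G u)) \<le> \<bar>M\<bar> * trace_norm (G u)"
          using trace_norm_nonneg [OF Gtc [of u]]
          by (intro order_trans [OF M [OF Gtc]] mult_right_mono) auto
        also have "\<dots> \<le> \<bar>M\<bar> * (L * norm u)" by (intro mult_left_mono G_norm) simp
        finally show "norm (\<phi> (G u)) \<le> (\<bar>M\<bar> * L) * norm u" by (simp add: mult.assoc)
      qed (use \<phi> Gtc in \<open>auto simp: bounded_clinear_on_def G_add G_scale\<close>)
      then obtain z where "\<And>u. \<phi> (G u) = cinner u z" using Riesz_representation by blast
      then show "(\<lambda>n. \<phi> (G (h (r n) - x))) \<longlonglongrightarrow> 0"
        using weak by (simp add: hilbert_weakly_null_def)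
    qed
    then have lim: "(\<lambda>n. T (G (h (r n) - x))) \<longlonglongrightarrow> 0"
      using DP by (auto simp: dunford_pettis_on_def)
    have "f (r n) = T (G (h (r n) - x)) + T (G x)" for n
    proof -
      have "A (r n) = G (h (r n) - x) + G x"
        unfolding G_add [symmetric] Gh [symmetric] by simp
      then show ?thesis
        using G(1) W(2) by (metis A(1) T_add subsetD)
    qed
    then have "(f \<circ> r) \<longlonglongrightarrow> 0 + T (G x)"
      using tendsto_add [OF lim tendsto_const [of "T (G x)"]] by (simp add: o_def)
    with r show "\<exists>l r. strict_mono r \<and> (f \<circ> r) \<longlonglongrightarrow> l" by blast
  qed
qed

section \<open>\<open>\<ell>\<^sup>2\<close>-compact operators are Dunford--Pettis\<close>

text \<open>Matrix entries are continuous, as the trace norm dominates the operator norm.\<close>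

lemma closed_csubspace_matrix_zeros:
  "closed_csubspace_on trace_class trace_norm
     {A \<in> trace_class. \<forall>x y. (x, y) \<in> Z \<longrightarrow> cinner (A x) (y :: 'h) = 0}" (is "closed_csubspace_on _ _ ?W")
  unfolding closed_csubspace_on_def
proof (intro conjI ballI impI)
  show "complex_vector.subspace ?W"
    unfolding complex_vector.subspace_def
    by (auto simp: trace_class_zero trace_class_add trace_class_scaleC cinner_add_left scaleC_fun_def
        cinner_scaleC_left cinner.zero_left intro: trace_class_scaleC [unfolded scaleC_fun_def])
  fix A :: "'h \<Rightarrow> 'h" assume A: "A \<in> trace_class" and approx: "\<forall>\<epsilon>>0. \<exists>B\<in>?W. trace_norm (A - B) < \<epsilon>"
  have "cinner (A x) y = 0" if "(x, y) \<in> Z" for x y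
  proof -
    have "cmod (cinner (A x) y) \<le> 0 + \<delta>" if "\<delta> > 0" for \<delta>
    proof -
      define \<epsilon> where "\<epsilon> = \<delta> / (norm x * norm y + 1)"
      have pos: "norm x * norm y + 1 > 0" by (simp add: add_nonneg_pos)
      then have "\<epsilon> > 0" using that by (simp add: \<epsilon>_def)
      then obtain B where B: "B \<in> ?W" "trace_norm (A - B) < \<epsilon>" using approx by blast
      then have "cinner (A x) y = cinner ((A - B) x) y"
        using \<open>(x, y) \<in> Z\<close> by (auto simp: cinner.diff_left)
      also have "cmod \<dots> \<le> norm ((A - B) x) * norm y" by (rule cinner_Cauchy_Schwarz)
      also have "\<dots> \<le> (trace_norm (A - B) * norm x) * norm y"
        using B A by (intro mult_right_mono norm_le_trace_norm trace_class_diff) auto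
      also have "\<dots> \<le> (\<epsilon> * norm x) * norm y"
        using B(2) by (intro mult_right_mono) auto
      also have "\<dots> \<le> \<epsilon> * (norm x * norm y + 1)" using \<open>\<epsilon> > 0\<close> by (simp add: algebra_simps)
      also have "\<dots> = \<delta>" using pos by (simp add: \<epsilon>_def)
      finally show ?thesis by simp
    qed
    then have "cmod (cinner (A x) y) \<le> 0" by (rule field_le_epsilon)
    then show ?thesis by simp
  qed
  with A show "A \<in> ?W" by blast
qed auto

text \<open>This covers the columns and the rows of matrices: the operators of rank one with one
  fixed unit vector. Their coordinates in \<open>\<ell>\<^sup>2\<close> are matrix entries, so that \<open>J\<close> is linear even
  where \<open>G\<close> is conjugate linear, which is the case for rows.\<close>

lemma isomorphic_ell2_if_coordinates:
  fixes G :: "'h \<Rightarrow> 'h \<Rightarrow> 'h" and u v :: "nat \<Rightarrow> 'h"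
  assumes G: "\<And>h. trace_norm (G h) = norm h"
    and ell2: "bij_betw (\<lambda>h n. cinner (G h (u n)) (v n)) UNIV ell2"
    and norm: "\<And>h. ell2_norm (\<lambda>n. cinner (G h (u n)) (v n)) = norm h"
  shows "isomorphic_on (range G) trace_norm ell2 ell2_norm"
  unfolding isomorphic_on_def
proof (intro exI conjI ballI allI)
  define J where "J A = (\<lambda>n. cinner (A (u n)) (v n))" for A :: "'h \<Rightarrow> 'h"
  have JG: "bij_betw (\<lambda>h. J (G h)) UNIV ell2" using ell2 by (simp add: J_def)
  show "bij_betw J (range G) ell2"
    using JG unfolding bij_betw_def by (auto simp: inj_on_def image_image)
  show "J (A + B) = J A + J B" for A B
    by (simp add: J_def fun_eq_iff cinner_add_left)
  show "J (c *\<^sub>C A) = c *\<^sub>C J A" for c A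
    by (simp add: J_def fun_eq_iff scaleC_fun_def cinner_scaleC_left scaleC_complex_def)
  show "ell2_norm (J A) \<le> 1 * trace_norm A" if "A \<in> range G" for A
    using that by (auto simp: J_def norm G)
  show "trace_norm A \<le> 1 * ell2_norm (J A)" if "A \<in> range G" for A
    using that by (auto simp: J_def norm G)
qed

lemma bij_betw_coords: "bij_betw (\<lambda>h n. cinner h (e n)) UNIV ell2"
  unfolding bij_betw_def
proof
  show "inj (\<lambda>h n. cinner h (e n))"
    by (auto simp: inj_def fun_eq_iff intro: eq_if_coords_eq)
  show "range (\<lambda>h n. cinner h (e n)) = ell2"
    using exists_vector_with_coords by (auto simp: coords_in_ell2 image_iff fun_eq_iff) metis
qed

lemma bij_betw_cnj_coords: "bij_betw (\<lambda>h n. cinner (e n) h) UNIV ell2"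
proof -
  have 1: "bij_betw (\<lambda>a n. cnj (a n)) ell2 ell2"
    by (rule bij_betwI [where g = "\<lambda>a n. cnj (a n)"]) (auto simp: ell2_def)
  have "(\<lambda>h n. cinner (e n) h) = (\<lambda>a n. cnj (a n)) \<circ> (\<lambda>h n. cinner h (e n))"
    by (simp add: fun_eq_iff flip: cinner_commute)
  then show ?thesis using bij_betw_trans [OF bij_betw_coords 1] by simp
qed

lemma ell2_norm_cnj_coords: "ell2_norm (\<lambda>n. cinner (e n) h) = norm h"
proof -
  have "(\<lambda>n. cinner (e n) h) = (\<lambda>n. cnj (cinner h (e n)))"
    by (rule ext) (rule cinner_commute)
  then have "ell2_norm (\<lambda>n. cinner (e n) h) = ell2_norm (\<lambda>n. cinner h (e n))"
    by (simp add: ell2_norm_def)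
  then show ?thesis by (simp add: ell2_norm_coords)
qed

lemma trace_norm_rank_one: "trace_norm (rank_one f g) = norm f * norm g"
proof (cases "f = 0")
  case True
  then show ?thesis
    using trace_norm_rank_one_le [of f g] trace_norm_nonneg [OF rank_one_trace_class, of f g] by simp
next
  case False
  have "norm (rank_one f g f) \<le> trace_norm (rank_one f g) * norm f"
    by (rule norm_le_trace_norm [OF rank_one_trace_class])
  then have "norm f * norm g \<le> trace_norm (rank_one f g)"
    using False by (simp add: rank_one_def norm_scaleC cinner_self power2_eq_square norm_mult)
  then show ?thesis using trace_norm_rank_one_le [of f g] by simp
qed

lemma column_space:
  "closed_csubspace_on trace_class trace_norm (range (rank_one (e i)))"
  "isomorphic_on (range (rank_one (e i))) trace_norm ell2 ell2_norm"
proof -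
  have "range (rank_one (e i)) =
      {A \<in> trace_class. \<forall>x y. (x, y) \<in> {(x, y). cinner x (e i) = 0} \<longrightarrow> cinner (A x) y = 0}" (is "_ = ?W")
  proof (intro equalityI subsetI)
    fix A assume "A \<in> ?W"
    then have A: "A \<in> trace_class" and "\<And>x y. cinner x (e i) = 0 \<Longrightarrow> cinner (A x) y = 0" by auto
    then have zero: "\<And>x. cinner x (e i) = 0 \<Longrightarrow> A x = 0"
      by (blast intro: cinner_eq_zero_imp_zero)
    note bA = trace_class_bounded_op [OF A]
    have form: "A x = cinner x (e i) *\<^sub>C A (e i)" for x
    proof -
      have "A (x - cinner x (e i) *\<^sub>C e i) = 0"
        by (rule zero) (simp add: cinner.diff_left cinner_scaleC_left cinner_e)
      then show ?thesis by (simp add: bounded_op_diff [OF bA] bounded_op_scaleC [OF bA])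
    qed
    have "A = rank_one (e i) (A (e i))"
      by (intro ext) (simp only: rank_one_def form [symmetric])
    then show "A \<in> range (rank_one (e i))" by (rule range_eqI)
  qed (auto simp: rank_one_trace_class rank_one_def complex_vector.scale_zero_left cinner.zero_left)
  then show "closed_csubspace_on trace_class trace_norm (range (rank_one (e i)))"
    by (simp only: closed_csubspace_matrix_zeros)
  have "cinner (rank_one (e i) h (e i)) (e n) = cinner h (e n)" for h n
    by (simp add: rank_one_def cinner_e complex_vector.scale_one)
  then show "isomorphic_on (range (rank_one (e i))) trace_norm ell2 ell2_norm"
    using bij_betw_coords ell2_norm_coords
    by (intro isomorphic_ell2_if_coordinates [where u = "\<lambda>n. e i" and v = e])
      (simp_all add: trace_norm_rank_one)
qed

lemma row_space:
  "closed_csubspace_on trace_class trace_norm (range (\<lambda>h. rank_one h (e i)))"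
  "isomorphic_on (range (\<lambda>h. rank_one h (e i))) trace_norm ell2 ell2_norm"
proof -
  have "range (\<lambda>h. rank_one h (e i)) =
      {A \<in> trace_class. \<forall>x y. (x, y) \<in> {(x, y). cinner y (e i) = 0} \<longrightarrow> cinner (A x) y = 0}" (is "_ = ?W")
  proof (intro equalityI subsetI)
    fix A assume "A \<in> ?W"
    then have A: "A \<in> trace_class" and zero: "\<And>x y. cinner y (e i) = 0 \<Longrightarrow> cinner (A x) y = 0" by auto
    note bA = trace_class_bounded_op [OF A]
    have "A x = cinner x (adjoint_op A (e i)) *\<^sub>C e i" for x
    proof -
      define y where "y = A x - cinner (A x) (e i) *\<^sub>C e i"
      have 0: "cinner y (e i) = 0"
        by (simp add: y_def cinner.diff_left cinner_scaleC_left cinner_e)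
      then have "cinner (e i) y = 0" by (metis cinner_commute complex_cnj_zero)
      with zero [OF 0, of x] have "cinner y y = 0"
        by (subst y_def) (simp add: cinner.diff_left cinner_scaleC_left)
      then have "y = 0" by (simp add: cinner_self)
      then show ?thesis by (simp add: y_def cinner_adjoint [OF bA])
    qed
    then have "A = rank_one (adjoint_op A (e i)) (e i)" by (simp add: fun_eq_iff rank_one_def)
    then show "A \<in> range (\<lambda>h. rank_one h (e i))" by (rule range_eqI)
  next
    fix A assume "A \<in> range (\<lambda>h. rank_one h (e i))"
    moreover have "cinner (e i) y = 0" if "cinner y (e i) = 0" for y
      using that by (metis cinner_commute complex_cnj_zero)
    ultimately show "A \<in> ?W"
      by (auto simp: rank_one_trace_class rank_one_def cinner_scaleC_left)
  qed
  then show "closed_csubspace_on trace_class trace_norm (range (\<lambda>h. rank_one h (e i)))"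
    by (simp only: closed_csubspace_matrix_zeros)
  have "cinner (rank_one h (e i) (e n)) (e i) = cinner (e n) h" for h n
    by (simp add: rank_one_def cinner_e cinner_scaleC_left)
  then show "isomorphic_on (range (\<lambda>h. rank_one h (e i))) trace_norm ell2 ell2_norm"
    using bij_betw_cnj_coords ell2_norm_cnj_coords
    by (intro isomorphic_ell2_if_coordinates [where u = e and v = "\<lambda>n. e i"])
      (simp_all add: trace_norm_rank_one)
qed

text \<open>Linearity of \<open>G\<close> over the reals allows for conjugate linear parametrizations.\<close>

lemma ell2_compact_on_copy_maps_weakly_null:
  fixes T :: "('h \<Rightarrow> 'h) \<Rightarrow> 'z::complex_banach" and G :: "'h \<Rightarrow> 'h \<Rightarrow> 'h"
  assumes T: "bounded_clinear_on trace_class trace_norm T"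
    and comp: "ell2_compact_on trace_class trace_norm T"
    and W: "closed_csubspace_on trace_class trace_norm (range G)"
      "isomorphic_on (range G) trace_norm ell2 ell2_norm"
    and G: "\<And>h. trace_norm (G h) = norm h" "\<And>h k. G (h + k) = G h + G k"
      "\<And>r h. G (r *\<^sub>R h) = complex_of_real r *\<^sub>C G h"
    and h: "hilbert_weakly_null h"
  shows "(\<lambda>n. T (G (h n))) \<longlonglongrightarrow> 0"
proof (rule compact_on_ball_maps_weakly_null [OF _ _ h])
  have tc: "G k \<in> trace_class" for k using W(1) by (auto simp: closed_csubspace_on_def)
  obtain K where K: "\<And>A. A \<in> trace_class \<Longrightarrow> norm (T A) \<le> K * trace_norm A"
    using T unfolding bounded_clinear_on_def by blast
  show "bounded_linear (\<lambda>k. T (G k))"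
  proof (rule bounded_linear_intro)
    show "norm (T (G k)) \<le> norm k * K" for k using K [OF tc, of k] by (simp add: G mult.commute)
    show "T (G (k + l)) = T (G k) + T (G l)" for k l
      using T tc by (simp only: G(2) bounded_clinear_on_def)
    have "T (c *\<^sub>C A) = c *\<^sub>C T A" if "A \<in> trace_class" for c A
      using T that by (simp add: bounded_clinear_on_def)
    then show "T (G (r *\<^sub>R k)) = r *\<^sub>R T (G k)" for r k
      unfolding G(3) by (simp add: tc scaleR_scaleC)
  qed
  have "(\<lambda>k. T (G k)) ` {k. norm k \<le> 1} = T ` {A \<in> range G. trace_norm A \<le> 1}"
    by (auto simp: G)
  then show "compact (closure ((\<lambda>k. T (G k)) ` {k. norm k \<le> 1}))"
    using comp W unfolding ell2_compact_on_def compact_operator_on_def by simp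
qed

lemma sum_fun_apply: "(\<Sum>i\<in>I. f i) x = (\<Sum>i\<in>I. f i x)" for f :: "'i \<Rightarrow> 'a \<Rightarrow> 'b::comm_monoid_add"
  by (induction I rule: infinite_finite_induct) auto

text \<open>The first \<open>N\<close> rows, the remaining part of the first \<open>N\<close> columns, and a corner.\<close>

lemma rows_columns_corner:
  assumes A: "bounded_op A"
  shows "A = (\<Sum>i<N. rank_one (adjoint_op A (e i)) (e i))
      + ((\<Sum>i<N. rank_one (e i) (coproj N (A (e i)))) + corner N A)"
proof
  fix x
  have "A x = proj {..<N} (A x) + (coproj N (A (proj {..<N} x)) + coproj N (A (coproj N x)))"
    by (simp add: coproj_def bounded_op_diff [OF A] bounded_op_diff [OF bounded_op_proj])
  also have "proj {..<N} (A x) = (\<Sum>i<N. rank_one (adjoint_op A (e i)) (e i) x)"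
    by (simp add: proj_def rank_one_def cinner_adjoint [OF A])
  also have "coproj N (A (proj {..<N} x)) = (\<Sum>i<N. rank_one (e i) (coproj N (A (e i))) x)"
    by (simp add: proj_def rank_one_def bounded_op_sum [OF A] bounded_op_scaleC [OF A]
        bounded_op_sum [OF bounded_op_coproj] bounded_op_scaleC [OF bounded_op_coproj])
  finally show "A x = ((\<Sum>i<N. rank_one (adjoint_op A (e i)) (e i))
      + ((\<Sum>i<N. rank_one (e i) (coproj N (A (e i)))) + corner N A)) x"
    by (simp add: sum_fun_apply corner_def)
qed

text \<open>On rows and columns the operator is compact and so annihilates weakly null sequences in
  the limit; the corners are uniformly small.\<close>

lemma ell2_compact_imp_dunford_pettis:
  fixes T :: "('h \<Rightarrow> 'h) \<Rightarrow> 'z::complex_banach"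
  assumes T: "bounded_clinear_on trace_class trace_norm T"
    and comp: "ell2_compact_on trace_class trace_norm T"
  shows "dunford_pettis_on trace_class trace_norm T"
  unfolding dunford_pettis_on_def
proof (intro allI impI)
  fix x :: "nat \<Rightarrow> 'h \<Rightarrow> 'h" assume weak: "weakly_null_on trace_class trace_norm x"
  have tc: "x n \<in> trace_class" for n using weak by (auto simp: weakly_null_on_def)
  note bx = trace_class_bounded_op [OF tc]
  have entries: "(\<lambda>n. cinner (x n u) v) \<longlonglongrightarrow> 0" for u v
    using weak matrix_entry_functional unfolding weakly_null_on_def by blast
  have T_add: "T (A + B) = T A + T B" if "A \<in> trace_class" "B \<in> trace_class" for A B
    using T that by (simp add: bounded_clinear_on_def)
  have T_0: "T 0 = 0"
    using T_add [OF trace_class_zero trace_class_zero] by simp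
  have T_sum: "(\<Sum>i<N. B i) \<in> trace_class \<and> T (\<Sum>i<N. B i) = (\<Sum>i<N. T (B i))"
    if "\<And>i. B i \<in> trace_class" for B :: "nat \<Rightarrow> 'h \<Rightarrow> 'h" and N
  proof (induction N)
    case 0
    then show ?case by (simp only: lessThan_0 sum.empty T_0 trace_class_zero simp_thms)
  next
    case (Suc N)
    then show ?case
      by (simp only: sum.lessThan_Suc T_add that trace_class_add simp_thms)
  qed
  have T_x: "T (x n) = (\<Sum>i<N. T (rank_one (adjoint_op (x n) (e i)) (e i)))
      + ((\<Sum>i<N. T (rank_one (e i) (coproj N (x n (e i))))) + T (corner N (x n)))" for n N
    by (subst rows_columns_corner [OF bx])
      (simp add: T_add T_sum rank_one_trace_class corner_trace_class tc trace_class_add)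
  have rows: "(\<lambda>n. T (rank_one (adjoint_op (x n) (e i)) (e i))) \<longlonglongrightarrow> 0" for i
  proof (rule ell2_compact_on_copy_maps_weakly_null [OF T comp row_space])
    have "(\<lambda>n. cnj (cinner (x n y) (e i))) \<longlonglongrightarrow> cnj 0" for y
      by (intro tendsto_cnj entries)
    moreover have "cnj (cinner (x n y) (e i)) = cinner (adjoint_op (x n) (e i)) y" for n y
      by (metis cinner_adjoint' [OF bx] cinner_commute)
    ultimately show "hilbert_weakly_null (\<lambda>n. adjoint_op (x n) (e i))"
      by (simp add: hilbert_weakly_null_def)
  qed (simp_all add: trace_norm_rank_one fun_eq_iff rank_one_def cinner_add_right cinner_scaleR_right
      scaleC_add_left scaleC_fun_def scaleC_scaleC)
  have columns: "(\<lambda>n. T (rank_one (e i) (coproj N (x n (e i))))) \<longlonglongrightarrow> 0" for i N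
  proof (rule ell2_compact_on_copy_maps_weakly_null [OF T comp column_space])
    show "hilbert_weakly_null (\<lambda>n. coproj N (x n (e i)))"
      using entries by (simp add: hilbert_weakly_null_def coproj_selfadjoint)
  qed (simp_all add: trace_norm_rank_one fun_eq_iff rank_one_def scaleC_add_right scaleC_fun_def
      scaleC_scaleC scaleR_scaleC mult.commute)
  obtain K where K: "\<And>A. A \<in> trace_class \<Longrightarrow> norm (T A) \<le> K * trace_norm A"
    using T unfolding bounded_clinear_on_def by blast
  show "(\<lambda>n. T (x n)) \<longlonglongrightarrow> 0"
  proof (rule LIMSEQ_I)
    fix \<epsilon> :: real assume "\<epsilon> > 0"
    define M where "M = \<bar>K\<bar> + 1"
    have M: "M > 0" "K \<le> M" by (simp_all add: M_def add_nonneg_pos)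
    define \<delta> where "\<delta> = \<epsilon> / (2 * M)"
    have "\<delta> > 0" using \<open>\<epsilon> > 0\<close> M by (simp add: \<delta>_def)
    then obtain N where N: "\<And>n. trace_norm (corner N (x n)) \<le> \<delta>"
      using weakly_null_corners_uniformly_small [OF weak] by blast
    have corner: "norm (T (corner N (x n))) \<le> \<epsilon> / 2" for n
    proof -
      have ct: "corner N (x n) \<in> trace_class" by (rule corner_trace_class [OF tc])
      have "norm (T (corner N (x n))) \<le> M * trace_norm (corner N (x n))"
        using trace_norm_nonneg [OF ct] M by (intro order_trans [OF K [OF ct]] mult_right_mono) auto
      also have "\<dots> \<le> M * \<delta>" using M by (intro mult_left_mono N) simp
      also have "\<dots> = \<epsilon> / 2" using M by (simp add: \<delta>_def)
      finally show ?thesis .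
    qed
    have "(\<lambda>n. (\<Sum>i<N. T (rank_one (adjoint_op (x n) (e i)) (e i)))
        + (\<Sum>i<N. T (rank_one (e i) (coproj N (x n (e i)))))) \<longlonglongrightarrow> (\<Sum>i<N. 0) + (\<Sum>i<N. 0)"
      by (intro tendsto_add tendsto_sum rows columns)
    then obtain n0 where n0: "\<And>n. n \<ge> n0 \<Longrightarrow> norm ((\<Sum>i<N. T (rank_one (adjoint_op (x n) (e i)) (e i)))
        + (\<Sum>i<N. T (rank_one (e i) (coproj N (x n (e i)))))) < \<epsilon> / 2"
      using LIMSEQ_D [of _ 0 "\<epsilon> / 2"] \<open>\<epsilon> > 0\<close> by fastforce
    have "norm (T (x n)) < \<epsilon>" if "n \<ge> n0" for n
      unfolding T_x [of n N] add.assoc [symmetric]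
      using norm_triangle_ineq n0 [OF that] corner [of n] by (smt (verit) field_sum_of_halves)
    then show "\<exists>no. \<forall>n\<ge>no. norm (T (x n) - 0) < \<epsilon>" by auto
  qed
qed

end

theorem proposition4p11:
  fixes T :: "('h::chilbert_space \<Rightarrow> 'h) \<Rightarrow> 'z::complex_banach"
  assumes "separable_space (euclidean :: 'h topology)"
    and "\<not> (\<exists>B::'h set. finite B \<and> complex_vector.span B = UNIV)"
    and "bounded_clinear_on trace_class trace_norm T"
  shows "dunford_pettis_on trace_class trace_norm T \<longleftrightarrow> ell2_compact_on trace_class trace_norm T"
proof -
  obtain e :: "nat \<Rightarrow> 'h" where "onb_sequence e"
    using onb_sequence_exists assms(1,2) by blast
  then interpret onb_sequence e .
  show ?thesis
    using dunford_pettis_imp_ell2_compact ell2_compact_imp_dunford_pettis assms(3) by blast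
qed

end
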